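(* Let $d\ge 2$, let $\Omega=B_1(0)\subset\mathbb{R}^d$ be the unit ball, and let $0<\widehat m<m_0$, where $m_0$ is the critical mass of $\Omega$ defined in the context. Let $\ell_{\min}\in[0,\widehat m/|\partial\Omega|)$ and set $m:=\widehat m-\ell_{\min}|\partial\Omega|>0$. Then there exists no radially symmetric solution (minimizer) $u$ of the eigenvalue problem $$\lambda_{m,\ell_{\min}}(\Omega)=\min_{0\neq u\in H^1(\Omega)}\frac{\int_\Omega|\nabla u|^2\,\mathrm{d}x+\int_{\partial\Omega}\frac{u^2}{\ell_{\min}+h_u}\,\mathrm{d}s}{\int_\Omega u^2\,\mathrm{d}x},$$ where $h_u$ is the optimal distribution of mass $m$ associated with $u$, as defined in the context.
   Context: $|\partial\Omega|$ denotes the surface measure of $\partial\Omega$; boundary values of $H^1$ functions are traces. For $m>0$ let $\mathcal{H}_m(\partial\Omega)=\{\ell\in L^1(\partial\Omega):\ell\ge0,\ \int_{\partial\Omega}\ell\,\mathrm{d}s=m\}$. Optimal distribution: for $\ell_{\min}>0$ and $u\in H^1(\Omega)$ with nonzero trace, $h_u=\frac{\ell_{\min}}{c_u}|u|-\ell_{\min}$ where $|u|\ge c_u$ on $\partial\Omega$, and $h_u=0$ elsewhere on $\partial\Omega$, where $c_u>0$ is the unique positive constant with $$c_u=\Big(\big|\{|u|\ge c_u\}\big|+\frac{m}{\ell_{\min}}\Big)^{-1}\int_{\{|u|\ge c_u\}}|u|\,\mathrm{d}s$$ (sets are subsets of $\partial\Omega$). The function $h_u$ minimizes $\ell\mapsto\int_{\partial\Omega}\frac{u^2}{\ell_{\min}+\ell}\,\mathrm{d}s$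 over $\mathcal{H}_m(\partial\Omega)$. For $\ell_{\min}=0$ (so $m=\widehat m$), the optimal distribution is $h_u=m|u|/\int_{\partial\Omega}|u|\,\mathrm{d}s$, so that the boundary term is $\frac1m\big(\int_{\partial\Omega}|u|\,\mathrm{d}s\big)^2$. If the trace of $u$ vanishes, the boundary term is $0$. Critical mass: for $m>0$ let $$\lambda_m(\Omega)=\inf\Big\{\int_\Omega|\nabla u|^2\,\mathrm{d}x+\frac1m\|u\|_{L^1(\partial\Omega)}^2:\ u\in H^1(\Omega),\ \|u\|_{L^2(\Omega)}=1\Big\}.$$ It is known (Bucur–Buttazzo–Nitsch) that for the ball there is $m_0>0$ such that minimizers of $\lambda_m(\Omega)$ are radial if $m>m_0$ and are not radial if $0<m<m_0$; this $m_0$ is the unique positive $m$ with $\lambda_m(\Omega)=\mu_2(\Omega)$, the first nonzero eigenvalue of the Neumann Laplacian on $\Omega$. *)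

theory Defs
  imports "HOL-Analysis.Analysis"
begin

definition grad :: "('a::euclidean_space \<Rightarrow> real) \<Rightarrow> 'a \<Rightarrow> 'a" where
  "grad f x = (\<Sum>b\<in>Basis. frechet_derivative f (at x) b *\<^sub>R b)"

primrec Ck :: "nat \<Rightarrow> ('a::euclidean_space \<Rightarrow> real) \<Rightarrow> bool" where
  "Ck 0 f \<longleftrightarrow> continuous_on UNIV f"
| "Ck (Suc k) f \<longleftrightarrow> (\<forall>x. f differentiable (at x)) \<and>
     (\<forall>b\<in>Basis. Ck k (\<lambda>x. frechet_derivative f (at x) b))"

definition smooth :: "('a::euclidean_space \<Rightarrow> real) \<Rightarrow> bool" where
  "smooth f \<longleftrightarrow> (\<forall>k. Ck k f)"

definition test_function :: "'a::euclidean_space set \<Rightarrow> ('a \<Rightarrow> real) \<Rightarrow> bool" where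
  "test_function \<Omega> \<phi> \<longleftrightarrow> smooth \<phi> \<and>
     compact (closure {x. \<phi> x \<noteq> 0}) \<and> closure {x. \<phi> x \<noteq> 0} \<subseteq> \<Omega>"

definition L2 :: "'a measure \<Rightarrow> ('a \<Rightarrow> 'b::euclidean_space) \<Rightarrow> bool" where
  "L2 M f \<longleftrightarrow> f \<in> borel_measurable M \<and> integrable M (\<lambda>x. (norm (f x))\<^sup>2)"

definition has_weak_gradient ::
  "'a::euclidean_space set \<Rightarrow> ('a \<Rightarrow> real) \<Rightarrow> ('a \<Rightarrow> 'a) \<Rightarrow> bool" where
  "has_weak_gradient \<Omega> u G \<longleftrightarrow> L2 (lebesgue_on \<Omega>) G \<and>
     (\<forall>\<phi>. test_function \<Omega> \<phi> \<longrightarrow>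
        (\<integral>x. u x *\<^sub>R grad \<phi> x \<partial>lebesgue_on \<Omega>) = - (\<integral>x. \<phi> x *\<^sub>R G x \<partial>lebesgue_on \<Omega>))"

definition H1 :: "'a::euclidean_space set \<Rightarrow> ('a \<Rightarrow> real) set" where
  "H1 \<Omega> = {u. L2 (lebesgue_on \<Omega>) u \<and> (\<exists>G. has_weak_gradient \<Omega> u G)}"

definition wgrad :: "'a::euclidean_space set \<Rightarrow> ('a \<Rightarrow> real) \<Rightarrow> 'a \<Rightarrow> 'a" where
  "wgrad \<Omega> u = (SOME G. has_weak_gradient \<Omega> u G)"

text \<open>Elements of \<open>H1 \<Omega>\<close> are functions, not classes; this is being nonzero in the quotient.\<close>

definition nonzero :: "'a::euclidean_space set \<Rightarrow> ('a \<Rightarrow> real) \<Rightarrow> bool" where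
  "nonzero \<Omega> u \<longleftrightarrow> \<not> (AE x in lebesgue_on \<Omega>. u x = 0)"

text \<open>
  Surface measure of the unit sphere: a Borel set \<open>A\<close> of the sphere has measure \<open>d\<close> times the
  volume of the cone \<open>{t x | 0 < t < 1, x \<in> A}\<close>, which is the preimage of \<open>A\<close> under
  \<open>x \<mapsto> x / |x|\<close> in the punctured unit ball.
\<close>

definition sphere_measure :: "'a::euclidean_space measure" where
  "sphere_measure = scale_measure (of_nat DIM('a))
     (distr (restrict_space lborel (ball 0 1 - {0})) (restrict_space borel (sphere 0 1)) sgn)"

text \<open>
  Below, \<open>\<Omega>\<close> is a bounded Lipschitz domain and \<open>\<sigma>\<close> the surface measure of its boundary.
  The trace operator is the continuous extension of the restriction map from smooth functions up
  to the boundary, which are dense in \<open>H1 \<Omega>\<close>.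
\<close>

definition has_trace ::
  "'a::euclidean_space set \<Rightarrow> 'a measure \<Rightarrow> ('a \<Rightarrow> real) \<Rightarrow> ('a \<Rightarrow> real) \<Rightarrow> bool" where
  "has_trace \<Omega> \<sigma> u g \<longleftrightarrow> L2 \<sigma> g \<and> (\<exists>\<phi> :: nat \<Rightarrow> 'a \<Rightarrow> real. (\<forall>n. smooth (\<phi> n)) \<and>
     (\<lambda>n. \<integral>x. (\<phi> n x - u x)\<^sup>2 \<partial>lebesgue_on \<Omega>) \<longlonglongrightarrow> 0 \<and>
     (\<lambda>n. \<integral>x. (norm (grad (\<phi> n) x - wgrad \<Omega> u x))\<^sup>2 \<partial>lebesgue_on \<Omega>) \<longlonglongrightarrow> 0 \<and>
     (\<lambda>n. \<integral>x. (\<phi> n x - g x)\<^sup>2 \<partial>\<sigma>) \<longlonglongrightarrow> 0)"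

definition boundary_trace ::
  "'a::euclidean_space set \<Rightarrow> 'a measure \<Rightarrow> ('a \<Rightarrow> real) \<Rightarrow> 'a \<Rightarrow> real" where
  "boundary_trace \<Omega> \<sigma> u = (SOME g. has_trace \<Omega> \<sigma> u g)"

text \<open>The constant \<open>c\<^sub>u\<close>; here and in the next two definitions \<open>g\<close> is the trace of \<open>u\<close>.\<close>

definition threshold :: "'a measure \<Rightarrow> real \<Rightarrow> real \<Rightarrow> ('a \<Rightarrow> real) \<Rightarrow> real" where
  "threshold \<sigma> lmin m g = (THE c. c > 0 \<and>
     c = inverse (measure \<sigma> {x \<in> space \<sigma>. \<bar>g x\<bar> \<ge> c} + m / lmin) *
         (\<integral>x\<in>{x \<in> space \<sigma>. \<bar>g x\<bar> \<ge> c}. \<bar>g x\<bar> \<partial>\<sigma>))"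

definition optimal_distribution ::
  "'a measure \<Rightarrow> real \<Rightarrow> real \<Rightarrow> ('a \<Rightarrow> real) \<Rightarrow> 'a \<Rightarrow> real" where
  "optimal_distribution \<sigma> lmin m g x =
     (if lmin = 0 then m * \<bar>g x\<bar> / (\<integral>y. \<bar>g y\<bar> \<partial>\<sigma>)
      else let c = threshold \<sigma> lmin m g
           in if \<bar>g x\<bar> \<ge> c then lmin / c * \<bar>g x\<bar> - lmin else 0)"

text \<open>
  The integrand is \<open>0\<close> wherever \<open>g x = 0\<close>, also where the denominator vanishes.  Hence the term is
  \<open>0\<close> if the trace vanishes almost everywhere, when \<^const>\<open>threshold\<close> is unspecified, and it is
  \<open>(\<integral>|g|)\<^sup>2 / m\<close> if \<open>lmin = 0\<close>.
\<close>

definition boundary_term :: "'a measure \<Rightarrow> real \<Rightarrow> real \<Rightarrow> ('a \<Rightarrow> real) \<Rightarrow> real" where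
  "boundary_term \<sigma> lmin m g =
     (\<integral>x. (g x)\<^sup>2 / (lmin + optimal_distribution \<sigma> lmin m g x) \<partial>\<sigma>)"

definition rayleigh_quotient ::
  "'a::euclidean_space set \<Rightarrow> 'a measure \<Rightarrow> real \<Rightarrow> real \<Rightarrow> ('a \<Rightarrow> real) \<Rightarrow> real" where
  "rayleigh_quotient \<Omega> \<sigma> lmin m u =
     ((\<integral>x. (norm (wgrad \<Omega> u x))\<^sup>2 \<partial>lebesgue_on \<Omega>) + boundary_term \<sigma> lmin m (boundary_trace \<Omega> \<sigma> u))
       / (\<integral>x. (u x)\<^sup>2 \<partial>lebesgue_on \<Omega>)"

definition minimizer ::
  "'a::euclidean_space set \<Rightarrow> 'a measure \<Rightarrow> real \<Rightarrow> real \<Rightarrow> ('a \<Rightarrow> real) \<Rightarrow> bool" where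
  "minimizer \<Omega> \<sigma> lmin m u \<longleftrightarrow> u \<in> H1 \<Omega> \<and> nonzero \<Omega> u \<and>
     (\<forall>w\<in>H1 \<Omega>. nonzero \<Omega> w \<longrightarrow> rayleigh_quotient \<Omega> \<sigma> lmin m u \<le> rayleigh_quotient \<Omega> \<sigma> lmin m w)"

definition radially_symmetric :: "'a::euclidean_space set \<Rightarrow> ('a \<Rightarrow> real) \<Rightarrow> bool" where
  "radially_symmetric \<Omega> u \<longleftrightarrow> (\<exists>f. AE x in lebesgue_on \<Omega>. u x = f (norm x))"

definition lambda_m :: "'a::euclidean_space set \<Rightarrow> 'a measure \<Rightarrow> real \<Rightarrow> real" where
  "lambda_m \<Omega> \<sigma> m = Inf {(\<integral>x. (norm (wgrad \<Omega> u x))\<^sup>2 \<partial>lebesgue_on \<Omega>)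
       + 1 / m * (\<integral>x. \<bar>boundary_trace \<Omega> \<sigma> u x\<bar> \<partial>\<sigma>)\<^sup>2 | u.
     u \<in> H1 \<Omega> \<and> sqrt (\<integral>x. (u x)\<^sup>2 \<partial>lebesgue_on \<Omega>) = 1}"

definition neumann_eigenvalue :: "'a::euclidean_space set \<Rightarrow> real \<Rightarrow> bool" where
  "neumann_eigenvalue \<Omega> \<mu> \<longleftrightarrow> (\<exists>u\<in>H1 \<Omega>. nonzero \<Omega> u \<and>
     (\<forall>w\<in>H1 \<Omega>. (\<integral>x. wgrad \<Omega> u x \<bullet> wgrad \<Omega> w x \<partial>lebesgue_on \<Omega>)
                 = \<mu> * (\<integral>x. u x * w x \<partial>lebesgue_on \<Omega>)))"

definition first_nonzero_neumann_eigenvalue :: "'a::euclidean_space set \<Rightarrow> real \<Rightarrow> bool" where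
  "first_nonzero_neumann_eigenvalue \<Omega> \<mu> \<longleftrightarrow> neumann_eigenvalue \<Omega> \<mu> \<and> \<mu> \<noteq> 0 \<and>
     (\<forall>\<nu>. neumann_eigenvalue \<Omega> \<nu> \<and> \<nu> \<noteq> 0 \<longrightarrow> \<mu> \<le> \<nu>)"

text \<open>\<open>m0\<close> is the unique positive mass \<open>m\<close> with \<open>\<lambda>\<^sub>m(\<Omega>) = \<mu>\<^sub>2(\<Omega>)\<close>.\<close>

definition critical_mass :: "'a::euclidean_space set \<Rightarrow> 'a measure \<Rightarrow> real \<Rightarrow> bool" where
  "critical_mass \<Omega> \<sigma> m0 \<longleftrightarrow>
     m0 > 0 \<and> first_nonzero_neumann_eigenvalue \<Omega> (lambda_m \<Omega> \<sigma> m0) \<and>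
     (\<forall>m>0. first_nonzero_neumann_eigenvalue \<Omega> (lambda_m \<Omega> \<sigma> m) \<longrightarrow> m = m0)"

end

theory Submission
  imports Defs
begin

text \<open>Let \<open>u\<close> be a radial minimizer with value \<open>q\<close>, and let
  \<open>\<mu>\<close> be the value of \<^const>\<open>lambda_m\<close> at \<open>m0\<close>. The trace of \<open>u\<close> is a constant \<open>a\<close> (\<open>radial_has_trace_const\<close>). For a trace \<open>g\<close> close to a
  nonzero constant the whole sphere lies above the threshold, and the boundary term is
  \<open>(\<integral>g)\<^sup>2 / mhat\<close> (\<open>boundary_term_nearly_constant\<close>), a quadratic form in which \<open>lmin\<close> enters through the total
  mass alone. So \<open>q\<close> is the quotient of \<open>u\<close> for \<open>lmin = 0\<close> and the mass \<open>mhat\<close>. Since \<open>mhat < m0\<close>, comparison with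
  the infimum \<open>\<mu>\<close> gives \<open>\<mu> \<le> q\<close>, with strict inequality if \<open>a \<noteq> 0\<close> (\<open>lambda_m_le\<close>).

  If \<open>a \<noteq> 0\<close>, the second variation at \<open>u\<close> says that \<open>q \<integral>\<phi>\<^sup>2 \<le> \<integral>\<bar>grad \<phi>\<bar>\<^sup>2\<close> for every smooth \<open>\<phi>\<close> with
  mean zero over the sphere (\<open>minimizer_second_variation\<close>). A Neumann eigenfunction \<open>v\<close> for \<open>\<mu> \<noteq> 0\<close> has mean zero
  over the ball. Subtracting a constant from it, so that the mean over the sphere vanishes, preserves the
  gradient and does not decrease the \<open>L2\<close> norm. Hence \<open>q \<le> \<mu>\<close> (\<open>neumann_eigenvalue_ge\<close>), a contradiction.

  If \<open>a = 0\<close>, perturb \<open>u\<close> by small multiples of a smooth function plus a large constant, whose traces are nearly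
  constant. The boundary term is then of second order, so \<open>u\<close> satisfies the Neumann equation with eigenvalue
  \<open>q > 0\<close> in addition to its zero trace. Testing with the powers of \<open>x \<bullet> x\<close> makes all radial moments of \<open>u\<close>
  vanish, and then \<open>u = 0\<close> (\<open>no_radial_minimizer_zero_trace\<close>).

  These arguments use smooth competitors. Mollification after a slight dilation of the ball
  approximates every function in \<open>H1\<close> by smooth ones and preserves radial symmetry
  (\<open>mollify_H1_tendsto\<close>, \<open>mollify_radial\<close>); it also shows that weak gradients are unique. The divergence
  theorem for the fields \<open>f x *\<^sub>R x\<close> (\<open>radial_divergence\<close>) gives the trace inequality, hence uniqueness of traces,
  and the recursion for the moments.\<close>

section \<open>Calculus of smooth functions and a smooth bump\<close>

text \<open>The definition of \<open>Ck\<close> refers to \<^const>\<open>frechet_derivative\<close>, a choice operator; this form admits any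
  derivative that is at hand.\<close>

lemma Ck_SucI:
  assumes "\<And>x. (f has_derivative f' x) (at x)" and "\<And>b. b \<in> Basis \<Longrightarrow> Ck k (\<lambda>x. f' x b)"
  shows "Ck (Suc k) f"
proof -
  have "frechet_derivative f (at x) = f' x" for x
    using assms(1) frechet_derivative_at by metis
  then show ?thesis
    using assms by (auto simp: differentiable_def)
qed

lemma Ck_Suc_has_derivative:
  "Ck (Suc k) f \<Longrightarrow> (f has_derivative frechet_derivative f (at x)) (at x)"
  by (simp add: frechet_derivative_works)

lemma Ck_Suc_imp_Ck: "Ck (Suc k) f \<Longrightarrow> Ck k f"
proof (induction k arbitrary: f)
  case 0
  then show ?case
    by (auto intro!: continuous_at_imp_continuous_on differentiable_imp_continuous_within)
qed auto

lemma Ck_const: "Ck k (\<lambda>x. c)"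
proof (induction k arbitrary: c)
  case (Suc k)
  show ?case
    by (rule Ck_SucI[where f' = "\<lambda>x h. 0"]) (use Suc in auto)
qed simp

lemma Ck_add: "Ck k f \<Longrightarrow> Ck k g \<Longrightarrow> Ck k (\<lambda>x. f x + g x)"
proof (induction k arbitrary: f g)
  case (Suc k)
  show ?case
    by (rule Ck_SucI[OF has_derivative_add[OF Ck_Suc_has_derivative Ck_Suc_has_derivative]])
      (use Suc in auto)
qed (auto intro: continuous_on_add)

lemma Ck_mult: "Ck k f \<Longrightarrow> Ck k g \<Longrightarrow> Ck k (\<lambda>x. f x * g x)"
proof (induction k arbitrary: f g)
  case (Suc k)
  have "Ck k f" "Ck k g"
    using Suc.prems Ck_Suc_imp_Ck by blast+
  then show ?case
    by (intro Ck_SucI[OF has_derivative_mult[OF Ck_Suc_has_derivative Ck_Suc_has_derivative]]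
         Ck_add Suc.IH) (use Suc.prems in auto)
qed (auto intro: continuous_on_mult)

lemma Ck_inner: "Ck k (\<lambda>x::'a::euclidean_space. x \<bullet> b)"
proof (cases k)
  case 0
  then show ?thesis by (auto intro!: continuous_intros)
next
  case (Suc k)
  show ?thesis
    unfolding Suc by (rule Ck_SucI[where f' = "\<lambda>x h. h \<bullet> b"]) (auto intro!: derivative_eq_intros Ck_const)
qed

lemma Ck_sum: "(\<And>i. i \<in> A \<Longrightarrow> Ck k (f i)) \<Longrightarrow> Ck k (\<lambda>x. \<Sum>i\<in>A. f i x)"
  by (induction A rule: infinite_finite_induct) (auto intro: Ck_const Ck_add)

lemma Ck_affine:
  fixes f :: "'a::euclidean_space \<Rightarrow> real"
  shows "Ck k f \<Longrightarrow> Ck k (\<lambda>x. f (c *\<^sub>R x + z))"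
proof (induction k arbitrary: f)
  case 0
  have "continuous_on UNIV (\<lambda>x. c *\<^sub>R x + z)"
    by (intro continuous_intros)
  then show ?case
    using continuous_on_compose2[of UNIV f UNIV "\<lambda>x. c *\<^sub>R x + z"] 0 by simp
next
  case (Suc k)
  have lin: "linear (frechet_derivative f (at y))" for y
    using Suc.prems by (intro linear_frechet_derivative) auto
  show ?case
  proof (rule Ck_SucI)
    fix x
    have "((\<lambda>x. c *\<^sub>R x + z) has_derivative (\<lambda>h. c *\<^sub>R h)) (at x)"
      by (auto intro!: derivative_eq_intros)
    from has_derivative_compose[OF this Ck_Suc_has_derivative[OF Suc.prems]]
    show "((\<lambda>x. f (c *\<^sub>R x + z)) has_derivative
        (\<lambda>h. c * frechet_derivative f (at (c *\<^sub>R x + z)) h)) (at x)"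
      by (simp add: linear_scale[OF lin])
  next
    fix b :: 'a assume "b \<in> Basis"
    then show "Ck k (\<lambda>x. c * frechet_derivative f (at (c *\<^sub>R x + z)) b)"
      using Suc by (intro Ck_mult Ck_const Suc.IH) auto
  qed
qed

lemma smooth_const [simp]: "smooth (\<lambda>x. c)"
  by (simp add: smooth_def Ck_const)

lemma smooth_add: "smooth f \<Longrightarrow> smooth g \<Longrightarrow> smooth (\<lambda>x. f x + g x)"
  by (simp add: smooth_def Ck_add)

lemma smooth_mult: "smooth f \<Longrightarrow> smooth g \<Longrightarrow> smooth (\<lambda>x. f x * g x)"
  by (simp add: smooth_def Ck_mult)

lemma smooth_diff: "smooth f \<Longrightarrow> smooth g \<Longrightarrow> smooth (\<lambda>x. f x - g x)"
  using smooth_add[of f "\<lambda>x. -1 * g x"] smooth_mult[of "\<lambda>_. -1" g] by simp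

lemma smooth_power: "smooth f \<Longrightarrow> smooth (\<lambda>x. f x ^ n)"
  by (induction n) (simp_all add: smooth_mult)

lemma smooth_norm_square: "smooth (\<lambda>x::'a::euclidean_space. x \<bullet> x)"
proof -
  have "(\<lambda>x::'a. x \<bullet> x) = (\<lambda>x. \<Sum>i\<in>Basis. (x \<bullet> i) * (x \<bullet> i))"
    by (rule ext) (rule euclidean_inner)
  then show ?thesis
    by (simp only: smooth_def) (intro allI Ck_sum Ck_mult Ck_inner)
qed

lemma smooth_affine: "smooth f \<Longrightarrow> smooth (\<lambda>x. f (c *\<^sub>R x + z))"
  by (simp add: smooth_def Ck_affine)

lemma smooth_differentiable: "smooth f \<Longrightarrow> f differentiable (at x)"
  using Ck.simps(2)[of 0 f] by (simp only: smooth_def) blast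

lemma smooth_has_derivative:
  "smooth f \<Longrightarrow> (f has_derivative frechet_derivative f (at x)) (at x)"
  using smooth_differentiable frechet_derivative_works by blast

lemma smooth_partial:
  "smooth f \<Longrightarrow> b \<in> Basis \<Longrightarrow> smooth (\<lambda>x. frechet_derivative f (at x) b)"
proof -
  assume "smooth f" and b: "b \<in> Basis"
  then have "Ck (Suc k) f" for k
    by (simp only: smooth_def)
  with b show ?thesis
    by (simp add: smooth_def)
qed

lemma smooth_continuous_on: "smooth f \<Longrightarrow> continuous_on A f"
  using Ck.simps(1)[of f] continuous_on_subset[of UNIV f A] by (simp only: smooth_def) blast

lemma grad_inner_Basis:
  "b \<in> Basis \<Longrightarrow> grad f x \<bullet> b = frechet_derivative f (at x) b"
  by (simp add: grad_def inner_sum_left inner_Basis if_distrib cong: if_cong)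

lemma frechet_derivative_eq_grad_inner:
  assumes "f differentiable (at x)"
  shows "frechet_derivative f (at x) h = grad f x \<bullet> h"
proof -
  interpret linear "frechet_derivative f (at x)"
    using assms by (rule linear_frechet_derivative)
  have "frechet_derivative f (at x) h = frechet_derivative f (at x) (\<Sum>b\<in>Basis. (h \<bullet> b) *\<^sub>R b)"
    by (simp add: euclidean_representation)
  also have "\<dots> = (\<Sum>b\<in>Basis. (h \<bullet> b) * frechet_derivative f (at x) b)"
    by (simp add: sum scaleR)
  also have "\<dots> = (\<Sum>b\<in>Basis. frechet_derivative f (at x) b * (b \<bullet> h))"
    by (simp add: inner_commute mult.commute)
  finally show ?thesis
    by (simp add: grad_def inner_sum_left)
qed

lemma grad_eqI:
  assumes "(f has_derivative (\<lambda>h. v \<bullet> h)) (at x)"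
  shows "grad f x = v"
  using frechet_derivative_at[OF assms, symmetric]
  by (simp add: grad_def euclidean_representation)

lemma smooth_has_grad:
  "smooth f \<Longrightarrow> (f has_derivative (\<lambda>h. grad f x \<bullet> h)) (at x)"
proof -
  assume f: "smooth f"
  have "frechet_derivative f (at x) = (\<lambda>h. grad f x \<bullet> h)"
    using frechet_derivative_eq_grad_inner[OF smooth_differentiable[OF f]] by blast
  then show ?thesis
    using smooth_has_derivative[OF f, of x] by metis
qed

lemma continuous_on_grad: "smooth f \<Longrightarrow> continuous_on A (grad f)"
  unfolding grad_def[abs_def]
  by (intro continuous_intros smooth_continuous_on smooth_partial)

lemma grad_const [simp]: "grad (\<lambda>x. c) x = 0"
  by (rule grad_eqI) simp

lemma grad_add: "smooth f \<Longrightarrow> smooth g \<Longrightarrow> grad (\<lambda>x. f x + g x) x = grad f x + grad g x"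
  by (rule grad_eqI) (auto intro!: derivative_eq_intros smooth_has_grad simp: inner_add_left)

lemma grad_diff: "smooth f \<Longrightarrow> smooth g \<Longrightarrow> grad (\<lambda>x. f x - g x) x = grad f x - grad g x"
  by (rule grad_eqI) (auto intro!: derivative_eq_intros smooth_has_grad simp: inner_diff_left)

lemma grad_mult:
  "smooth f \<Longrightarrow> smooth g \<Longrightarrow> grad (\<lambda>x. f x * g x) x = f x *\<^sub>R grad g x + g x *\<^sub>R grad f x"
  by (rule grad_eqI) (auto intro!: derivative_eq_intros smooth_has_grad simp: inner_add_left)

lemma grad_affine:
  fixes f :: "'a::euclidean_space \<Rightarrow> real"
  assumes "smooth f"
  shows "grad (\<lambda>x. f (c *\<^sub>R x + z)) x = c *\<^sub>R grad f (c *\<^sub>R x + z)"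
proof (rule grad_eqI)
  have "((\<lambda>x. c *\<^sub>R x + z) has_derivative (\<lambda>h. c *\<^sub>R h)) (at x)"
    by (auto intro!: derivative_eq_intros)
  from has_derivative_compose[OF this smooth_has_grad[OF assms]]
  show "((\<lambda>x. f (c *\<^sub>R x + z)) has_derivative (\<lambda>h. (c *\<^sub>R grad f (c *\<^sub>R x + z)) \<bullet> h)) (at x)"
    by simp
qed

text \<open>The functions \<open>s\<^sup>-\<^sup>j exp (-1/s)\<close>, extended by \<open>0\<close>: their span is closed under
  differentiation, so that smoothness of \<open>exp (-1/s)\<close> is an induction over the order.\<close>

definition flat_exp :: "nat \<Rightarrow> real \<Rightarrow> real" where
  "flat_exp j s = (if s > 0 then exp (- 1 / s) / s ^ j else 0)"

lemma flat_exp_nonneg: "0 \<le> flat_exp j s"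
  by (simp add: flat_exp_def)

lemma flat_exp_tendsto_0: "(flat_exp j \<longlongrightarrow> 0) (at 0)"
proof -
  have "((\<lambda>s::real. inverse s ^ j / exp (inverse s)) \<longlongrightarrow> 0) (at_right 0)"
    by (rule filterlim_compose[OF tendsto_power_div_exp_0 filterlim_inverse_at_top_right])
  then have "(flat_exp j \<longlongrightarrow> 0) (at_right 0)"
    by (rule Lim_transform_eventually)
      (auto simp: eventually_at_right_field flat_exp_def exp_minus field_simps intro!: exI[of _ 1])
  moreover have "(flat_exp j \<longlongrightarrow> 0) (at_left 0)"
    by (rule Lim_transform_eventually[OF tendsto_const])
      (auto simp: eventually_at_left_field flat_exp_def intro!: exI[of _ "-1"])
  ultimately show ?thesis
    by (simp add: filterlim_at_split)
qed

lemma flat_exp_DERIV: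
  "(flat_exp j has_real_derivative flat_exp (j + 2) s - j * flat_exp (j + 1) s) (at s)"
proof -
  consider "s < 0" | "s > 0" | "s = 0" by linarith
  then show ?thesis
  proof cases
    case 1
    have "((\<lambda>s. 0) has_real_derivative 0) (at s)" by simp
    moreover have "\<forall>\<^sub>F x in nhds s. flat_exp j x = 0"
      using eventually_nhds_in_open[of "{..<0}" s] 1
      by (auto elim!: eventually_mono simp: flat_exp_def)
    ultimately show ?thesis
      using 1 DERIV_cong_ev[of s s "flat_exp j" "\<lambda>_. 0" 0 0] by (simp add: flat_exp_def)
  next
    case 2
    have "((\<lambda>s. exp (- 1 / s) / s ^ j) has_real_derivative
        ((exp (- 1 / s) / s\<^sup>2) * s ^ j - exp (- 1 / s) * (j * s ^ (j - 1))) / (s ^ j * s ^ j)) (at s)"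
      using 2 by (auto intro!: derivative_eq_intros simp: power2_eq_square)
    moreover have "((exp (- 1 / s) / s\<^sup>2) * s ^ j - exp (- 1 / s) * (j * s ^ (j - 1))) / (s ^ j * s ^ j)
        = flat_exp (j + 2) s - j * flat_exp (j + 1) s"
      using 2 by (cases j) (auto simp: flat_exp_def field_simps power2_eq_square)
    moreover have "\<forall>\<^sub>F x in nhds s. flat_exp j x = exp (- 1 / x) / x ^ j"
      using eventually_nhds_in_open[of "{0<..}" s] 2
      by (auto elim!: eventually_mono simp: flat_exp_def)
    ultimately show ?thesis
      using DERIV_cong_ev[of s s "flat_exp j" "\<lambda>s. exp (- 1 / s) / s ^ j"] by simp
  next
    case 3
    have "(\<lambda>h. (flat_exp j (0 + h) - flat_exp j 0) / h) = flat_exp (Suc j)"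
      by (auto simp: flat_exp_def fun_eq_iff)
    then show ?thesis
      using 3 flat_exp_tendsto_0[of "Suc j"] by (simp add: DERIV_def flat_exp_def)
  qed
qed

lemma smooth_flat_exp_ball: "smooth (\<lambda>x::'a::euclidean_space. flat_exp j (1 - x \<bullet> x))"
proof -
  have "Ck k (\<lambda>x::'a. flat_exp j (1 - x \<bullet> x))" for k
  proof (induction k arbitrary: j)
    case 0
    have "continuous_on UNIV (flat_exp j)"
      by (intro continuous_at_imp_continuous_on ballI DERIV_isCont[OF flat_exp_DERIV])
    then show ?case
      using continuous_on_compose2[of UNIV "flat_exp j" UNIV "\<lambda>x::'a. 1 - x \<bullet> x"]
      by (simp add: continuous_intros)
  next
    case (Suc k)
    show ?case
    proof (rule Ck_SucI)
      fix x :: 'a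
      have "((\<lambda>x::'a. 1 - x \<bullet> x) has_derivative (\<lambda>h. - 2 * (x \<bullet> h))) (at x)"
        by (auto intro!: derivative_eq_intros simp: inner_commute)
      from has_derivative_compose[OF this flat_exp_DERIV[unfolded has_field_derivative_def]]
      show "((\<lambda>x. flat_exp j (1 - x \<bullet> x)) has_derivative
        (\<lambda>h. (flat_exp (j + 2) (1 - x \<bullet> x) + (- real j) * flat_exp (j + 1) (1 - x \<bullet> x)) * (- 2 * (x \<bullet> h)))) (at x)"
        by simp
    next
      fix b :: 'a assume "b \<in> Basis"
      show "Ck k (\<lambda>x. (flat_exp (j + 2) (1 - x \<bullet> x) + (- real j) * flat_exp (j + 1) (1 - x \<bullet> x)) * (- 2 * (x \<bullet> b)))"
        by (intro Ck_mult Ck_add Ck_const Ck_inner Suc.IH)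
    qed
  qed
  then show ?thesis by (simp add: smooth_def)
qed

definition bump :: "'a::euclidean_space \<Rightarrow> real" where
  "bump x = flat_exp 0 (1 - x \<bullet> x) / (\<integral>y. flat_exp 0 (1 - y \<bullet> y) \<partial>(lborel :: 'a measure))"

lemma smooth_bump: "smooth (bump :: 'a::euclidean_space \<Rightarrow> real)"
  unfolding bump_def[abs_def] divide_inverse by (intro smooth_mult smooth_flat_exp_ball smooth_const)

lemma inner_self_ge_1_iff: "(x::'a::real_inner) \<bullet> x \<ge> 1 \<longleftrightarrow> norm x \<ge> 1"
  by (simp add: norm_eq_sqrt_inner)

lemma integrable_flat_exp_ball: "integrable lborel (\<lambda>y::'a::euclidean_space. flat_exp j (1 - y \<bullet> y))"
proof -
  have "integrable lborel (\<lambda>y::'a. indicator (cball 0 1) y *\<^sub>R flat_exp j (1 - y \<bullet> y))"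
    by (rule borel_integrable_compact) (auto intro: smooth_continuous_on smooth_flat_exp_ball)
  also have "(\<lambda>y::'a. indicator (cball 0 1) y *\<^sub>R flat_exp j (1 - y \<bullet> y)) = (\<lambda>y. flat_exp j (1 - y \<bullet> y))"
  proof
    fix y :: 'a
    show "indicator (cball 0 1) y *\<^sub>R flat_exp j (1 - y \<bullet> y) = flat_exp j (1 - y \<bullet> y)"
      using inner_self_ge_1_iff[of y] by (auto simp: flat_exp_def indicator_def)
  qed
  finally show ?thesis .
qed

lemma flat_exp_ball_integral_pos: "0 < (\<integral>y. flat_exp 0 (1 - y \<bullet> y) \<partial>(lborel :: 'a::euclidean_space measure))"
proof (rule ccontr)
  assume "\<not> ?thesis"
  moreover have "0 \<le> (\<integral>y. flat_exp 0 (1 - y \<bullet> y) \<partial>(lborel :: 'a::euclidean_space measure))"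
    by (simp add: flat_exp_nonneg)
  ultimately have "(\<integral>y. flat_exp 0 (1 - y \<bullet> y) \<partial>(lborel :: 'a::euclidean_space measure)) = 0"
    by simp
  then have "AE y::'a in lborel. flat_exp 0 (1 - y \<bullet> y) = 0"
    by (subst (asm) integral_nonneg_eq_0_iff_AE) (auto intro: integrable_flat_exp_ball simp: flat_exp_nonneg)
  moreover have "y \<in> ball 0 1 \<Longrightarrow> flat_exp 0 (1 - y \<bullet> y) \<noteq> 0" for y :: 'a
    using inner_self_ge_1_iff[of y] by (auto simp: flat_exp_def)
  ultimately have "AE y::'a in lborel. y \<notin> ball 0 1"
    by (auto elim!: eventually_mono)
  then have "emeasure lborel (ball (0::'a) 1) = 0"
    by (subst (asm) AE_iff_measurable[where N = "ball 0 1"]) auto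
  then show False
    using emeasure_lborel_ball_finite[of "0::'a" 1] content_ball_pos[of 1 "0::'a"] by (simp add: measure_def)
qed

lemma bump_nonneg: "0 \<le> bump x"
  by (simp add: bump_def flat_exp_nonneg flat_exp_ball_integral_pos less_imp_le)

lemma bump_eq_0: "norm x \<ge> 1 \<Longrightarrow> bump x = 0"
  using inner_self_ge_1_iff[of x] by (simp add: bump_def flat_exp_def)

lemma integrable_bump: "integrable lborel (bump :: 'a::euclidean_space \<Rightarrow> real)"
  unfolding bump_def[abs_def] by (intro integrable_divide integrable_flat_exp_ball)

lemma integral_bump: "(\<integral>x. bump x \<partial>(lborel :: 'a::euclidean_space measure)) = 1"
  using flat_exp_ball_integral_pos[where 'a='a] by (simp add: bump_def[abs_def])

lemma bump_norm: "norm (x::'a::euclidean_space) = norm y \<Longrightarrow> bump x = bump (y::'a)"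
  unfolding bump_def by (simp only: dot_square_norm)

section \<open>Square integrable functions\<close>

lemma L2_iff_real: "L2 M (f :: _ \<Rightarrow> real) \<longleftrightarrow> f \<in> borel_measurable M \<and> integrable M (\<lambda>x. (f x)\<^sup>2)"
  by (simp add: L2_def)

lemma L2_inner_integrable:
  assumes "L2 M f" "L2 M g"
  shows "integrable M (\<lambda>x. f x \<bullet> g x)"
proof (rule Bochner_Integration.integrable_bound)
  show "integrable M (\<lambda>x. (norm (f x))\<^sup>2 + (norm (g x))\<^sup>2)"
    using assms by (auto simp: L2_def)
  show "(\<lambda>x. f x \<bullet> g x) \<in> borel_measurable M"
    using assms by (auto simp: L2_def)
  have "\<bar>f x \<bullet> g x\<bar> \<le> (norm (f x))\<^sup>2 + (norm (g x))\<^sup>2" for x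
  proof -
    have "\<bar>f x \<bullet> g x\<bar> \<le> norm (f x) * norm (g x)"
      by (rule Cauchy_Schwarz_ineq2)
    also have "\<dots> \<le> (norm (f x))\<^sup>2 + (norm (g x))\<^sup>2"
      using sum_squares_bound[of "norm (f x)" "norm (g x)"] mult_nonneg_nonneg[OF norm_ge_zero norm_ge_zero, of "f x" "g x"]
      unfolding mult.assoc by linarith
    finally show ?thesis .
  qed
  then show "AE x in M. norm (f x \<bullet> g x) \<le> norm ((norm (f x))\<^sup>2 + (norm (g x))\<^sup>2)"
    by simp
qed

lemma L2_mult_integrable:
  "L2 M (f :: _ \<Rightarrow> real) \<Longrightarrow> L2 M g \<Longrightarrow> integrable M (\<lambda>x. f x * g x)"
  using L2_inner_integrable[of M f g] by simp

lemma norm_add_square: "(norm (x + y))\<^sup>2 = (norm x)\<^sup>2 + 2 * (x \<bullet> y) + (norm (y::'a::real_inner))\<^sup>2"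
  by (simp add: power2_norm_eq_inner inner_add inner_commute algebra_simps)

lemma norm_diff_square: "(norm (x - y))\<^sup>2 = (norm x)\<^sup>2 - 2 * (x \<bullet> y) + (norm (y::'a::real_inner))\<^sup>2"
  by (simp add: power2_norm_eq_inner inner_diff inner_commute algebra_simps)

lemma L2_add: "L2 M f \<Longrightarrow> L2 M g \<Longrightarrow> L2 M (\<lambda>x. f x + g x)"
  using L2_inner_integrable[of M f g] by (auto simp: L2_def norm_add_square)

lemma L2_diff: "L2 M f \<Longrightarrow> L2 M g \<Longrightarrow> L2 M (\<lambda>x. f x - g x)"
  using L2_inner_integrable[of M f g] by (auto simp: L2_def norm_diff_square)

lemma L2_scaleR: "L2 M f \<Longrightarrow> L2 M (\<lambda>x. c *\<^sub>R f x)"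
  by (auto simp: L2_def power_mult_distrib)

lemma L2_cmult: "L2 M f \<Longrightarrow> L2 M (\<lambda>x. c * f x :: real)"
  using L2_scaleR[of M f c] by simp

lemma L2_cong_AE:
  assumes "L2 M f" "g \<in> borel_measurable M" "AE x in M. g x = f x"
  shows "L2 M g"
  using assms by (auto simp: L2_def cong: integrable_cong_AE
      intro!: integrable_cong_AE_imp[of M "\<lambda>x. (norm (f x))\<^sup>2"] elim!: eventually_mono)

text \<open>The discriminant argument: the integral of the square of \<open>f - t g\<close> is a nonnegative quadratic polynomial in \<open>t\<close>.\<close>

lemma L2_cauchy_schwarz:
  assumes f: "L2 M f" and g: "L2 M g"
  shows "\<bar>\<integral>x. f x \<bullet> g x \<partial>M\<bar> \<le> sqrt (LINT x|M. (norm (f x))\<^sup>2) * sqrt (LINT x|M. (norm (g x))\<^sup>2)"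
proof -
  define a c b where "a = (LINT x|M. (norm (f x))\<^sup>2)" and "c = (LINT x|M. f x \<bullet> g x)"
    and "b = (LINT x|M. (norm (g x))\<^sup>2)"
  have ab: "a \<ge> 0" "b \<ge> 0"
    by (auto simp: a_def b_def)
  have ineq: "0 \<le> a - 2 * t * c + t\<^sup>2 * b" for t
  proof -
    have "0 \<le> (LINT x|M. (norm (f x - t *\<^sub>R g x))\<^sup>2)"
      by simp
    also have "\<dots> = (LINT x|M. (norm (f x))\<^sup>2 - 2 * t * (f x \<bullet> g x) + t\<^sup>2 * (norm (g x))\<^sup>2)"
      by (intro Bochner_Integration.integral_cong) (simp_all add: norm_diff_square power_mult_distrib)
    also have "\<dots> = a - 2 * t * c + t\<^sup>2 * b"
      using f g L2_inner_integrable[OF f g] by (simp add: L2_def a_def b_def c_def)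
    finally show ?thesis .
  qed
  have "c\<^sup>2 \<le> a * b"
  proof (cases "b = 0")
    case True
    have "c = 0"
    proof (rule ccontr)
      assume "c \<noteq> 0"
      then show False
        using ineq[of "(a + 1) / (2 * c)"] True by (simp add: field_simps)
    qed
    then show ?thesis using True by simp
  next
    case False
    then show ?thesis
      using ineq[of "c / b"] ab by (simp add: field_simps power2_eq_square)
  qed
  then have "\<bar>c\<bar> \<le> sqrt (a * b)"
    by (simp add: real_le_rsqrt)
  then show ?thesis
    by (simp add: a_def b_def c_def real_sqrt_mult)
qed

lemma L2_tendsto_inner:
  assumes F: "\<And>n. L2 M (F n)" "L2 M f" and G: "\<And>n. L2 M (G n)" "L2 M g"
    and limF: "(\<lambda>n. \<integral>x. (norm (F n x - f x))\<^sup>2 \<partial>M) \<longlonglongrightarrow> 0"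
    and limG: "(\<lambda>n. \<integral>x. (norm (G n x - g x))\<^sup>2 \<partial>M) \<longlonglongrightarrow> 0"
  shows "(\<lambda>n. \<integral>x. F n x \<bullet> G n x \<partial>M) \<longlonglongrightarrow> (LINT x|M. f x \<bullet> g x)"
proof -
  let ?N = "\<lambda>h. sqrt (LINT x|M. (norm (h x))\<^sup>2)"
  note dF = L2_diff[OF F(1) F(2)] and dG = L2_diff[OF G(1) G(2)]
  have bound: "norm ((LINT x|M. F n x \<bullet> G n x) - (LINT x|M. f x \<bullet> g x))
      \<le> ?N (\<lambda>x. F n x - f x) * ?N (\<lambda>x. G n x - g x) + ?N (\<lambda>x. F n x - f x) * ?N g
        + ?N f * ?N (\<lambda>x. G n x - g x)" for n
  proof -
    have "(LINT x|M. F n x \<bullet> G n x) - (LINT x|M. f x \<bullet> g x)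
        = (LINT x|M. (F n x - f x) \<bullet> (G n x - g x) + (F n x - f x) \<bullet> g x + f x \<bullet> (G n x - g x))"
      by (subst Bochner_Integration.integral_diff[symmetric])
        (auto intro!: L2_inner_integrable F G Bochner_Integration.integral_cong simp: inner_diff)
    also have "\<dots> = (LINT x|M. (F n x - f x) \<bullet> (G n x - g x)) + (LINT x|M. (F n x - f x) \<bullet> g x)
        + (LINT x|M. f x \<bullet> (G n x - g x))"
      using L2_inner_integrable[OF dF dG, of n n] L2_inner_integrable[OF dF G(2), of n] L2_inner_integrable[OF F(2) dG, of n]
      by simp
    finally show ?thesis
      using L2_cauchy_schwarz[OF dF dG, of n n] L2_cauchy_schwarz[OF dF G(2), of n]
        L2_cauchy_schwarz[OF F(2) dG, of n]
      by simp
  qed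
  have sF: "(\<lambda>n. ?N (\<lambda>x. F n x - f x)) \<longlonglongrightarrow> 0" and sG: "(\<lambda>n. ?N (\<lambda>x. G n x - g x)) \<longlonglongrightarrow> 0"
    using tendsto_real_sqrt[OF limF] tendsto_real_sqrt[OF limG] by simp_all
  have "(\<lambda>n. ?N (\<lambda>x. F n x - f x) * ?N (\<lambda>x. G n x - g x) + ?N (\<lambda>x. F n x - f x) * ?N g
        + ?N f * ?N (\<lambda>x. G n x - g x)) \<longlonglongrightarrow> 0 * 0 + 0 * ?N g + ?N f * 0"
    by (intro tendsto_intros sF sG)
  then have "(\<lambda>n. (LINT x|M. F n x \<bullet> G n x) - (LINT x|M. f x \<bullet> g x)) \<longlonglongrightarrow> 0"
    by (intro Lim_null_comparison[OF always_eventually[OF allI[OF bound]]]) simp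
  then show ?thesis
    by (simp add: LIM_zero_iff)
qed

lemma L2_tendsto_mult:
  fixes F G :: "nat \<Rightarrow> 'a \<Rightarrow> real"
  assumes "\<And>n. L2 M (F n)" "L2 M f" "\<And>n. L2 M (G n)" "L2 M g"
    and "(\<lambda>n. \<integral>x. (F n x - f x)\<^sup>2 \<partial>M) \<longlonglongrightarrow> 0" and "(\<lambda>n. \<integral>x. (G n x - g x)\<^sup>2 \<partial>M) \<longlonglongrightarrow> 0"
  shows "(\<lambda>n. \<integral>x. F n x * G n x \<partial>M) \<longlonglongrightarrow> (LINT x|M. f x * g x)"
  using L2_tendsto_inner[of M F f G g] assms by simp

lemma square_integral_triangle:
  assumes f: "L2 M f" and g: "L2 M g"
  shows "(LINT x|M. (norm (f x + g x))\<^sup>2) \<le> 2 * (LINT x|M. (norm (f x))\<^sup>2) + 2 * (LINT x|M. (norm (g x))\<^sup>2)"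
proof -
  have "(norm (f x + g x))\<^sup>2 \<le> 2 * (norm (f x))\<^sup>2 + 2 * (norm (g x))\<^sup>2" for x
    using zero_le_power2[of "norm (f x - g x)"] unfolding norm_add_square norm_diff_square by linarith
  then have "(LINT x|M. (norm (f x + g x))\<^sup>2) \<le> (LINT x|M. 2 * (norm (f x))\<^sup>2 + 2 * (norm (g x))\<^sup>2)"
    using f g L2_add[OF f g] by (intro integral_mono) (auto simp: L2_def)
  then show ?thesis
    using f g by (simp add: L2_def)
qed

text \<open>Uniqueness of weak gradients and of traces are both instances: two approximating sequences are shown to
  approach each other.\<close>

lemma L2_limit_unique:
  assumes F: "\<And>n. L2 M (F n)" "L2 M f" and G: "\<And>n. L2 M (G n)" "L2 M g"
    and limF: "(\<lambda>n. \<integral>x. (norm (F n x - f x))\<^sup>2 \<partial>M) \<longlonglongrightarrow> 0"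
    and limG: "(\<lambda>n. \<integral>x. (norm (G n x - g x))\<^sup>2 \<partial>M) \<longlonglongrightarrow> 0"
    and lim: "(\<lambda>n. \<integral>x. (norm (F n x - G n x))\<^sup>2 \<partial>M) \<longlonglongrightarrow> 0"
  shows "AE x in M. f x = g x"
proof -
  note d = L2_diff[OF F(1) G(1)] and d' = L2_diff[OF F(2) G(2)]
  have "(\<lambda>n. \<integral>x. (norm ((F n x - G n x) - (f x - g x)))\<^sup>2 \<partial>M) \<longlonglongrightarrow> 0"
  proof (rule Lim_null_comparison[OF always_eventually[OF allI]])
    show "(\<lambda>n. 2 * (LINT x|M. (norm (F n x - f x))\<^sup>2) + 2 * (LINT x|M. (norm (G n x - g x))\<^sup>2)) \<longlonglongrightarrow> 0"
      using tendsto_add[OF tendsto_mult_left[OF limF, of 2] tendsto_mult_left[OF limG, of 2]] by simp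
    fix n
    show "norm (LINT x|M. (norm ((F n x - G n x) - (f x - g x)))\<^sup>2)
      \<le> 2 * (LINT x|M. (norm (F n x - f x))\<^sup>2) + 2 * (LINT x|M. (norm (G n x - g x))\<^sup>2)"
      using square_integral_triangle[OF L2_diff[OF F(1) F(2)] L2_scaleR[OF L2_diff[OF G(1) G(2)], of "-1"], of n n]
      by (simp add: algebra_simps norm_minus_commute)
  qed
  from L2_tendsto_inner[OF d d' d d' this this]
  have "(\<lambda>n. \<integral>x. (norm (F n x - G n x))\<^sup>2 \<partial>M) \<longlonglongrightarrow> (LINT x|M. (norm (f x - g x))\<^sup>2)"
    by (simp add: power2_norm_eq_inner)
  then have "(LINT x|M. (norm (f x - g x))\<^sup>2) = 0"
    using lim LIMSEQ_unique by blast
  then have "AE x in M. (norm (f x - g x))\<^sup>2 = 0"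
    using d' by (subst (asm) integral_nonneg_eq_0_iff_AE) (auto simp: L2_def)
  then show ?thesis by simp
qed

section \<open>Integration over the unit ball\<close>

abbreviation ballM :: "'a::euclidean_space measure" where
  "ballM \<equiv> lebesgue_on (ball 0 1)"

lemma finite_measure_ball [simp]: "finite_measure ((ballM :: 'a::euclidean_space measure))"
  by (rule finite_measure_lebesgue_on) auto

lemma continuous_measurable_ball:
  fixes f :: "'a::euclidean_space \<Rightarrow> 'b::euclidean_space"
  assumes "continuous_on (cball 0 1) f"
  shows "f \<in> borel_measurable ballM"
  by (rule continuous_imp_measurable_on_sets_lebesgue[OF continuous_on_subset[OF assms]]) auto

lemma integrable_bounded_ball:
  fixes f :: "'a::euclidean_space \<Rightarrow> 'b::euclidean_space"
  assumes "f \<in> borel_measurable ballM" and "\<And>x. x \<in> ball 0 1 \<Longrightarrow> norm (f x) \<le> C"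
  shows "integrable ballM f"
  by (rule finite_measure.integrable_const_bound[OF finite_measure_ball, of _ C])
    (use assms in \<open>auto intro!: AE_I2\<close>)

lemma continuous_bounded_ball:
  fixes f :: "'a::euclidean_space \<Rightarrow> 'b::euclidean_space"
  assumes "continuous_on (cball 0 1) f"
  obtains C where "C > 0" "\<And>x. x \<in> cball 0 1 \<Longrightarrow> norm (f x) \<le> C"
proof -
  have "bounded (f ` cball 0 1)"
    by (intro compact_imp_bounded compact_continuous_image assms) simp
  then show ?thesis
    using that by (auto simp: bounded_pos)
qed

lemma continuous_integrable_ball:
  fixes f :: "'a::euclidean_space \<Rightarrow> 'b::euclidean_space"
  assumes "continuous_on (cball 0 1) f"
  shows "integrable ballM f"
proof -
  obtain C where "\<And>x. x \<in> cball 0 1 \<Longrightarrow> norm (f x) \<le> C"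
    using continuous_bounded_ball[OF assms] by blast
  then show ?thesis
    by (intro integrable_bounded_ball[of _ C] continuous_measurable_ball assms) auto
qed

lemma continuous_L2_ball:
  fixes f :: "'a::euclidean_space \<Rightarrow> 'b::euclidean_space"
  assumes "continuous_on (cball 0 1) f"
  shows "L2 ballM f"
  unfolding L2_def
  by (intro conjI continuous_measurable_ball continuous_integrable_ball continuous_intros assms)

lemma smooth_L2_ball: "smooth f \<Longrightarrow> L2 ballM f"
  by (intro continuous_L2_ball smooth_continuous_on)

lemma grad_L2_ball: "smooth f \<Longrightarrow> L2 ballM (grad f)"
  by (intro continuous_L2_ball continuous_on_grad)

lemma L2_ball_integrable:
  fixes f :: "'a::euclidean_space \<Rightarrow> 'b::euclidean_space"
  assumes "L2 ballM f"
  shows "integrable ballM f"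
proof (rule Bochner_Integration.integrable_bound)
  show "integrable ballM (\<lambda>x. 1 + (norm (f x))\<^sup>2)"
    using assms continuous_integrable_ball[of "\<lambda>_. 1::real"]
    by (intro Bochner_Integration.integrable_add) (simp_all add: L2_def)
  have "norm (f x) \<le> 1 + (norm (f x))\<^sup>2" for x
    using sum_squares_bound[of "norm (f x)" 1] by (smt (verit) norm_ge_zero power2_eq_square mult_1_right one_power2)
  then show "AE x in ballM. norm (f x) \<le> norm (1 + (norm (f x))\<^sup>2)"
    by simp
qed (use assms in \<open>simp add: L2_def\<close>)

lemma integrable_mult_bounded_ball:
  fixes f :: "'a::euclidean_space \<Rightarrow> 'b::euclidean_space" and g :: "'a \<Rightarrow> real"
  assumes f: "integrable ballM f" and g: "continuous_on (cball 0 1) g"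
  shows "integrable ballM (\<lambda>x. g x *\<^sub>R f x)"
proof -
  obtain C where C: "C > 0" "\<And>x. x \<in> cball 0 1 \<Longrightarrow> norm (g x) \<le> C"
    using continuous_bounded_ball[OF g] by blast
  show ?thesis
  proof (rule Bochner_Integration.integrable_bound)
    show "integrable ballM (\<lambda>x. C *\<^sub>R f x)"
      using f by simp
    show "(\<lambda>x. g x *\<^sub>R f x) \<in> borel_measurable ballM"
      using borel_measurable_integrable[OF f] continuous_measurable_ball[OF g] by (rule borel_measurable_scaleR[rotated])
    show "AE x in ballM. norm (g x *\<^sub>R f x) \<le> norm (C *\<^sub>R f x)"
      using C by (intro AE_I2) (auto intro!: mult_right_mono)
  qed
qed

lemma integral_ball_eq_lborel:
  fixes f :: "'a::euclidean_space \<Rightarrow> 'b::euclidean_space"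
  assumes [measurable]: "f \<in> borel_measurable borel"
  shows "integral\<^sup>L ballM f = (LINT x|lborel. indicator (ball 0 1) x *\<^sub>R f x)"
    and "integrable ballM f \<longleftrightarrow> integrable lborel (\<lambda>x. indicator (ball 0 1) x *\<^sub>R f x)"
proof -
  have [measurable]: "(\<lambda>x. indicator (ball 0 1) x *\<^sub>R f x) \<in> borel_measurable lborel"
    by (intro borel_measurable_scaleR borel_measurable_indicator) auto
  show "integral\<^sup>L ballM f = (LINT x|lborel. indicator (ball 0 1) x *\<^sub>R f x)"
    by (subst integral_restrict_space) (auto intro!: integral_completion)
  show "integrable ballM f \<longleftrightarrow> integrable lborel (\<lambda>x. indicator (ball 0 1) x *\<^sub>R f x)"
    by (subst integrable_restrict_space) (auto intro!: integrable_completion)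
qed

lemma AE_ball_iff_lborel: "(AE x in (ballM :: 'a::euclidean_space measure). P x) \<longleftrightarrow> (AE x in lborel. x \<in> ball 0 1 \<longrightarrow> P x)"
  by (subst AE_restrict_space_iff) (auto simp: AE_completion_iff)

text \<open>Substitutions and Fubini are carried out for Lebesgue measure on the Borel sets, where affine images and slices
  stay measurable; this lemma reduces to that case.\<close>

lemma borel_version_ball:
  fixes f :: "'a::euclidean_space \<Rightarrow> real"
  assumes "f \<in> borel_measurable ballM"
  obtains f0 where "f0 \<in> borel_measurable borel" "AE x in ballM. f x = f0 x"
proof -
  have "(\<lambda>x. if x \<in> ball 0 1 then f x else 0) \<in> borel_measurable lebesgue"
    using assms by (subst borel_measurable_if) simp_all
  then obtain g where g: "g \<in> borel_measurable lborel"
    and "AE x in lborel. (if x \<in> ball 0 1 then f x else 0) = g x"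
    using completion_ex_borel_measurable_real by blast
  then have "AE x in ballM. f x = g x"
    unfolding AE_ball_iff_lborel by (auto elim!: eventually_mono)
  with g that show ?thesis by simp
qed

lemma integral_translate: 
  fixes F :: "'a::euclidean_space \<Rightarrow> 'b::euclidean_space"
  assumes [measurable]: "F \<in> borel_measurable borel"
  shows "(LINT x|lborel. F (z + x)) = (LINT x|lborel. F x)"
  by (subst (2) lborel_distr_plus[of z, symmetric]) (simp add: integral_distr)

text \<open>The integral of the difference quotients of \<open>F\<close> vanishes, because Lebesgue measure is
  translation invariant.\<close>

lemma integral_grad_eq_0:
  fixes F :: "'a::euclidean_space \<Rightarrow> real"
  assumes F: "smooth F" and supp: "\<And>x. norm x \<ge> 1 \<Longrightarrow> F x = 0" and b: "b \<in> Basis"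
  shows "(LINT x|lborel. grad F x \<bullet> b) = 0"
proof -
  have [measurable]: "F \<in> borel_measurable borel" "grad F \<in> borel_measurable borel"
    using smooth_continuous_on[OF F] continuous_on_grad[OF F] by (auto intro: borel_measurable_continuous_onI)
  obtain C where C: "C > 0" "\<And>x. x \<in> cball 0 2 \<Longrightarrow> norm (grad F x) \<le> C"
  proof -
    have "bounded (grad F ` cball 0 2)"
      by (intro compact_imp_bounded compact_continuous_image continuous_on_grad F) simp
    then show ?thesis using that by (auto simp: bounded_pos)
  qed
  define h where "h n = 1 / real (Suc n)" for n
  have h: "0 < h n" "h n \<le> 1" for n by (auto simp: h_def)
  have h0: "h \<longlonglongrightarrow> 0"
    unfolding h_def[abs_def] using LIMSEQ_inverse_real_of_nat by (simp add: inverse_eq_divide)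
  have Fint: "integrable lborel F"
  proof -
    have "integrable lborel (\<lambda>x. indicator (cball 0 1) x *\<^sub>R F x)"
      by (intro borel_integrable_compact smooth_continuous_on F) simp
    also have "(\<lambda>x. indicator (cball 0 1) x *\<^sub>R F x) = F"
      using supp by (auto simp: fun_eq_iff indicator_def)
    finally show ?thesis .
  qed
  let ?q = "\<lambda>n x. (F (h n *\<^sub>R b + x) - F x) / h n"
  have lim: "(\<lambda>n. \<integral>x. ?q n x \<partial>lborel) \<longlonglongrightarrow> (LINT x|lborel. grad F x \<bullet> b)"
  proof (rule integral_dominated_convergence)
    show "integrable lborel (\<lambda>x. C * indicator (cball (0::'a) 2) x)"
      using emeasure_lborel_cball_finite[of "0::'a" 2] by (intro integrable_mult_right integrable_real_indicator) auto
    show "AE x in lborel. (\<lambda>n. ?q n x) \<longlonglongrightarrow> grad F x \<bullet> b"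
    proof (rule AE_I2)
      fix x
      have "((\<lambda>t. F (x + t *\<^sub>R b)) has_real_derivative grad F x \<bullet> b) (at 0)"
      proof -
        have "((\<lambda>t. x + t *\<^sub>R b) has_derivative (\<lambda>t. t *\<^sub>R b)) (at 0)"
          by (auto intro!: derivative_eq_intros)
        from has_derivative_compose[OF this, of F "\<lambda>h. grad F x \<bullet> h"] smooth_has_grad[OF F, of x]
        show ?thesis by (simp add: has_field_derivative_def mult.commute[of _ "grad F x \<bullet> b"])
      qed
      then have "((\<lambda>t. (F (x + t *\<^sub>R b) - F x) / t) \<longlongrightarrow> grad F x \<bullet> b) (at 0)"
        by (simp add: DERIV_def)
      moreover have "filterlim h (at 0) sequentially"
        using h0 h by (simp add: filterlim_at less_imp_neq[THEN not_sym])
      ultimately show "(\<lambda>n. ?q n x) \<longlonglongrightarrow> grad F x \<bullet> b"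
        using filterlim_compose by (force simp: add.commute)
    qed
    fix n
    show "AE x in lborel. norm (?q n x) \<le> C * indicator (cball (0::'a) 2) x"
    proof (rule AE_I2)
      fix x :: 'a
      show "norm (?q n x) \<le> C * indicator (cball (0::'a) 2) x"
      proof (cases "norm x \<le> 1 \<or> norm (h n *\<^sub>R b + x) \<le> 1")
        case True
        have nb: "norm (h n *\<^sub>R b) \<le> 1"
          using h[of n] b by simp
        have x2: "norm x \<le> 2" and y2: "norm (h n *\<^sub>R b + x) \<le> 2"
          using True nb norm_triangle_ineq[of "h n *\<^sub>R b" x] norm_triangle_ineq4[of "h n *\<^sub>R b + x" "h n *\<^sub>R b"] by auto
        have "norm (F (h n *\<^sub>R b + x) - F x) \<le> C * norm ((h n *\<^sub>R b + x) - x)"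
        proof (rule differentiable_bound[of "cball 0 2" F "\<lambda>x h. grad F x \<bullet> h" C])
          fix y :: 'a assume y: "y \<in> cball 0 2"
          show "(F has_derivative (\<lambda>h. grad F y \<bullet> h)) (at y within cball 0 2)"
            by (rule has_derivative_at_withinI[OF smooth_has_grad[OF F]])
          show "onorm (\<lambda>h. grad F y \<bullet> h) \<le> C"
            using C(2)[OF y] onorm_inner_right[OF bounded_linear_ident, of "grad F y"]
            by (simp add: onorm_id)
        qed (use x2 y2 in auto)
        also have "norm ((h n *\<^sub>R b + x) - x) = h n"
          using h[of n] b by simp
        finally have "norm (?q n x) \<le> C"
          using h[of n] by (simp add: field_simps)
        then show ?thesis using x2 by simp
      next
        case False
        then have "F x = 0" "F (h n *\<^sub>R b + x) = 0"
          by (auto intro: supp)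
        then show ?thesis using C(1) by simp
      qed
    qed
  qed auto
  moreover have "(LINT x|lborel. ?q n x) = 0" for n
  proof -
    have i: "integrable lborel (\<lambda>x. F (h n *\<^sub>R b + x))"
      using Fint by (subst (asm) lborel_distr_plus[of "h n *\<^sub>R b", symmetric]) (simp add: integrable_distr_eq)
    show ?thesis
      using Bochner_Integration.integral_diff[OF i Fint] integral_translate[of F "h n *\<^sub>R b"] by simp
  qed
  ultimately have "(\<lambda>n. 0) \<longlonglongrightarrow> (LINT x|lborel. grad F x \<bullet> b)"
    by (simp only:)
  then show ?thesis
    by (simp add: LIMSEQ_const_iff)
qed

section \<open>Mollification\<close>

text \<open>Convolution with a smooth kernel, up to a dilation of the argument.\<close>

definition smear :: "('a::euclidean_space \<Rightarrow> real) \<Rightarrow> real \<Rightarrow> ('a \<Rightarrow> real) \<Rightarrow> 'a \<Rightarrow> real" where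
  "smear \<psi> t f x = (LINT y|ballM. f y * \<psi> (t *\<^sub>R x - y))"

lemma smear_integrable:
  fixes f :: "'a::euclidean_space \<Rightarrow> real" and p :: "'a \<Rightarrow> 'b::euclidean_space"
  assumes f: "integrable ballM f" and p: "continuous_on UNIV p"
  shows "integrable ballM (\<lambda>y. f y *\<^sub>R p (z - y))"
proof -
  have "continuous_on (cball 0 1) (\<lambda>y. p (z - y))"
    by (rule continuous_on_compose2[OF p]) (auto intro!: continuous_intros)
  then obtain C where C: "C > 0" "\<And>x. x \<in> cball 0 1 \<Longrightarrow> norm (p (z - x)) \<le> C"
    using continuous_bounded_ball by blast
  have [measurable]: "(\<lambda>y. p (z - y)) \<in> borel_measurable ballM"
    by (rule continuous_measurable_ball) fact
  show ?thesis
  proof (rule Bochner_Integration.integrable_bound)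
    show "integrable ballM (\<lambda>x. f x * C)"
      using f by simp
    show "(\<lambda>y. f y *\<^sub>R p (z - y)) \<in> borel_measurable ballM"
      using f by (intro borel_measurable_scaleR) auto
    show "AE x in ballM. norm (f x *\<^sub>R p (z - x)) \<le> norm (f x * C)"
      using C by (intro AE_I2) (auto simp: abs_mult intro!: mult_left_mono)
  qed
qed

text \<open>The gradient of the kernel is uniformly continuous on a large ball, so the error of linearizing the kernel
  is uniform in the variable of integration.\<close>

lemma smear_has_derivative:
  fixes f :: "'a::euclidean_space \<Rightarrow> real"
  assumes f: "integrable ballM f" and \<psi>: "smooth \<psi>"
  shows "(smear \<psi> t f has_derivative
    (\<lambda>h. (t *\<^sub>R (LINT y|ballM. f y *\<^sub>R grad \<psi> (t *\<^sub>R x - y))) \<bullet> h)) (at x)"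
  unfolding has_derivative_at_alt
proof (intro conjI allI impI)
  let ?L = "ballM :: 'a measure"
  let ?V = "\<integral>y. f y *\<^sub>R grad \<psi> (t *\<^sub>R x - y) \<partial>?L"
  show "bounded_linear (\<lambda>h. (t *\<^sub>R ?V) \<bullet> h)"
    by (rule bounded_linear_inner_right)
  fix e :: real assume e: "e > 0"
  define K where "K = (LINT y|?L. \<bar>f y\<bar>)"
  have K0: "K \<ge> 0" by (simp add: K_def)
  define e' where "e' = e / ((\<bar>t\<bar> + 1) * (K + 1))"
  have e': "e' > 0" using e K0 by (simp add: e'_def)
  define R where "R = \<bar>t\<bar> * (norm x + 1) + 1"
  have "uniformly_continuous_on (cball 0 R) (grad \<psi>)"
    by (intro compact_uniformly_continuous continuous_on_grad \<psi>) simp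
  then obtain d where d: "d > 0"
    "\<And>a b. a \<in> cball 0 R \<Longrightarrow> b \<in> cball 0 R \<Longrightarrow> dist a b < d \<Longrightarrow> dist (grad \<psi> a) (grad \<psi> b) < e'"
    unfolding uniformly_continuous_on_def using e' by metis
  define d1 where "d1 = min 1 (d / (\<bar>t\<bar> + 1))"
  have d1: "d1 > 0" using d by (simp add: d1_def)
  show "\<exists>d>0. \<forall>x'. norm (x' - x) < d \<longrightarrow>
      norm (smear \<psi> t f x' - smear \<psi> t f x - (t *\<^sub>R ?V) \<bullet> (x' - x)) \<le> e * norm (x' - x)"
  proof (intro exI[of _ d1] conjI d1 allI impI)
    fix x' assume x': "norm (x' - x) < d1"
    let ?w = "t *\<^sub>R (x' - x)"
    have w: "norm ?w < d"
    proof -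
      have "norm ?w \<le> (\<bar>t\<bar> + 1) * norm (x' - x)"
        by (simp add: mult_right_mono)
      also have "\<dots> < (\<bar>t\<bar> + 1) * (d / (\<bar>t\<bar> + 1))"
        using x' by (intro mult_strict_left_mono) (auto simp: d1_def)
      finally show ?thesis by simp
    qed
    have pt: "\<bar>\<psi> (t *\<^sub>R x' - y) - \<psi> (t *\<^sub>R x - y) - grad \<psi> (t *\<^sub>R x - y) \<bullet> ?w\<bar> \<le> norm ?w * e'"
      if y: "y \<in> ball 0 1" for y
    proof -
      let ?a = "t *\<^sub>R x - y" and ?b = "t *\<^sub>R x' - y"
      let ?S = "cball 0 R \<inter> ball ?a d"
      have ba: "?b - ?a = ?w" by (simp add: algebra_simps)
      have nx': "norm x' \<le> norm x + 1"
        using x' norm_triangle_ineq2[of x' x] by (simp add: d1_def)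
      have a: "?a \<in> ?S"
      proof -
        have "norm ?a \<le> \<bar>t\<bar> * norm x + norm y"
          using norm_triangle_ineq4[of "t *\<^sub>R x" y] by simp
        also have "\<dots> \<le> R"
          using y by (simp add: R_def algebra_simps add_increasing)
        finally show ?thesis using d by simp
      qed
      have b: "?b \<in> ?S"
      proof -
        have "norm ?b \<le> \<bar>t\<bar> * norm x' + norm y"
          using norm_triangle_ineq4[of "t *\<^sub>R x'" y] by simp
        also have "\<dots> \<le> \<bar>t\<bar> * (norm x + 1) + 1"
          using y mult_left_mono[OF nx', of "\<bar>t\<bar>"] by simp
        finally have "norm ?b \<le> R" by (simp add: R_def)
        moreover have "norm (?a - ?b) < d"
          using w ba by (metis norm_minus_commute)
        ultimately show ?thesis by (simp add: dist_norm norm_minus_commute)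
      qed
      have conv: "convex ?S" by (intro convex_Int convex_cball convex_ball)
      have seg: "?a + s *\<^sub>R (?b - ?a) \<in> ?S" if "s \<in> {0..1}" for s
      proof -
        have "(1 - s) *\<^sub>R ?a + s *\<^sub>R ?b \<in> ?S"
          using convexD_alt[OF conv a b] that by auto
        then show ?thesis by (simp add: algebra_simps)
      qed
      have "norm (\<psi> ?b - \<psi> ?a - grad \<psi> ?a \<bullet> (?b - ?a)) \<le> norm (?b - ?a) * e'"
      proof (rule differentiable_bound_linearization[of ?a ?b ?S \<psi> "\<lambda>z h. grad \<psi> z \<bullet> h" ?a e'])
        fix z assume z: "z \<in> ?S"
        show "(\<psi> has_derivative (\<lambda>h. grad \<psi> z \<bullet> h)) (at z within ?S)"
          by (rule has_derivative_at_withinI[OF smooth_has_grad[OF \<psi>]])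
        have "norm (grad \<psi> z - grad \<psi> ?a) < e'"
          using d(2)[of z ?a] z a by (auto simp: dist_norm norm_minus_commute)
        moreover have "(\<lambda>h. grad \<psi> z \<bullet> h - grad \<psi> ?a \<bullet> h) = (\<lambda>h. (grad \<psi> z - grad \<psi> ?a) \<bullet> h)"
          by (simp add: inner_diff_left)
        moreover have "onorm (\<lambda>h. (grad \<psi> z - grad \<psi> ?a) \<bullet> h) \<le> norm (grad \<psi> z - grad \<psi> ?a)"
          by (intro onorm_le Cauchy_Schwarz_ineq2[unfolded real_norm_def[symmetric]])
        ultimately show "onorm ((\<lambda>h. grad \<psi> z \<bullet> h) - (\<lambda>h. grad \<psi> ?a \<bullet> h)) \<le> e'"
          by (simp add: fun_diff_def)
      qed (use seg a in auto)
      then show ?thesis using ba by simp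
    qed
    have c\<psi>: "continuous_on UNIV \<psi>" "continuous_on UNIV (grad \<psi>)"
      using \<psi> by (auto intro: smooth_continuous_on continuous_on_grad)
    note i1 = smear_integrable[OF f c\<psi>(1), of "t *\<^sub>R x'", unfolded real_scaleR_def]
      and i2 = smear_integrable[OF f c\<psi>(1), of "t *\<^sub>R x", unfolded real_scaleR_def]
      and i3 = smear_integrable[OF f c\<psi>(2), of "t *\<^sub>R x"]
    have i4: "integrable ?L (\<lambda>y. f y * (grad \<psi> (t *\<^sub>R x - y) \<bullet> ?w))"
      using integrable_inner_left[OF i3, of ?w] by (simp only: inner_scaleR_left)
    have V: "(t *\<^sub>R ?V) \<bullet> (x' - x) = (LINT y|?L. f y * (grad \<psi> (t *\<^sub>R x - y) \<bullet> ?w))"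
    proof -
      have "(t *\<^sub>R ?V) \<bullet> (x' - x) = ?V \<bullet> ?w" by simp
      also have "\<dots> = (LINT y|?L. f y * (grad \<psi> (t *\<^sub>R x - y) \<bullet> ?w))"
        using integral_inner_left[OF i3, of ?w] by (simp only: inner_scaleR_left)
      finally show ?thesis .
    qed
    have "smear \<psi> t f x' - smear \<psi> t f x - (t *\<^sub>R ?V) \<bullet> (x' - x)
      = (LINT y|?L. f y * (\<psi> (t *\<^sub>R x' - y) - \<psi> (t *\<^sub>R x - y) - grad \<psi> (t *\<^sub>R x - y) \<bullet> ?w))"
      unfolding V smear_def right_diff_distrib using i1 i2 i4 by simp
    also have "norm \<dots> \<le> (LINT y|?L. \<bar>f y\<bar> * (norm ?w * e'))"
    proof (rule Bochner_Integration.integral_norm_bound_integral)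
      show "integrable ?L (\<lambda>y. f y * (\<psi> (t *\<^sub>R x' - y) - \<psi> (t *\<^sub>R x - y) - grad \<psi> (t *\<^sub>R x - y) \<bullet> ?w))"
        unfolding right_diff_distrib using i1 i2 i4 by simp
      show "integrable ?L (\<lambda>y. \<bar>f y\<bar> * (norm ?w * e'))"
        using f by simp
      show "norm (f y * (\<psi> (t *\<^sub>R x' - y) - \<psi> (t *\<^sub>R x - y) - grad \<psi> (t *\<^sub>R x - y) \<bullet> ?w)) \<le> \<bar>f y\<bar> * (norm ?w * e')"
        if "y \<in> space ?L" for y
        using mult_left_mono[OF pt[of y], of "\<bar>f y\<bar>"] that by (simp add: abs_mult)
    qed
    also have "\<dots> = K * (\<bar>t\<bar> * e') * norm (x' - x)"
      by (simp add: K_def)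
    also have "\<dots> \<le> (K + 1) * ((\<bar>t\<bar> + 1) * e') * norm (x' - x)"
      using K0 e' by (intro mult_right_mono mult_mono) auto
    also have "(K + 1) * ((\<bar>t\<bar> + 1) * e') = e"
    proof -
      have "(\<bar>t\<bar> + 1) * (K + 1) \<noteq> 0" using K0 by simp
      then show ?thesis unfolding e'_def by (simp add: field_simps)
    qed
    finally show "norm (smear \<psi> t f x' - smear \<psi> t f x - (t *\<^sub>R ?V) \<bullet> (x' - x)) \<le> e * norm (x' - x)" .
  qed
qed

lemma smooth_smear:
  fixes f :: "'a::euclidean_space \<Rightarrow> real"
  assumes f: "integrable ballM f" and "smooth \<psi>"
  shows "smooth (smear \<psi> t f)"
proof -
  have "smooth \<psi> \<Longrightarrow> Ck k (smear \<psi> t f)" for k \<psi>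
  proof (induction k arbitrary: \<psi>)
    case 0
    then show ?case
      using has_derivative_continuous[OF smear_has_derivative[OF f 0]]
      by (auto intro: continuous_at_imp_continuous_on)
  next
    case (Suc k)
    show ?case
    proof (rule Ck_SucI[OF smear_has_derivative[OF f Suc.prems]])
      fix b :: 'a assume b: "b \<in> Basis"
      have eq: "(t *\<^sub>R (LINT y|ballM. f y *\<^sub>R grad \<psi> (t *\<^sub>R x - y))) \<bullet> b
          = t * smear (\<lambda>z. frechet_derivative \<psi> (at z) b) t f x" for x
        using integral_inner_left[OF smear_integrable[OF f continuous_on_grad[OF Suc.prems]], of "t *\<^sub>R x" b] b
        by (simp add: smear_def grad_inner_Basis)
      show "Ck k (\<lambda>x. (t *\<^sub>R (LINT y|ballM. f y *\<^sub>R grad \<psi> (t *\<^sub>R x - y))) \<bullet> b)"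
        unfolding eq by (intro Ck_mult Ck_const Suc.IH smooth_partial Suc.prems b)
    qed
  qed
  with assms show ?thesis by (simp add: smooth_def)
qed

lemma grad_smear:
  fixes f :: "'a::euclidean_space \<Rightarrow> real"
  assumes "integrable ballM f" and "smooth \<psi>"
  shows "grad (smear \<psi> t f) x = t *\<^sub>R (LINT y|ballM. f y *\<^sub>R grad \<psi> (t *\<^sub>R x - y))"
  by (rule grad_eqI[OF smear_has_derivative[OF assms]])

text \<open>The \<open>2\<close> keeps the dilation factor \<open>1 - width n\<close> at least \<open>1 / 2\<close>.\<close>

definition width :: "nat \<Rightarrow> real" where "width n = 1 / real (n + 2)"

lemma width: "0 < width n" "width n \<le> 1 / 2" "width n < 1"
  by (auto simp: width_def field_simps)

lemma width_tendsto: "width \<longlonglongrightarrow> 0"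
  unfolding width_def[abs_def] using LIMSEQ_ignore_initial_segment[OF lim_1_over_n, of 2] by simp

definition kernel :: "nat \<Rightarrow> 'a::euclidean_space \<Rightarrow> real" where
  "kernel n w = bump (w /\<^sub>R width n) / width n ^ DIM('a)"

text \<open>The dilation by \<open>1 - width n\<close> moves the ball of radius \<open>width n\<close> around the argument into
  the unit ball, so that no values of \<open>f\<close> beyond the boundary are needed.\<close>

definition mollify :: "nat \<Rightarrow> ('a::euclidean_space \<Rightarrow> real) \<Rightarrow> 'a \<Rightarrow> real" where
  "mollify n = smear (kernel n) (1 - width n)"

lemma smooth_kernel: "smooth (kernel n :: 'a::euclidean_space \<Rightarrow> real)"
  using smooth_mult[OF smooth_affine[OF smooth_bump, of "inverse (width n)" 0] smooth_const[of "inverse (width n ^ DIM('a))"]]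
  by (simp add: kernel_def[abs_def] divide_inverse)

lemma smooth_mollify:
  "integrable ballM f \<Longrightarrow> smooth (mollify n f)"
  unfolding mollify_def by (intro smooth_smear smooth_kernel)

lemma shifted_ball:
  fixes x z :: "'a::real_normed_vector"
  assumes "norm x < 1" "norm z \<le> 1"
  shows "norm ((1 - width n) *\<^sub>R x - width n *\<^sub>R z) < 1"
proof -
  have "norm ((1 - width n) *\<^sub>R x - width n *\<^sub>R z) \<le> (1 - width n) * norm x + width n * norm z"
    using norm_triangle_ineq4[of "(1 - width n) *\<^sub>R x" "width n *\<^sub>R z"] width[of n] by simp
  also have "\<dots> < (1 - width n) * 1 + width n * 1"
    using assms width[of n] by (intro add_less_le_mono mult_strict_left_mono mult_left_mono) auto
  finally show ?thesis by simp
qed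

lemma kernel_eq_0: "norm w \<ge> width n \<Longrightarrow> kernel n w = 0"
  using width[of n] by (simp add: kernel_def bump_eq_0 field_simps)

lemma test_function_kernel:
  fixes x :: "'a::euclidean_space"
  assumes "norm x < 1"
  shows "test_function (ball 0 1) (\<lambda>y. kernel n ((1 - width n) *\<^sub>R x - y))"
proof -
  let ?z = "(1 - width n) *\<^sub>R x"
  have sm: "smooth (\<lambda>y. kernel n (?z - y))"
    using smooth_affine[OF smooth_kernel, of n "-1" ?z] by (simp add: add.commute)
  have sub: "closure {y. kernel n (?z - y) \<noteq> 0} \<subseteq> cball ?z (width n)"
  proof (rule closure_minimal)
    show "{y. kernel n (?z - y) \<noteq> 0} \<subseteq> cball ?z (width n)"
    proof
      fix y assume "y \<in> {y. kernel n (?z - y) \<noteq> 0}"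
      then have "\<not> width n \<le> norm (?z - y)"
        using kernel_eq_0 by blast
      then show "y \<in> cball ?z (width n)" by (simp add: dist_norm)
    qed
  qed simp
  have "cball ?z (width n) \<subseteq> ball 0 1"
  proof
    fix y assume y: "y \<in> cball ?z (width n)"
    have "norm ((?z - y) /\<^sub>R width n) = norm (?z - y) / width n"
      unfolding norm_scaleR using width(1)[of n] by (simp only: divide_inverse_commute abs_inverse abs_of_pos)
    then have "norm ((?z - y) /\<^sub>R width n) \<le> 1"
      using y width[of n] by (simp add: dist_norm)
    from shifted_ball[OF assms this, of n]
    have "norm (?z - width n *\<^sub>R ((?z - y) /\<^sub>R width n)) < 1" .
    moreover have "width n *\<^sub>R ((?z - y) /\<^sub>R width n) = ?z - y"
      using width(1)[of n] by (simp del: scaleR_diff_right)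
    ultimately show "y \<in> ball 0 1"
      by simp
  qed
  moreover have "compact (closure {y. kernel n (?z - y) \<noteq> 0})"
    using compact_Int_closed[OF compact_cball closed_closure] Int_absorb1[OF sub] by metis
  ultimately show ?thesis
    unfolding test_function_def using sub sm by blast
qed

lemma integral_substitute:
  fixes F :: "'a::euclidean_space \<Rightarrow> real"
  assumes "integrable lborel F" and c: "c \<noteq> 0"
  shows "integrable lborel (\<lambda>z. F (w + c *\<^sub>R z))"
    and "(LINT y|lborel. F y) = \<bar>c\<bar> ^ DIM('a) * (LINT z|lborel. F (w + c *\<^sub>R z))"
proof -
  have [measurable]: "F \<in> borel_measurable borel"
    using assms by auto
  have eq: "lborel = density (distr lborel borel (\<lambda>x. w + c *\<^sub>R x)) (\<lambda>_. ennreal (\<bar>c\<bar> ^ DIM('a)))"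
    using lborel_affine[OF c, of w] by simp
  show "integrable lborel (\<lambda>z. F (w + c *\<^sub>R z))"
    using assms by (subst (asm) eq) (simp add: integrable_density integrable_distr_eq c)
  show "(LINT y|lborel. F y) = \<bar>c\<bar> ^ DIM('a) * (LINT z|lborel. F (w + c *\<^sub>R z))"
    by (subst eq) (simp add: integral_density integral_distr)
qed

lemma nn_integral_substitute:
  fixes F :: "'a::euclidean_space \<Rightarrow> ennreal"
  assumes [measurable]: "F \<in> borel_measurable borel" and c: "c \<noteq> 0"
  shows "(\<integral>\<^sup>+y. F y \<partial>lborel) = ennreal (\<bar>c\<bar> ^ DIM('a)) * (\<integral>\<^sup>+z. F (w + c *\<^sub>R z) \<partial>lborel)"
proof -
  have eq: "lborel = density (distr lborel borel (\<lambda>x. w + c *\<^sub>R x)) (\<lambda>_. ennreal (\<bar>c\<bar> ^ DIM('a)))"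
    using lborel_affine[OF c, of w] by simp
  show ?thesis
    by (subst eq) (simp add: nn_integral_density nn_integral_distr nn_integral_cmult)
qed

text \<open>Substitute \<open>y = (1 - width n) x - width n z\<close>. This point stays in the ball where \<open>bump z \<noteq> 0\<close>, so that the
  restriction of the integral to the ball disappears.\<close>

lemma mollify_eq_average:
  fixes f :: "'a::euclidean_space \<Rightarrow> real"
  assumes [measurable]: "f \<in> borel_measurable borel"
    and f: "integrable ballM f" and x: "norm x < 1"
  shows "integrable lborel (\<lambda>z. f ((1 - width n) *\<^sub>R x - width n *\<^sub>R z) * bump z)"
    and "mollify n f x = (LINT z|lborel. f ((1 - width n) *\<^sub>R x - width n *\<^sub>R z) * bump z)"
proof -
  let ?z = "(1 - width n) *\<^sub>R x" and ?e = "width n"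
  have [measurable]: "kernel n \<in> borel_measurable (borel :: 'a measure)"
    by (intro borel_measurable_continuous_onI smooth_continuous_on smooth_kernel)
  let ?F = "\<lambda>y. indicator (ball 0 1) y *\<^sub>R (f y * kernel n (?z - y))"
  have i: "integrable lborel ?F"
    using smear_integrable[OF f smooth_continuous_on[OF smooth_kernel], of n ?z]
    by (subst (asm) integral_ball_eq_lborel(2)) auto
  have e: "- ?e \<noteq> 0" using width[of n] by simp
  have eq: "?F (?z + (- ?e) *\<^sub>R z) = (f (?z - ?e *\<^sub>R z) * bump z) / ?e ^ DIM('a)" for z
  proof (cases "norm z < 1")
    case True
    then have "?z - ?e *\<^sub>R z \<in> ball 0 1"
      using shifted_ball[OF x, of z n] by simp
    then show ?thesis
      using width[of n] by (simp add: kernel_def)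
  next
    case False
    then have "kernel n (?e *\<^sub>R z) = 0" "bump z = 0"
      using width[of n] by (auto intro!: kernel_eq_0 bump_eq_0)
    then show ?thesis by simp
  qed
  have "integrable lborel (\<lambda>z. (f (?z - ?e *\<^sub>R z) * bump z) / ?e ^ DIM('a))"
    using integral_substitute(1)[OF i e, of ?z] unfolding eq .
  from integrable_mult_left[OF this, of "?e ^ DIM('a)"]
  show "integrable lborel (\<lambda>z. f (?z - ?e *\<^sub>R z) * bump z)"
    using width[of n] by simp
  have "mollify n f x = (LINT y|lborel. ?F y)"
    unfolding mollify_def smear_def by (rule integral_ball_eq_lborel) measurable
  also have "\<dots> = ?e ^ DIM('a) * (LINT z|lborel. (f (?z - ?e *\<^sub>R z) * bump z) / ?e ^ DIM('a))"
    using integral_substitute(2)[OF i e, of ?z] unfolding eq using width[of n] by simp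
  finally show "mollify n f x = (LINT z|lborel. f (?z - ?e *\<^sub>R z) * bump z)"
    using width[of n] by simp
qed

text \<open>Jensen's inequality for the probability density \<open>bump\<close>: the variance is nonnegative.\<close>

lemma average_square_le:
  fixes w :: "'a::euclidean_space \<Rightarrow> real"
  assumes i: "integrable lborel (\<lambda>z. w z * bump z)" and [measurable]: "w \<in> borel_measurable borel"
  shows "ennreal ((LINT z|lborel. w z * bump z)\<^sup>2) \<le> (\<integral>\<^sup>+z. ennreal (bump z * (w z)\<^sup>2) \<partial>lborel)"
proof (cases "(\<integral>\<^sup>+z. ennreal (bump z * (w z)\<^sup>2) \<partial>lborel) = \<infinity>")
  case False
  have [measurable]: "bump \<in> borel_measurable (borel :: 'a measure)"
    by (intro borel_measurable_continuous_onI smooth_continuous_on smooth_bump)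
  have j: "integrable lborel (\<lambda>z. bump z * (w z)\<^sup>2)"
    using False by (intro integrableI_nonneg) (auto simp: bump_nonneg less_top)
  define c where "c = (LINT z|lborel. w z * bump z)"
  have "0 \<le> (LINT z|lborel. bump z * (w z - c)\<^sup>2)"
    by (simp add: bump_nonneg)
  also have "\<dots> = (LINT z|lborel. bump z * (w z)\<^sup>2 - 2 * c * (w z * bump z) + c\<^sup>2 * bump z)"
    by (intro Bochner_Integration.integral_cong) (auto simp: power2_eq_square algebra_simps)
  also have "\<dots> = (LINT z|lborel. bump z * (w z)\<^sup>2) - 2 * c * c + c\<^sup>2"
  proof -
    have k1: "integrable lborel (\<lambda>z. 2 * c * (w z * bump z))"
      by (intro integrable_mult_right i)
    have k2: "integrable lborel (\<lambda>z::'a. c\<^sup>2 * bump z)"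
      by (intro integrable_mult_right integrable_bump)
    have "(LINT z|lborel. 2 * c * (w z * bump z)) = 2 * c * c" "(LINT z|(lborel :: 'a measure). c\<^sup>2 * bump z) = c\<^sup>2"
      using integral_bump[where 'a='a] by (simp_all add: c_def)
    with Bochner_Integration.integral_add[OF Bochner_Integration.integrable_diff[OF j k1] k2]
      Bochner_Integration.integral_diff[OF j k1]
    show ?thesis by (simp only:)
  qed
  also have "\<dots> = (LINT z|lborel. bump z * (w z)\<^sup>2) - c\<^sup>2"
    by (simp add: power2_eq_square)
  finally have "c\<^sup>2 \<le> (LINT z|lborel. bump z * (w z)\<^sup>2)" by simp
  then show ?thesis
    using nn_integral_eq_integral[OF j] by (simp add: c_def bump_nonneg ennreal_leI)
qed simp

lemma ball_measurable [measurable]: "ball (x::'a::euclidean_space) r \<in> sets borel"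
  by simp

text \<open>Truncate \<open>f\<close>, then approximate it pointwise by continuous functions truncated at the same level. Both
  errors tend to zero by dominated convergence.\<close>

lemma L2_ball_continuous_dense:
  fixes f :: "'a::euclidean_space \<Rightarrow> real"
  assumes f: "L2 ballM f" and e: "e > 0"
  obtains g where "continuous_on UNIV g" "(LINT x|ballM. (f x - g x)\<^sup>2) < e"
proof -
  let ?L = "ballM :: 'a measure"
  have fm [measurable]: "f \<in> borel_measurable ?L" and fi: "integrable ?L (\<lambda>x. (f x)\<^sup>2)"
    using f by (auto simp: L2_iff_real)
  define clip where "clip k z = max (- real k) (min (real k) z)" for k :: nat and z :: real
  have clip_cont: "continuous_on UNIV (clip k)" for k
    unfolding clip_def[abs_def] by (intro continuous_intros)
  have [measurable]: "clip k \<in> borel_measurable borel" for k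
    by (intro borel_measurable_continuous_onI clip_cont)
  have clip_bound: "\<bar>clip k z\<bar> \<le> real k" for k z
    by (auto simp: clip_def)
  have clip_diff: "\<bar>z - clip k z\<bar> \<le> \<bar>z\<bar>" for k z
    by (auto simp: clip_def)
  have "(\<lambda>k. \<integral>x. (f x - clip k (f x))\<^sup>2 \<partial>?L) \<longlonglongrightarrow> (LINT x|?L. 0)"
  proof (rule integral_dominated_convergence[OF _ _ fi])
    show "AE x in ?L. (\<lambda>k. (f x - clip k (f x))\<^sup>2) \<longlonglongrightarrow> 0"
    proof (rule AE_I2)
      fix x
      obtain N :: nat where N: "\<bar>f x\<bar> \<le> real N" using real_arch_simple by blast
      have "\<forall>\<^sub>F k in sequentially. (f x - clip k (f x))\<^sup>2 = 0"
        unfolding eventually_sequentially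
        by (rule exI[of _ N]) (use N in \<open>auto simp: clip_def\<close>)
      then show "(\<lambda>k. (f x - clip k (f x))\<^sup>2) \<longlonglongrightarrow> 0"
        by (rule tendsto_eventually)
    qed
    show "AE x in ?L. norm ((f x - clip k (f x))\<^sup>2) \<le> (f x)\<^sup>2" for k
      using clip_diff by (intro AE_I2) (auto simp: abs_le_square_iff)
  qed auto
  then have "\<forall>\<^sub>F k in sequentially. (LINT x|?L. (f x - clip k (f x))\<^sup>2) < e / 4"
    by (rule order_tendstoD) (use e in simp)
  then obtain k where k: "(LINT x|?L. (f x - clip k (f x))\<^sup>2) < e / 4"
    by (auto simp: eventually_sequentially)
  have "f measurable_on (ball 0 1)"
    by (subst measurable_on_iff_borel_measurable) auto
  then obtain N g where N: "negligible N" and g: "\<And>n. continuous_on UNIV (g n)"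
    and lim: "\<And>x. x \<notin> N \<Longrightarrow> (\<lambda>n. g n x) \<longlonglongrightarrow> (if x \<in> ball 0 1 then f x else 0)"
    unfolding measurable_on_def by blast
  have cg: "continuous_on UNIV (\<lambda>x. clip k (g n x))" for n
    by (rule continuous_on_compose2[OF clip_cont g]) simp
  then have [measurable]: "(\<lambda>x. clip k (g n x)) \<in> borel_measurable ?L" for n
    by (intro continuous_measurable_ball continuous_on_subset[OF cg]) simp
  have "(\<lambda>n. \<integral>x. (clip k (f x) - clip k (g n x))\<^sup>2 \<partial>?L) \<longlonglongrightarrow> (LINT x|?L. 0)"
  proof (rule integral_dominated_convergence)
    show "integrable ?L (\<lambda>x. (2 * real k)\<^sup>2)"
      by (intro continuous_integrable_ball continuous_intros)
    have "N \<inter> ball 0 1 \<in> null_sets lebesgue"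
      using negligible_subset[OF N, of "N \<inter> ball 0 1"] by (simp add: negligible_iff_null_sets)
    then have "AE x in ?L. x \<notin> N"
      by (intro AE_I'[of "N \<inter> ball 0 1"]) (auto simp: null_sets_restrict_space)
    then show "AE x in ?L. (\<lambda>n. (clip k (f x) - clip k (g n x))\<^sup>2) \<longlonglongrightarrow> 0"
      using AE_space
    proof eventually_elim
      case (elim x)
      then have "(\<lambda>n. clip k (g n x)) \<longlonglongrightarrow> clip k (f x)"
        using continuous_on_tendsto_compose[OF clip_cont lim[of x]] by simp
      then have "(\<lambda>n. (clip k (f x) - clip k (g n x))\<^sup>2) \<longlonglongrightarrow> (clip k (f x) - clip k (f x))\<^sup>2"
        by (intro tendsto_intros)
      then show ?case by simp
    qed
    show "AE x in ?L. norm ((clip k (f x) - clip k (g n x))\<^sup>2) \<le> (2 * real k)\<^sup>2" for n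
    proof (rule AE_I2)
      fix x
      have "\<bar>clip k (f x) - clip k (g n x)\<bar> \<le> \<bar>2 * real k\<bar>"
        using clip_bound[of k "f x"] clip_bound[of k "g n x"] by linarith
      then show "norm ((clip k (f x) - clip k (g n x))\<^sup>2) \<le> (2 * real k)\<^sup>2"
        by (simp only: abs_le_square_iff real_norm_def abs_power2)
    qed
  qed auto
  then have "\<forall>\<^sub>F n in sequentially. (LINT x|?L. (clip k (f x) - clip k (g n x))\<^sup>2) < e / 4"
    by (rule order_tendstoD) (use e in simp)
  then obtain n where n: "(LINT x|?L. (clip k (f x) - clip k (g n x))\<^sup>2) < e / 4"
    by (auto simp: eventually_sequentially)
  have L2c: "L2 ?L (\<lambda>x. clip k (f x))"
    unfolding L2_iff_real
  proof
    have "(clip k z)\<^sup>2 \<le> (real k)\<^sup>2" for z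
      using clip_bound[of k z] by (simp add: abs_le_square_iff[symmetric])
    then show "integrable ?L (\<lambda>x. (clip k (f x))\<^sup>2)"
      by (intro integrable_bounded_ball[of _ "(real k)\<^sup>2"]) auto
  qed measurable
  have L2g: "L2 ?L (\<lambda>x. clip k (g n x))"
    by (intro continuous_L2_ball continuous_on_subset[OF cg]) simp
  have "(LINT x|?L. (f x - clip k (g n x))\<^sup>2) < e"
    using square_integral_triangle[OF L2_diff[OF f L2c] L2_diff[OF L2c L2g]] k n by simp
  with cg that show ?thesis by blast
qed

lemma nn_integral_ball:
  fixes f :: "'a::euclidean_space \<Rightarrow> ennreal"
  assumes [measurable]: "f \<in> borel_measurable borel"
  shows "integral\<^sup>N ballM f = (\<integral>\<^sup>+x. indicator (ball 0 1) x * f x \<partial>lborel)"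
proof -
  have "integral\<^sup>N ballM f = (\<integral>\<^sup>+x. f x * indicator (ball 0 1) x \<partial>lebesgue)"
    by (subst nn_integral_restrict_space) auto
  also have "\<dots> = (\<integral>\<^sup>+x. f x * indicator (ball 0 1) x \<partial>lborel)"
    by (rule nn_integral_completion)
  finally show ?thesis by (simp add: mult.commute)
qed

text \<open>The error of mollification is an average over \<open>z\<close> of the errors made by the affine maps
  \<open>x \<mapsto> (1 - width n) x - width n z\<close> of the ball into itself, which are
  uniformly small for continuous functions and uniformly bounded on \<open>L2\<close>.\<close>

lemma mollify_L2_tendsto_borel:
  fixes f :: "'a::euclidean_space \<Rightarrow> real"
  assumes fb [measurable]: "f \<in> borel_measurable borel" and f: "L2 ballM f"
  shows "(\<lambda>n. \<integral>x. (mollify n f x - f x)\<^sup>2 \<partial>ballM) \<longlonglongrightarrow> 0"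
proof (rule LIMSEQ_I)
  fix e :: real assume e: "e > 0"
  let ?L = "ballM :: 'a measure" and ?I = "indicator (ball (0::'a) 1) :: 'a \<Rightarrow> ennreal"
  have bump_m [measurable]: "bump \<in> borel_measurable (borel :: 'a measure)"
    by (intro borel_measurable_continuous_onI smooth_continuous_on smooth_bump)
  define V where "V = measure lebesgue (ball (0::'a) 1)"
  have V: "emeasure ?L (ball 0 1) = ennreal V" "V \<ge> 0"
    using emeasure_eq_ennreal_measure[of lborel "ball (0::'a) 1"] emeasure_lborel_ball_finite[of "0::'a" 1]
    unfolding V_def by (auto simp: emeasure_restrict_space)
  \<comment> \<open>With this choice the three errors of \<open>slice\<close> below add up to at most \<open>e / 2\<close>.\<close>
  define D where "D = e / (2 * (3 * 2 ^ DIM('a) + 3 + 3 * (V + 1)))"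
  have Kpos: "3 * 2 ^ DIM('a) + 3 + 3 * (V + 1) > 0"
    using V(2) by (intro add_pos_nonneg) auto
  then have Dpos: "D > 0" using e unfolding D_def by simp
  obtain g where gc: "continuous_on UNIV g" and g: "(LINT x|?L. (f x - g x)\<^sup>2) < D"
    using L2_ball_continuous_dense[OF f Dpos] by blast
  have [measurable]: "g \<in> borel_measurable borel"
    using gc by (rule borel_measurable_continuous_onI)
  have gL2: "L2 ?L g" by (intro continuous_L2_ball continuous_on_subset[OF gc]) simp
  have fgD: "(\<integral>\<^sup>+x. ?I x * ennreal ((f x - g x)\<^sup>2) \<partial>lborel) \<le> ennreal D"
  proof -
    have "(\<integral>\<^sup>+x. ?I x * ennreal ((f x - g x)\<^sup>2) \<partial>lborel) = (\<integral>\<^sup>+x. ennreal ((f x - g x)\<^sup>2) \<partial>?L)"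
      by (subst nn_integral_ball) auto
    also have "\<dots> = ennreal (LINT x|?L. (f x - g x)\<^sup>2)"
      using L2_diff[OF f gL2] by (intro nn_integral_eq_integral) (auto simp: L2_iff_real)
    finally show ?thesis using g by (simp add: ennreal_leI)
  qed
  have "uniformly_continuous_on (cball 0 1) g"
    by (intro compact_uniformly_continuous continuous_on_subset[OF gc]) auto
  then obtain d where d: "d > 0"
    "\<And>a b. a \<in> cball 0 1 \<Longrightarrow> b \<in> cball 0 1 \<Longrightarrow> dist a b < d \<Longrightarrow> dist (g a) (g b) < sqrt D"
    unfolding uniformly_continuous_on_def using Dpos by (metis real_sqrt_gt_0_iff)
  have "\<forall>\<^sub>F n in sequentially. width n < d / 2"
    using order_tendstoD(2)[OF width_tendsto, of "d / 2"] d by simp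
  then obtain N where N: "\<And>n. n \<ge> N \<Longrightarrow> width n < d / 2"
    unfolding eventually_sequentially by blast
  show "\<exists>N. \<forall>n\<ge>N. norm ((LINT x|?L. (mollify n f x - f x)\<^sup>2) - 0) < e"
  proof (intro exI[of _ N] allI impI)
    fix n assume "n \<ge> N"
    then have wd: "width n < d / 2" by (rule N)
    let ?A = "\<lambda>x z. (1 - width n) *\<^sub>R x - width n *\<^sub>R z"
    have slice: "(\<integral>\<^sup>+x. ?I x * ennreal ((f (?A x z) - f x)\<^sup>2) \<partial>lborel)
        \<le> ennreal (D * (3 * 2 ^ DIM('a) + 3 + 3 * V))" if z: "norm z < 1" for z :: 'a
    proof -
      have s1: "(\<integral>\<^sup>+x. ?I x * ennreal ((f (?A x z) - g (?A x z))\<^sup>2) \<partial>lborel) \<le> ennreal (2 ^ DIM('a) * D)"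
      proof -
        let ?t = "1 - width n"
        have t: "?t \<noteq> 0" "?t > 0" "2 * ?t \<ge> 1" using width[of n] by auto
        have "(\<integral>\<^sup>+x. ?I x * ennreal ((f (?A x z) - g (?A x z))\<^sup>2) \<partial>lborel)
          \<le> (\<integral>\<^sup>+x. ?I (?A x z) * ennreal ((f (?A x z) - g (?A x z))\<^sup>2) \<partial>lborel)"
        proof (rule nn_integral_mono)
          fix x
          have "?I x \<le> ?I (?A x z)"
            using shifted_ball[of x z n] z by (auto simp: indicator_def)
          then show "?I x * ennreal ((f (?A x z) - g (?A x z))\<^sup>2) \<le> ?I (?A x z) * ennreal ((f (?A x z) - g (?A x z))\<^sup>2)"
            by (intro mult_right_mono) auto
        qed
        also have "\<dots> = ennreal (2 ^ DIM('a)) * (ennreal ((1 / 2) ^ DIM('a)) * (\<integral>\<^sup>+x. ?I (?A x z) * ennreal ((f (?A x z) - g (?A x z))\<^sup>2) \<partial>lborel))"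
          by (simp add: mult.assoc[symmetric] ennreal_mult[symmetric] power_mult_distrib[symmetric])
        also have "\<dots> \<le> ennreal (2 ^ DIM('a)) * (ennreal (\<bar>?t\<bar> ^ DIM('a)) * (\<integral>\<^sup>+x. ?I (?A x z) * ennreal ((f (?A x z) - g (?A x z))\<^sup>2) \<partial>lborel))"
          using t by (intro mult_left_mono mult_right_mono ennreal_leI power_mono) auto
        also have "ennreal (\<bar>?t\<bar> ^ DIM('a)) * (\<integral>\<^sup>+x. ?I (?A x z) * ennreal ((f (?A x z) - g (?A x z))\<^sup>2) \<partial>lborel)
            = (\<integral>\<^sup>+x. ?I x * ennreal ((f x - g x)\<^sup>2) \<partial>lborel)"
          using nn_integral_substitute[of "\<lambda>x. ?I x * ennreal ((f x - g x)\<^sup>2)" ?t "- (width n *\<^sub>R z)"] t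
          by simp
        also have "ennreal (2 ^ DIM('a)) * \<dots> \<le> ennreal (2 ^ DIM('a)) * ennreal D"
          using fgD by (intro mult_left_mono) auto
        finally show ?thesis
          using Dpos by (simp add: ennreal_mult)
      qed
      have s2: "(\<integral>\<^sup>+x. ?I x * ennreal D \<partial>lborel) = ennreal (D * V)"
      proof -
        have "(\<integral>\<^sup>+x. ?I x * ennreal D \<partial>lborel) = (\<integral>\<^sup>+x. ennreal D \<partial>?L)"
          by (subst nn_integral_ball) auto
        also have "\<dots> = ennreal D * ennreal V" using V by simp
        finally show ?thesis using Dpos V by (simp add: ennreal_mult)
      qed
      have "?I x * ennreal ((f (?A x z) - f x)\<^sup>2)
          \<le> 3 * (?I x * ennreal ((f (?A x z) - g (?A x z))\<^sup>2)) + 3 * (?I x * ennreal D)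
            + 3 * (?I x * ennreal ((f x - g x)\<^sup>2))" for x
      proof (cases "x \<in> ball 0 1")
        case True
        let ?y = "?A x z"
        have yb: "?y \<in> ball 0 1" using shifted_ball[of x z n] True z by simp
        have "dist ?y x \<le> width n * norm x + width n * norm z"
        proof -
          have eq: "?y - x = - (width n *\<^sub>R x) - width n *\<^sub>R z" by (simp add: algebra_simps)
          show ?thesis
            unfolding dist_norm eq
            using norm_triangle_ineq4[of "- (width n *\<^sub>R x)" "width n *\<^sub>R z"] width(1)[of n] by simp
        qed
        also have "\<dots> \<le> width n * 1 + width n * 1"
          using True z width(1)[of n] by (intro add_mono mult_left_mono) auto
        also have "\<dots> < d" using wd by simp
        finally have "\<bar>g ?y - g x\<bar> < sqrt D"
          using d(2)[of ?y x] yb True by (simp add: dist_real_def)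
        then have "(g ?y - g x)\<^sup>2 < (sqrt D)\<^sup>2"
          by (metis abs_ge_zero power2_abs power_strict_mono zero_less_numeral)
        then have gD: "(g ?y - g x)\<^sup>2 \<le> D" using Dpos by simp
        have "(f ?y - f x)\<^sup>2 \<le> 3 * (f ?y - g ?y)\<^sup>2 + 3 * (g ?y - g x)\<^sup>2 + 3 * (f x - g x)\<^sup>2"
        proof -
          have "(p - q - r)\<^sup>2 \<le> 3 * p\<^sup>2 + 3 * q\<^sup>2 + 3 * r\<^sup>2" for p q r :: real
            using zero_le_power2[of "p + q"] zero_le_power2[of "p + r"] zero_le_power2[of "q - r"]
            unfolding power2_eq_square by (simp add: algebra_simps)
          from this[of "f ?y - g ?y" "g x - g ?y" "f x - g x"] show ?thesis
            by (simp add: power2_commute)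
        qed
        also have "\<dots> \<le> 3 * (f ?y - g ?y)\<^sup>2 + 3 * D + 3 * (f x - g x)\<^sup>2"
          using gD by simp
        finally have "ennreal ((f ?y - f x)\<^sup>2) \<le> ennreal (3 * (f ?y - g ?y)\<^sup>2 + 3 * D + 3 * (f x - g x)\<^sup>2)"
          by (rule ennreal_leI)
        also have "\<dots> = 3 * ennreal ((f ?y - g ?y)\<^sup>2) + 3 * ennreal D + 3 * ennreal ((f x - g x)\<^sup>2)"
          using Dpos by (simp add: ennreal_plus ennreal_mult')
        finally show ?thesis using True by simp
      qed (simp add: indicator_def)
      then have "(\<integral>\<^sup>+x. ?I x * ennreal ((f (?A x z) - f x)\<^sup>2) \<partial>lborel)
        \<le> (\<integral>\<^sup>+x. 3 * (?I x * ennreal ((f (?A x z) - g (?A x z))\<^sup>2)) + 3 * (?I x * ennreal D)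
            + 3 * (?I x * ennreal ((f x - g x)\<^sup>2)) \<partial>lborel)"
        by (intro nn_integral_mono)
      also have "\<dots> = 3 * (\<integral>\<^sup>+x. ?I x * ennreal ((f (?A x z) - g (?A x z))\<^sup>2) \<partial>lborel)
          + 3 * (\<integral>\<^sup>+x. ?I x * ennreal D \<partial>lborel) + 3 * (\<integral>\<^sup>+x. ?I x * ennreal ((f x - g x)\<^sup>2) \<partial>lborel)"
      proof -
        have m: "(\<lambda>x. ?I x * ennreal ((f (?A x z) - g (?A x z))\<^sup>2)) \<in> borel_measurable lborel"
          "(\<lambda>x. ?I x * ennreal D) \<in> borel_measurable lborel"
          "(\<lambda>x. ?I x * ennreal ((f x - g x)\<^sup>2)) \<in> borel_measurable lborel"
          by (measurable, measurable, measurable)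
        have add: "(\<integral>\<^sup>+x. 3 * F x + 3 * G x + 3 * H x \<partial>lborel)
            = 3 * (\<integral>\<^sup>+x. F x \<partial>lborel) + 3 * (\<integral>\<^sup>+x. G x \<partial>lborel) + 3 * (\<integral>\<^sup>+x. H x \<partial>lborel)"
          if [measurable]: "F \<in> borel_measurable lborel" "G \<in> borel_measurable lborel" "H \<in> borel_measurable lborel"
          for F G H :: "'a \<Rightarrow> ennreal"
          by (simp add: nn_integral_add nn_integral_cmult)
        show ?thesis by (rule add[OF m])
      qed
      also have "\<dots> \<le> 3 * ennreal (2 ^ DIM('a) * D) + 3 * ennreal (D * V) + 3 * ennreal D"
        by (intro add_mono mult_left_mono s1 fgD eq_refl[OF s2]) auto
      also have "\<dots> = ennreal (D * (3 * 2 ^ DIM('a) + 3 + 3 * V))"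
      proof -
        have "3 * ennreal (2 ^ DIM('a) * D) + 3 * ennreal (D * V) + 3 * ennreal D
          = ennreal (3 * (2 ^ DIM('a) * D)) + ennreal (3 * (D * V)) + ennreal (3 * D)"
          using Dpos V by (simp add: ennreal_mult')
        also have "\<dots> = ennreal (3 * (2 ^ DIM('a) * D) + 3 * (D * V) + 3 * D)"
          using Dpos V by (simp add: ennreal_plus[symmetric] del: ennreal_plus)
        finally show ?thesis by (simp add: algebra_simps)
      qed
      finally show ?thesis .
    qed
    have fi: "integrable ?L f" by (rule L2_ball_integrable[OF f])
    have pt: "?I x * ennreal ((mollify n f x - f x)\<^sup>2)
        \<le> (\<integral>\<^sup>+z. ?I x * ennreal (bump z * (f (?A x z) - f x)\<^sup>2) \<partial>lborel)" for x
    proof (cases "x \<in> ball 0 1")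
      case True
      then have x: "norm x < 1" by simp
      note av = mollify_eq_average[OF fb fi x, of n]
      have i: "integrable lborel (\<lambda>z. (f (?A x z) - f x) * bump z)"
        unfolding left_diff_distrib
        by (intro Bochner_Integration.integrable_diff integrable_mult_right av(1) integrable_bump)
      have "(LINT z|lborel. (f (?A x z) - f x) * bump z)
          = (LINT z|lborel. f (?A x z) * bump z) - (LINT z|(lborel :: 'a measure). f x * bump z)"
        unfolding left_diff_distrib
        by (intro Bochner_Integration.integral_diff integrable_mult_right av(1) integrable_bump)
      also have "\<dots> = mollify n f x - f x"
        using av(2) integral_bump[where 'a='a] by simp
      finally have "(LINT z|lborel. (f (?A x z) - f x) * bump z) = mollify n f x - f x" .
      then show ?thesis
        using average_square_le[OF i] True by simp
    qed simp
    have "ennreal (LINT x|?L. (mollify n f x - f x)\<^sup>2) = (\<integral>\<^sup>+x. ennreal ((mollify n f x - f x)\<^sup>2) \<partial>?L)"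
      using L2_diff[OF smooth_L2_ball[OF smooth_mollify[OF fi]] f]
      by (intro nn_integral_eq_integral[symmetric]) (auto simp: L2_iff_real)
    also have "\<dots> = (\<integral>\<^sup>+x. ?I x * ennreal ((mollify n f x - f x)\<^sup>2) \<partial>lborel)"
    proof -
      have [measurable]: "mollify n f \<in> borel_measurable borel"
        by (intro borel_measurable_continuous_onI smooth_continuous_on smooth_mollify fi)
      show ?thesis by (subst nn_integral_ball) auto
    qed
    also have "\<dots> \<le> (\<integral>\<^sup>+x. (\<integral>\<^sup>+z. ?I x * ennreal (bump z * (f (?A x z) - f x)\<^sup>2) \<partial>lborel) \<partial>lborel)"
      by (intro nn_integral_mono pt)
    also have "\<dots> = (\<integral>\<^sup>+z. (\<integral>\<^sup>+x. ?I x * ennreal (bump z * (f (?A x z) - f x)\<^sup>2) \<partial>lborel) \<partial>lborel)"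
      by (rule lborel_pair.Fubini') measurable
    also have "\<dots> \<le> (\<integral>\<^sup>+z. ennreal (bump z) * ennreal (D * (3 * 2 ^ DIM('a) + 3 + 3 * V)) \<partial>(lborel :: 'a measure))"
    proof (rule nn_integral_mono)
      fix z :: 'a
      have "(\<integral>\<^sup>+x. ?I x * ennreal (bump z * (f (?A x z) - f x)\<^sup>2) \<partial>lborel)
        = (\<integral>\<^sup>+x. ennreal (bump z) * (?I x * ennreal ((f (?A x z) - f x)\<^sup>2)) \<partial>lborel)"
        by (intro nn_integral_cong) (simp add: ennreal_mult bump_nonneg mult_ac)
      also have "\<dots> = ennreal (bump z) * (\<integral>\<^sup>+x. ?I x * ennreal ((f (?A x z) - f x)\<^sup>2) \<partial>lborel)"
        by (intro nn_integral_cmult) measurable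
      also have "\<dots> \<le> ennreal (bump z) * ennreal (D * (3 * 2 ^ DIM('a) + 3 + 3 * V))"
      proof (cases "norm z < 1")
        case True
        then show ?thesis by (intro mult_left_mono slice) auto
      next
        case False
        then have "bump z = 0" by (intro bump_eq_0) simp
        then show ?thesis by simp
      qed
      finally show "(\<integral>\<^sup>+x. ?I x * ennreal (bump z * (f (?A x z) - f x)\<^sup>2) \<partial>lborel)
        \<le> ennreal (bump z) * ennreal (D * (3 * 2 ^ DIM('a) + 3 + 3 * V))" .
    qed
    also have "\<dots> = (\<integral>\<^sup>+z. ennreal (bump z) \<partial>(lborel :: 'a measure)) * ennreal (D * (3 * 2 ^ DIM('a) + 3 + 3 * V))"
      by (intro nn_integral_multc) measurable
    also have "(\<integral>\<^sup>+z. ennreal (bump z) \<partial>(lborel :: 'a measure)) = 1"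
      using nn_integral_eq_integral[OF integrable_bump[where 'a='a]] integral_bump[where 'a='a] by (simp add: bump_nonneg)
    finally have "(LINT x|?L. (mollify n f x - f x)\<^sup>2) \<le> D * (3 * 2 ^ DIM('a) + 3 + 3 * V)"
      using Dpos V by (simp add: ennreal_le_iff)
    also have "\<dots> \<le> D * (3 * 2 ^ DIM('a) + 3 + 3 * (V + 1))"
      using Dpos by (intro mult_left_mono) auto
    also have "\<dots> = e / 2"
      using Kpos unfolding D_def by (simp add: field_simps)
    finally show "norm ((LINT x|?L. (mollify n f x - f x)\<^sup>2) - 0) < e"
      using e by simp
  qed
qed

lemma mollify_cong_AE:
  fixes f :: "'a::euclidean_space \<Rightarrow> real"
  assumes "AE x in ballM. f x = g x"
    and [measurable]: "f \<in> borel_measurable ballM" "g \<in> borel_measurable ballM"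
  shows "mollify n f = mollify n g"
proof
  fix x :: 'a
  have "continuous_on (cball 0 1) (\<lambda>y. kernel n ((1 - width n) *\<^sub>R x - y))"
    by (rule continuous_on_compose2[of UNIV "kernel n"]) (auto intro!: continuous_intros smooth_continuous_on smooth_kernel)
  then have [measurable]: "(\<lambda>y. kernel n ((1 - width n) *\<^sub>R x - y)) \<in> borel_measurable ballM"
    by (rule continuous_measurable_ball)
  show "mollify n f x = mollify n g x"
    unfolding mollify_def smear_def
    by (intro integral_cong_AE borel_measurable_times assms) (use assms(1) in \<open>auto elim!: eventually_mono\<close>)
qed

lemma mollify_L2_tendsto:
  fixes f :: "'a::euclidean_space \<Rightarrow> real"
  assumes f: "L2 ballM f"
  shows "(\<lambda>n. \<integral>x. (mollify n f x - f x)\<^sup>2 \<partial>ballM) \<longlonglongrightarrow> 0"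
proof -
  let ?L = "ballM :: 'a measure"
  have fm [measurable]: "f \<in> borel_measurable ?L" using f by (simp add: L2_def)
  then obtain f0 where f0: "f0 \<in> borel_measurable borel" and eq: "AE x in ?L. f x = f0 x"
    by (rule borel_version_ball)
  have f0m [measurable]: "f0 \<in> borel_measurable ?L"
    using f0 by (intro measurable_restrict_space1 measurable_completion) auto
  have f0L: "L2 ?L f0"
  proof (rule L2_cong_AE[OF f f0m])
    show "AE x in ?L. f0 x = f x" using eq by eventually_elim simp
  qed
  have [measurable]: "mollify n f0 \<in> borel_measurable ?L" for n
    using smooth_L2_ball[OF smooth_mollify[OF L2_ball_integrable[OF f0L]]] by (simp add: L2_def)
  have "(LINT x|?L. (mollify n f x - f x)\<^sup>2) = (LINT x|?L. (mollify n f0 x - f0 x)\<^sup>2)" for n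
    unfolding mollify_cong_AE[OF eq fm f0m]
    by (intro integral_cong_AE) (use eq in \<open>auto elim!: eventually_mono\<close>)
  then show ?thesis
    using mollify_L2_tendsto_borel[OF f0 f0L] by simp
qed

section \<open>Weak gradients on the ball\<close>

lemma norm_square_eq_sum_Basis: "(norm (v::'a::euclidean_space))\<^sup>2 = (\<Sum>b\<in>Basis. (v \<bullet> b)\<^sup>2)"
proof -
  have "(norm v)\<^sup>2 = v \<bullet> v" by (rule power2_norm_eq_inner)
  also have "\<dots> = (\<Sum>b\<in>Basis. (v \<bullet> b) * (v \<bullet> b))" by (rule euclidean_inner)
  finally show ?thesis by (simp add: power2_eq_square)
qed

lemma L2_component:
  assumes "L2 M G" and "b \<in> Basis"
  shows "L2 M (\<lambda>x. G x \<bullet> b)"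
  unfolding L2_iff_real
proof
  show "(\<lambda>x. G x \<bullet> b) \<in> borel_measurable M"
    using assms by (auto simp: L2_def)
  show "integrable M (\<lambda>x. (G x \<bullet> b)\<^sup>2)"
  proof (rule Bochner_Integration.integrable_bound)
    show "integrable M (\<lambda>x. (norm (G x))\<^sup>2)" "(\<lambda>x. (G x \<bullet> b)\<^sup>2) \<in> borel_measurable M"
      using assms by (auto simp: L2_def)
    have "(G x \<bullet> b)\<^sup>2 \<le> (norm (G x))\<^sup>2" for x
      using Basis_le_norm[OF assms(2), of "G x"] by (simp add: abs_le_square_iff[symmetric])
    then show "AE x in M. norm ((G x \<bullet> b)\<^sup>2) \<le> norm ((norm (G x))\<^sup>2)"
      by simp
  qed
qed

lemma test_function_smooth: "test_function \<Omega> \<phi> \<Longrightarrow> smooth \<phi>"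
  by (simp add: test_function_def)

lemma has_weak_gradient_component:
  fixes G :: "'a::euclidean_space \<Rightarrow> 'a"
  assumes u: "L2 ballM u" and G: "has_weak_gradient (ball 0 1) u G"
    and \<phi>: "test_function (ball 0 1) \<phi>" and b: "b \<in> Basis"
  shows "(LINT x|ballM. u x * (grad \<phi> x \<bullet> b))
    = - (LINT x|ballM. \<phi> x * (G x \<bullet> b))"
proof -
  let ?L = "ballM :: 'a measure"
  have sm: "smooth \<phi>" by (rule test_function_smooth[OF \<phi>])
  have i1: "integrable ?L (\<lambda>x. u x *\<^sub>R grad \<phi> x)"
  proof -
    have "integrable ?L (\<lambda>x. u x *\<^sub>R grad \<phi> (0 + 1 *\<^sub>R x))"
    proof -
      have "continuous_on UNIV (\<lambda>x. grad \<phi> (- x))"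
        by (rule continuous_on_compose2[OF continuous_on_grad[OF sm, of UNIV]]) (auto intro!: continuous_intros)
      from smear_integrable[OF L2_ball_integrable[OF u] this, of 0] show ?thesis by simp
    qed
    then show ?thesis by simp
  qed
  have i2: "integrable ?L (\<lambda>x. \<phi> x *\<^sub>R G x)"
    using G by (intro integrable_mult_bounded_ball L2_ball_integrable smooth_continuous_on sm)
      (simp add: has_weak_gradient_def)
  have "(LINT x|?L. u x *\<^sub>R grad \<phi> x) \<bullet> b = (- (LINT x|?L. \<phi> x *\<^sub>R G x)) \<bullet> b"
    using G \<phi> by (simp add: has_weak_gradient_def)
  then show ?thesis
    using integral_inner_left[OF i1, of b] integral_inner_left[OF i2, of b]
    by (simp only: inner_minus_left inner_scaleR_left)
qed

text \<open>A translated kernel is a test function, so the mollified gradient does not see the difference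
  between weak and classical gradient.\<close>

lemma grad_mollify:
  fixes u :: "'a::euclidean_space \<Rightarrow> real"
  assumes u: "L2 ballM u" and G: "has_weak_gradient (ball 0 1) u G"
    and b: "b \<in> Basis" and x: "norm x < 1"
  shows "grad (mollify n u) x \<bullet> b = (1 - width n) * mollify n (\<lambda>y. G y \<bullet> b) x"
proof -
  let ?L = "ballM :: 'a measure"
  let ?z = "(1 - width n) *\<^sub>R x"
  have gr: "grad (\<lambda>y. kernel n (?z - y)) y = - grad (kernel n) (?z - y)" for y
    using grad_affine[OF smooth_kernel, of n "-1" ?z y] by (simp add: add.commute)
  have i: "integrable ?L (\<lambda>y. u y *\<^sub>R grad (kernel n) (?z - y))"
    by (intro smear_integrable L2_ball_integrable u continuous_on_grad smooth_kernel)
  have "grad (mollify n u) x \<bullet> b = (1 - width n) * (LINT y|?L. u y * (grad (kernel n) (?z - y) \<bullet> b))"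
    unfolding mollify_def grad_smear[OF L2_ball_integrable[OF u] smooth_kernel] inner_scaleR_left
    using integral_inner_left[OF i, of b] by (simp only: inner_scaleR_left)
  also have "(LINT y|?L. u y * (grad (kernel n) (?z - y) \<bullet> b))
      = - (LINT y|?L. u y * (grad (\<lambda>y. kernel n (?z - y)) y \<bullet> b))"
    by (simp add: gr)
  also have "\<dots> = (LINT y|?L. kernel n (?z - y) * (G y \<bullet> b))"
    using has_weak_gradient_component[OF u G test_function_kernel[OF x] b, of n] by simp
  also have "\<dots> = mollify n (\<lambda>y. G y \<bullet> b) x"
    by (simp add: mollify_def smear_def mult.commute)
  finally show ?thesis .
qed

lemma has_weak_gradient_L2: "has_weak_gradient \<Omega> u G \<Longrightarrow> L2 (lebesgue_on \<Omega>) G"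
  by (simp add: has_weak_gradient_def)

text \<open>The mollified components of both gradients coincide by \<open>grad_mollify\<close>, and they converge to the components.\<close>

theorem weak_gradient_unique:
  fixes u :: "'a::euclidean_space \<Rightarrow> real"
  assumes u: "L2 ballM u"
    and G: "has_weak_gradient (ball 0 1) u G" and H: "has_weak_gradient (ball 0 1) u H"
  shows "AE x in ballM. G x = H x"
proof -
  let ?L = "ballM :: 'a measure"
  have "AE x in ?L. G x \<bullet> b = H x \<bullet> b" if b: "b \<in> Basis" for b
  proof (rule L2_limit_unique[where F = "\<lambda>n. mollify n (\<lambda>x. G x \<bullet> b)" and G = "\<lambda>n. mollify n (\<lambda>x. H x \<bullet> b)"])
    let ?G = "\<lambda>x. G x \<bullet> b" and ?H = "\<lambda>x. H x \<bullet> b"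
    show Lg: "L2 ?L ?G" "L2 ?L ?H"
      using G H b by (auto intro: L2_component has_weak_gradient_L2)
    show "L2 ?L (mollify n ?G)" for n
      by (intro smooth_L2_ball smooth_mollify L2_ball_integrable Lg(1))
    show "L2 ?L (mollify n ?H)" for n
      by (intro smooth_L2_ball smooth_mollify L2_ball_integrable Lg(2))
    show "(\<lambda>n. \<integral>x. (norm (mollify n ?G x - ?G x))\<^sup>2 \<partial>?L) \<longlonglongrightarrow> 0"
      "(\<lambda>n. \<integral>x. (norm (mollify n ?H x - ?H x))\<^sup>2 \<partial>?L) \<longlonglongrightarrow> 0"
      using mollify_L2_tendsto[OF Lg(1)] mollify_L2_tendsto[OF Lg(2)] by simp_all
    have "mollify n ?G x = mollify n ?H x" if "norm x < 1" for n x
      using grad_mollify[OF u G b that, of n] grad_mollify[OF u H b that, of n] width(3)[of n] by simp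
    then have "(LINT x|?L. (norm (mollify n ?G x - mollify n ?H x))\<^sup>2) = (LINT x|?L. 0)" for n
      by (intro Bochner_Integration.integral_cong) auto
    then show "(\<lambda>n. \<integral>x. (norm (mollify n ?G x - mollify n ?H x))\<^sup>2 \<partial>?L) \<longlonglongrightarrow> 0"
      by simp
  qed
  then have "AE x in ?L. \<forall>b\<in>Basis. G x \<bullet> b = H x \<bullet> b"
    by (simp add: AE_finite_all)
  then show ?thesis
    by eventually_elim (auto intro: euclidean_eqI)
qed

lemma H1_wgrad:
  assumes "u \<in> H1 \<Omega>"
  shows "L2 (lebesgue_on \<Omega>) u" "has_weak_gradient \<Omega> u (wgrad \<Omega> u)" "L2 (lebesgue_on \<Omega>) (wgrad \<Omega> u)"
proof -
  show "L2 (lebesgue_on \<Omega>) u" using assms by (simp add: H1_def)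
  show w: "has_weak_gradient \<Omega> u (wgrad \<Omega> u)"
    using assms someI_ex[of "has_weak_gradient \<Omega> u"] by (simp add: H1_def wgrad_def)
  then show "L2 (lebesgue_on \<Omega>) (wgrad \<Omega> u)" by (rule has_weak_gradient_L2)
qed

lemma wgrad_eq_AE:
  fixes u :: "'a::euclidean_space \<Rightarrow> real"
  assumes u: "L2 ballM u" and G: "has_weak_gradient (ball 0 1) u G"
  shows "u \<in> H1 (ball 0 1)" "AE x in ballM. wgrad (ball 0 1) u x = G x"
proof -
  show *: "u \<in> H1 (ball 0 1)" using u G by (auto simp: H1_def)
  show "AE x in ballM. wgrad (ball 0 1) u x = G x"
    by (rule weak_gradient_unique[OF u H1_wgrad(2)[OF *] G])
qed

text \<open>By \<open>grad_mollify\<close> the derivatives of the mollified function are the mollified weak derivatives, up to the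
  factor \<open>1 - width n\<close>. So both limits are instances of \<open>mollify_L2_tendsto\<close>.\<close>

theorem mollify_H1_tendsto:
  fixes u :: "'a::euclidean_space \<Rightarrow> real"
  assumes "u \<in> H1 (ball 0 1)"
  shows "smooth (mollify n u)"
    and "(\<lambda>n. \<integral>x. (mollify n u x - u x)\<^sup>2 \<partial>ballM) \<longlonglongrightarrow> 0"
    and "(\<lambda>n. \<integral>x. (norm (grad (mollify n u) x - wgrad (ball 0 1) u x))\<^sup>2 \<partial>ballM) \<longlonglongrightarrow> 0"
proof -
  let ?L = "ballM :: 'a measure" and ?G = "wgrad (ball 0 1) u"
  note u = H1_wgrad(1)[OF assms] and G = H1_wgrad(2)[OF assms] and GL = H1_wgrad(3)[OF assms]
  show sm: "smooth (mollify n u)" for n by (intro smooth_mollify L2_ball_integrable u)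
  show "(\<lambda>n. \<integral>x. (mollify n u x - u x)\<^sup>2 \<partial>?L) \<longlonglongrightarrow> 0"
    by (rule mollify_L2_tendsto[OF u])
  have comp: "(\<lambda>n. \<integral>x. (grad (mollify n u) x \<bullet> b - ?G x \<bullet> b)\<^sup>2 \<partial>?L) \<longlonglongrightarrow> 0" if b: "b \<in> Basis" for b
  proof -
    let ?g = "\<lambda>x. ?G x \<bullet> b"
    have g: "L2 ?L ?g" by (rule L2_component[OF GL b])
    have M: "L2 ?L (mollify n ?g)" for n
      by (intro smooth_L2_ball smooth_mollify L2_ball_integrable g)
    show ?thesis
    proof (rule Lim_null_comparison[OF always_eventually[OF allI]])
      show "(\<lambda>n. 2 * (1 - width n)\<^sup>2 * (LINT x|?L. (mollify n ?g x - ?g x)\<^sup>2) + 2 * (width n)\<^sup>2 * (LINT x|?L. (?g x)\<^sup>2)) \<longlonglongrightarrow> 0"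
      proof -
        have "(\<lambda>n. 2 * (1 - width n)\<^sup>2 * (LINT x|?L. (mollify n ?g x - ?g x)\<^sup>2) + 2 * (width n)\<^sup>2 * (LINT x|?L. (?g x)\<^sup>2))
          \<longlonglongrightarrow> 2 * (1 - 0)\<^sup>2 * 0 + 2 * 0\<^sup>2 * (LINT x|?L. (?g x)\<^sup>2)"
          by (intro tendsto_intros width_tendsto mollify_L2_tendsto g)
        then show ?thesis by simp
      qed
      fix n
      have "(LINT x|?L. (grad (mollify n u) x \<bullet> b - ?g x)\<^sup>2)
          = (LINT x|?L. (norm ((1 - width n) * (mollify n ?g x - ?g x) + (- width n) * ?g x))\<^sup>2)"
        by (intro Bochner_Integration.integral_cong)
          (auto simp: grad_mollify[OF u G b] algebra_simps)
      also have "\<dots> \<le> 2 * (LINT x|?L. (norm ((1 - width n) * (mollify n ?g x - ?g x)))\<^sup>2) + 2 * (LINT x|?L. (norm ((- width n) * ?g x))\<^sup>2)"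
        by (intro square_integral_triangle L2_cmult L2_diff M g)
      also have "\<dots> = 2 * (1 - width n)\<^sup>2 * (LINT x|?L. (mollify n ?g x - ?g x)\<^sup>2) + 2 * (width n)\<^sup>2 * (LINT x|?L. (?g x)\<^sup>2)"
        by (simp add: power_mult_distrib)
      finally show "norm (LINT x|?L. (grad (mollify n u) x \<bullet> b - ?g x)\<^sup>2)
        \<le> 2 * (1 - width n)\<^sup>2 * (LINT x|?L. (mollify n ?g x - ?g x)\<^sup>2) + 2 * (width n)\<^sup>2 * (LINT x|?L. (?g x)\<^sup>2)"
        by simp
    qed
  qed
  have "(LINT x|?L. (norm (grad (mollify n u) x - ?G x))\<^sup>2)
      = (\<Sum>b\<in>Basis. \<integral>x. (grad (mollify n u) x \<bullet> b - ?G x \<bullet> b)\<^sup>2 \<partial>?L)" for n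
  proof -
    have "L2 ?L (\<lambda>x. grad (mollify n u) x \<bullet> b - ?G x \<bullet> b)" if "b \<in> Basis" for b
      using that by (intro L2_diff L2_component grad_L2_ball sm GL)
    then show ?thesis
      unfolding norm_square_eq_sum_Basis inner_diff_left
      by (intro Bochner_Integration.integral_sum) (auto simp: L2_iff_real)
  qed
  then show "(\<lambda>n. \<integral>x. (norm (grad (mollify n u) x - ?G x))\<^sup>2 \<partial>?L) \<longlonglongrightarrow> 0"
    using tendsto_sum[of Basis "\<lambda>b n. \<integral>x. (grad (mollify n u) x \<bullet> b - ?G x \<bullet> b)\<^sup>2 \<partial>?L" "\<lambda>_. 0" sequentially] comp
    by simp
qed

text \<open>Integration by parts: the product with a test function has compact support in the ball, so its gradient
  integrates to zero.\<close>

lemma smooth_has_weak_gradient: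
  fixes \<phi> :: "'a::euclidean_space \<Rightarrow> real"
  assumes \<phi>: "smooth \<phi>"
  shows "has_weak_gradient (ball 0 1) \<phi> (grad \<phi>)"
  unfolding has_weak_gradient_def
proof (intro conjI allI impI)
  let ?L = "ballM :: 'a measure"
  show "L2 ?L (grad \<phi>)" by (rule grad_L2_ball[OF \<phi>])
  fix \<psi> :: "'a \<Rightarrow> real" assume \<psi>: "test_function (ball 0 1) \<psi>"
  then have sm: "smooth \<psi>" by (rule test_function_smooth)
  have \<psi>0: "\<psi> x = 0" if "norm x \<ge> 1" for x
    using \<psi> that closure_subset[of "{x. \<psi> x \<noteq> 0}"] by (force simp: test_function_def)
  note sp = smooth_mult[OF \<phi> sm]
  have [measurable]: "grad (\<lambda>x. \<phi> x * \<psi> x) \<in> borel_measurable borel"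
    by (intro borel_measurable_continuous_onI continuous_on_grad sp)
  have i1: "integrable ?L (\<lambda>x. \<phi> x *\<^sub>R grad \<psi> x)" and i2: "integrable ?L (\<lambda>x. \<psi> x *\<^sub>R grad \<phi> x)"
    by (intro continuous_integrable_ball continuous_on_scaleR smooth_continuous_on continuous_on_grad \<phi> sm)+
  have i: "integrable ?L (grad (\<lambda>x. \<phi> x * \<psi> x))"
    by (intro continuous_integrable_ball continuous_on_grad sp)
  have g0: "grad (\<lambda>x. \<phi> x * \<psi> x) x = 0" if x: "x \<notin> ball 0 1" for x
  proof -
    have "open (- closure {x. \<psi> x \<noteq> 0})" "x \<in> - closure {x. \<psi> x \<noteq> 0}"
      using \<psi> x by (auto simp: test_function_def)
    moreover have "\<phi> y * \<psi> y = 0" if "y \<in> - closure {x. \<psi> x \<noteq> 0}" for y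
      using that closure_subset[of "{x. \<psi> x \<noteq> 0}"] by auto
    ultimately have "((\<lambda>x. \<phi> x * \<psi> x) has_derivative (\<lambda>h. 0 \<bullet> h)) (at x)"
      using has_derivative_transform_within_open[of "\<lambda>_. 0::real" "\<lambda>_. 0" x UNIV "- closure {x. \<psi> x \<noteq> 0}" "\<lambda>x. \<phi> x * \<psi> x"]
      by simp
    then show ?thesis by (rule grad_eqI)
  qed
  have "(LINT x|?L. grad (\<lambda>x. \<phi> x * \<psi> x) x) = 0"
  proof (rule euclidean_eqI)
    fix b :: 'a assume b: "b \<in> Basis"
    have "(LINT x|?L. grad (\<lambda>x. \<phi> x * \<psi> x) x) \<bullet> b = (LINT x|?L. grad (\<lambda>x. \<phi> x * \<psi> x) x \<bullet> b)"
      using integral_inner_left[OF i, of b] by simp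
    also have "\<dots> = (LINT x|lborel. indicator (ball 0 1) x *\<^sub>R (grad (\<lambda>x. \<phi> x * \<psi> x) x \<bullet> b))"
      by (rule integral_ball_eq_lborel) measurable
    also have "\<dots> = (LINT x|lborel. grad (\<lambda>x. \<phi> x * \<psi> x) x \<bullet> b)"
      by (intro Bochner_Integration.integral_cong) (auto simp: indicator_def g0)
    also have "\<dots> = 0"
      by (rule integral_grad_eq_0[OF sp _ b]) (simp add: \<psi>0)
    finally show "(LINT x|?L. grad (\<lambda>x. \<phi> x * \<psi> x) x) \<bullet> b = 0 \<bullet> b" by simp
  qed
  then have "(LINT x|?L. \<phi> x *\<^sub>R grad \<psi> x + \<psi> x *\<^sub>R grad \<phi> x) = 0"
    by (simp add: grad_mult[OF \<phi> sm])
  then show "(LINT x|?L. \<phi> x *\<^sub>R grad \<psi> x) = - (LINT x|?L. \<psi> x *\<^sub>R grad \<phi> x)"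
    using Bochner_Integration.integral_add[OF i1 i2] by (simp add: eq_neg_iff_add_eq_0)
qed

lemma has_weak_gradient_add_scaled:
  fixes u w :: "'a::euclidean_space \<Rightarrow> real"
  assumes u: "L2 ballM u" and G: "has_weak_gradient (ball 0 1) u G"
    and w: "smooth w"
  shows "has_weak_gradient (ball 0 1) (\<lambda>x. c * u x + w x) (\<lambda>x. c *\<^sub>R G x + grad w x)"
  unfolding has_weak_gradient_def
proof (intro conjI allI impI)
  let ?L = "ballM :: 'a measure"
  have GL: "L2 ?L G" by (rule has_weak_gradient_L2[OF G])
  show "L2 ?L (\<lambda>x. c *\<^sub>R G x + grad w x)"
    by (intro L2_add L2_scaleR GL grad_L2_ball w)
  fix \<psi> :: "'a \<Rightarrow> real" assume \<psi>: "test_function (ball 0 1) \<psi>"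
  then have sm: "smooth \<psi>" by (rule test_function_smooth)
  have cs: "continuous_on (cball 0 1) \<psi>" "continuous_on UNIV (\<lambda>x. grad \<psi> (- x))"
    using smooth_continuous_on[OF sm] continuous_on_minus[OF continuous_on_id, of "UNIV :: 'a set"]
      continuous_on_compose2[OF continuous_on_grad[OF sm, of UNIV], of UNIV "\<lambda>x. - x"]
    by auto
  have i: "integrable ?L (\<lambda>x. f x *\<^sub>R grad \<psi> x)" if "L2 ?L f" for f
    using smear_integrable[OF L2_ball_integrable[OF that] cs(2), of 0] by simp
  have j: "integrable ?L (\<lambda>x. \<psi> x *\<^sub>R H x)" if "L2 ?L H" for H :: "'a \<Rightarrow> 'a"
    by (intro integrable_mult_bounded_ball L2_ball_integrable that cs)
  note wL = smooth_L2_ball[OF w] and gL = grad_L2_ball[OF w]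
  have eu: "(LINT x|?L. u x *\<^sub>R grad \<psi> x) = - (LINT x|?L. \<psi> x *\<^sub>R G x)"
    and ew: "(LINT x|?L. w x *\<^sub>R grad \<psi> x) = - (LINT x|?L. \<psi> x *\<^sub>R grad w x)"
    using G smooth_has_weak_gradient[OF w] \<psi> by (auto simp: has_weak_gradient_def)
  have "(LINT x|?L. (c * u x + w x) *\<^sub>R grad \<psi> x) = (LINT x|?L. c *\<^sub>R (u x *\<^sub>R grad \<psi> x) + w x *\<^sub>R grad \<psi> x)"
    by (simp add: scaleR_add_left)
  also have "\<dots> = c *\<^sub>R (LINT x|?L. u x *\<^sub>R grad \<psi> x) + (LINT x|?L. w x *\<^sub>R grad \<psi> x)"
    using i[OF u] i[OF wL] by (simp del: scaleR_scaleR)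
  also have "\<dots> = - (c *\<^sub>R (LINT x|?L. \<psi> x *\<^sub>R G x) + (LINT x|?L. \<psi> x *\<^sub>R grad w x))"
    by (simp add: eu ew)
  also have "c *\<^sub>R (LINT x|?L. \<psi> x *\<^sub>R G x) + (LINT x|?L. \<psi> x *\<^sub>R grad w x)
      = (LINT x|?L. c *\<^sub>R (\<psi> x *\<^sub>R G x) + \<psi> x *\<^sub>R grad w x)"
    using j[OF GL] j[OF gL] by (simp del: scaleR_scaleR)
  also have "\<dots> = (LINT x|?L. \<psi> x *\<^sub>R (c *\<^sub>R G x + grad w x))"
    by (simp add: scaleR_add_right mult.commute)
  finally show "(LINT x|?L. (c * u x + w x) *\<^sub>R grad \<psi> x) = - (LINT x|?L. \<psi> x *\<^sub>R (c *\<^sub>R G x + grad w x))" .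
qed

section \<open>Rotation invariance and radial functions\<close>

text \<open>Lebesgue measure is the unique translation invariant measure with its value on the unit ball,
  and an isometry preserves both properties. The double integral below contains this: it computes
  the volume of the unit ball times the volume of the preimage of \<open>A\<close> in two ways.\<close>

lemma lborel_linear_isometry:
  fixes R :: "'a::euclidean_space \<Rightarrow> 'a"
  assumes R: "linear R" and norm_R: "\<And>x. norm (R x) = norm x" and RR: "\<And>x. R (R x) = x"
  shows "distr lborel borel R = lborel"
proof (rule measure_eqI)
  interpret R: linear R by fact
  have [measurable]: "R \<in> borel_measurable borel"
    by (intro borel_measurable_continuous_onI linear_continuous_on linear_conv_bounded_linear[THEN iffD1] R)
  let ?U = "ball (0::'a) 1"
  fix A :: "'a set" assume "A \<in> sets (distr lborel borel R)"
  then have [measurable]: "A \<in> sets borel" by simp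
  have "emeasure (distr lborel borel R) A * emeasure lborel ?U
      = (\<integral>\<^sup>+z. (\<integral>\<^sup>+x. indicator A (R x) * indicator ?U z \<partial>lborel) \<partial>lborel)"
  proof -
    have "emeasure (distr lborel borel R) A = (\<integral>\<^sup>+x. indicator A x \<partial>distr lborel borel R)"
      by simp
    also have "\<dots> = (\<integral>\<^sup>+x. indicator A (R x) \<partial>lborel)"
      by (subst nn_integral_distr) auto
    finally show ?thesis
      by (simp add: nn_integral_multc nn_integral_cmult del: nn_integral_indicator) simp
  qed
  also have "\<dots> = (\<integral>\<^sup>+z. (\<integral>\<^sup>+x. indicator A (R x + z) * indicator ?U z \<partial>lborel) \<partial>lborel)"
  proof (rule nn_integral_cong)
    fix z :: 'a
    have "(\<integral>\<^sup>+x. indicator A (R x) * indicator ?U z \<partial>lborel)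
        = (\<integral>\<^sup>+x. indicator A (R (R z + x)) * indicator ?U z \<partial>(lborel :: 'a measure))"
      using nn_integral_substitute[of "\<lambda>x. indicator A (R x) * indicator ?U z" 1 "R z"] by simp
    then show "(\<integral>\<^sup>+x. indicator A (R x) * indicator ?U z \<partial>lborel)
        = (\<integral>\<^sup>+x. indicator A (R x + z) * indicator ?U z \<partial>(lborel :: 'a measure))"
      by (simp add: R.add RR add.commute)
  qed
  also have "\<dots> = (\<integral>\<^sup>+x. (\<integral>\<^sup>+z. indicator A (R x + z) * indicator ?U z \<partial>lborel) \<partial>lborel)"
    by (rule lborel_pair.Fubini') measurable
  also have "\<dots> = (\<integral>\<^sup>+x. (\<integral>\<^sup>+z. indicator A z * indicator ?U (z - R x) \<partial>lborel) \<partial>lborel)"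
  proof (rule nn_integral_cong)
    fix x :: 'a
    show "(\<integral>\<^sup>+z. indicator A (R x + z) * indicator ?U z \<partial>(lborel :: 'a measure))
        = (\<integral>\<^sup>+z. indicator A z * indicator ?U (z - R x) \<partial>lborel)"
      using nn_integral_substitute[of "\<lambda>z. indicator A z * indicator ?U (z - R x)" 1 "R x"] by simp
  qed
  also have "\<dots> = (\<integral>\<^sup>+z. (\<integral>\<^sup>+x. indicator A z * indicator ?U (z - R x) \<partial>lborel) \<partial>lborel)"
    by (rule lborel_pair.Fubini') measurable
  also have "\<dots> = (\<integral>\<^sup>+z. indicator A z * emeasure lborel ?U \<partial>(lborel :: 'a measure))"
  proof (rule nn_integral_cong)
    fix z :: 'a
    have "norm (R x - z) = norm (R z - x)" for x
      by (metis R.diff RR norm_R norm_minus_commute)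
    then have "indicator ?U (z - R x) = (indicator (ball (R z) 1) x :: ennreal)" for x
      by (auto simp: indicator_def dist_norm)
    then have "(\<integral>\<^sup>+x. indicator A z * indicator ?U (z - R x) \<partial>lborel) = indicator A z * emeasure lborel (ball (R z) 1)"
      by (simp add: nn_integral_cmult)
    also have "emeasure lborel (ball (R z) 1) = emeasure lborel ?U"
      by (simp add: emeasure_ball)
    finally show "(\<integral>\<^sup>+x. indicator A z * indicator ?U (z - R x) \<partial>lborel) = indicator A z * emeasure lborel ?U" .
  qed
  also have "\<dots> = emeasure lborel A * emeasure lborel ?U"
    by (simp add: nn_integral_multc)
  finally have "emeasure (distr lborel borel R) A * emeasure lborel ?U = emeasure lborel A * emeasure lborel ?U" .
  moreover have "unit_ball_vol (real DIM('a)) \<noteq> 0"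
    using unit_ball_vol_pos[of "real DIM('a)"] by linarith
  then have "emeasure lborel ?U \<noteq> 0" "emeasure lborel ?U \<noteq> top"
    by (simp_all add: emeasure_ball)
  ultimately show "emeasure (distr lborel borel R) A = emeasure lborel A"
    by (simp add: mult.commute[of _ "emeasure lborel ?U"] ennreal_mult_cancel_left)
qed simp

text \<open>The reflection in the hyperplane that bisects \<open>x\<close> and \<open>y\<close>.\<close>

lemma obtain_reflection:
  fixes x y :: "'a::euclidean_space"
  assumes "norm x = norm y"
  obtains R where "linear R" "\<And>z. norm (R z) = norm z" "\<And>z. R (R z) = z" "R x = y"
proof (cases "x = y")
  case True
  show ?thesis by (rule that[of id]) (use True in \<open>auto simp: linear_id\<close>)
next
  case False
  define v where "v = x - y"
  have vv: "v \<bullet> v \<noteq> 0" using False by (simp add: v_def)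
  define R where "R z = z - (2 * (v \<bullet> z) / (v \<bullet> v)) *\<^sub>R v" for z
  show ?thesis
  proof (rule that)
    show "linear R"
      unfolding R_def[abs_def]
      by (rule linearI) (simp_all add: inner_add_right algebra_simps add_divide_distrib scaleR_add_left)
    show "norm (R z) = norm z" for z
    proof -
      have "(norm (R z))\<^sup>2 = (norm z)\<^sup>2"
        using vv by (simp add: R_def power2_norm_eq_inner inner_diff inner_commute field_simps)
      then show ?thesis by simp
    qed
    show "R (R z) = z" for z
      using vv by (simp add: R_def inner_diff_right)
    have "x \<bullet> x = y \<bullet> y" using assms by (simp add: norm_eq_sqrt_inner)
    then have "v \<bullet> v = 2 * (v \<bullet> x)"
      by (simp add: v_def inner_diff inner_commute)
    then show "R x = y" using vv by (simp add: R_def) (simp add: v_def)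
  qed
qed

lemma kernel_norm: "norm (w::'a::euclidean_space) = norm z \<Longrightarrow> kernel n w = kernel n (z::'a)"
  unfolding kernel_def by (subst bump_norm[of "w /\<^sub>R width n" "z /\<^sub>R width n"]) simp_all

text \<open>A reflection that exchanges \<open>x\<close> and \<open>y\<close> preserves the measure, the kernel and, up to null sets, the function.\<close>

lemma mollify_radial:
  fixes u :: "'a::euclidean_space \<Rightarrow> real"
  assumes u: "L2 ballM u" and rad: "radially_symmetric (ball 0 1) u"
    and xy: "norm x = norm y"
  shows "mollify n u x = mollify n u y"
proof -
  let ?L = "ballM :: 'a measure" and ?t = "1 - width n"
  obtain R where R: "linear R" "\<And>z. norm (R z) = norm z" "\<And>z. R (R z) = z" "R x = y"
    using obtain_reflection[OF xy] by blast
  interpret R: linear R by fact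
  have [measurable]: "R \<in> borel_measurable borel"
    by (intro borel_measurable_continuous_onI linear_continuous_on linear_conv_bounded_linear[THEN iffD1] R)
  note inv = lborel_linear_isometry[OF R(1-3)]
  have [measurable]: "kernel n \<in> borel_measurable (borel :: 'a measure)"
    by (intro borel_measurable_continuous_onI smooth_continuous_on smooth_kernel)
  have um: "u \<in> borel_measurable ?L" using u by (simp add: L2_def)
  then obtain u0 where [measurable]: "u0 \<in> borel_measurable borel" and eq: "AE z in ?L. u z = u0 z"
    by (rule borel_version_ball)
  have u0m: "u0 \<in> borel_measurable ?L"
    by (intro measurable_restrict_space1 measurable_completion) auto
  obtain f where "AE z in ?L. u z = f (norm z)"
    using rad by (auto simp: radially_symmetric_def)
  with eq have "AE z in ?L. u0 z = f (norm z)" by eventually_elim simp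
  then have 1: "AE z in lborel. z \<in> ball 0 1 \<longrightarrow> u0 z = f (norm z)"
    unfolding AE_ball_iff_lborel .
  then obtain N where N: "N \<in> null_sets lborel" "{z. \<not> (z \<in> ball 0 1 \<longrightarrow> u0 z = f (norm z))} \<subseteq> N"
    by (auto simp: eventually_ae_filter)
  have "R -` N \<in> null_sets lborel"
  proof -
    have [measurable]: "N \<in> sets borel" using N by auto
    have "emeasure lborel (R -` N) = emeasure (distr lborel borel R) N"
      by (subst emeasure_distr) auto
    then show ?thesis
      using N measurable_sets[of R borel borel N] by (simp add: inv null_sets_def)
  qed
  then have 2: "AE z in lborel. z \<in> ball 0 1 \<longrightarrow> u0 (R z) = f (norm (R z))"
  proof (rule AE_I', intro subsetI)
    fix z assume "z \<in> {z \<in> space lborel. \<not> (z \<in> ball 0 1 \<longrightarrow> u0 (R z) = f (norm (R z)))}"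
    then have "R z \<in> {z. \<not> (z \<in> ball 0 1 \<longrightarrow> u0 z = f (norm z))}"
      by (simp add: R(2))
    then show "z \<in> R -` N" using N(2) by blast
  qed
  have sym: "AE z in lborel. z \<in> ball 0 1 \<longrightarrow> u0 (R z) = u0 z"
    using 1 2 by eventually_elim (simp add: R(2))
  have "mollify n u0 y = (LINT z|lborel. indicator (ball 0 1) z *\<^sub>R (u0 z * kernel n (?t *\<^sub>R y - z)))"
    unfolding mollify_def smear_def by (rule integral_ball_eq_lborel) measurable
  also have "\<dots> = (LINT z|(distr lborel borel R). indicator (ball 0 1) z *\<^sub>R (u0 z * kernel n (?t *\<^sub>R y - z)))"
    by (simp add: inv)
  also have "\<dots> = (LINT z|lborel. indicator (ball 0 1) (R z) *\<^sub>R (u0 (R z) * kernel n (?t *\<^sub>R y - R z)))"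
    by (rule integral_distr) measurable
  also have "\<dots> = (LINT z|lborel. indicator (ball 0 1) z *\<^sub>R (u0 z * kernel n (?t *\<^sub>R x - z)))"
  proof (rule integral_cong_AE)
    have keq: "kernel n (?t *\<^sub>R y - R z) = kernel n (?t *\<^sub>R x - z)" for z
      by (rule kernel_norm) (metis R(2,4) R.diff R.scale)
    show "AE z in lborel. indicator (ball 0 1) (R z) *\<^sub>R (u0 (R z) * kernel n (?t *\<^sub>R y - R z))
        = indicator (ball 0 1) z *\<^sub>R (u0 z * kernel n (?t *\<^sub>R x - z))"
      using sym by eventually_elim (auto simp: indicator_def R(2) keq)
  qed measurable
  also have "\<dots> = mollify n u0 x"
    unfolding mollify_def smear_def by (rule integral_ball_eq_lborel[symmetric]) measurable
  finally show ?thesis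
    using mollify_cong_AE[OF eq um u0m] by simp
qed

section \<open>The surface measure of the sphere\<close>

lemma space_sphere_measure: "space (sphere_measure :: 'a::euclidean_space measure) = sphere 0 1"
  by (simp add: sphere_measure_def space_scale_measure)

lemma sets_sphere_measure:
  "sets (sphere_measure :: 'a::euclidean_space measure) = sets (restrict_space borel (sphere 0 1))"
  by (simp add: sphere_measure_def)

lemma borel_imp_sphere_measurable:
  fixes g :: "'a::euclidean_space \<Rightarrow> 'b::topological_space"
  assumes "g \<in> borel_measurable borel"
  shows "g \<in> borel_measurable sphere_measure"
proof -
  have "g \<in> borel_measurable (restrict_space borel (sphere 0 1))"
    using assms by (rule measurable_restrict_space1)
  then show ?thesis
    by (simp cong: measurable_cong_sets[OF sets_sphere_measure refl])
qed

lemma sgn_ball_measurable: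
  "sgn \<in> restrict_space lborel (ball (0::'a::euclidean_space) 1 - {0}) \<rightarrow>\<^sub>M restrict_space borel (sphere 0 1)"
  by (intro measurable_restrict_space2 measurable_restrict_space1)
    (auto simp: space_restrict_space norm_sgn)

lemma scale_measure_eq_density: "scale_measure c M = density M (\<lambda>_. c)"
  by (rule measure_eqI) (simp_all add: emeasure_density_const)

text \<open>The surface measure is a multiple of an image measure under \<^const>\<open>sgn\<close>, so functions on the sphere are
  integrated through their radially constant extensions. The missing origin is a null set.\<close>

lemma integral_sphere_measure:
  fixes g :: "'a::euclidean_space \<Rightarrow> real"
  assumes [measurable]: "g \<in> borel_measurable borel"
  shows "(LINT x|sphere_measure. g x) = DIM('a) * (LINT x|ballM. g (sgn x))"
    and "integrable sphere_measure g \<longleftrightarrow> integrable ballM (\<lambda>x. g (sgn x))"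
proof -
  let ?M = "restrict_space lborel (ball (0::'a) 1 - {0})"
  let ?D = "distr ?M (restrict_space borel (sphere 0 1)) sgn"
  have gm: "g \<in> borel_measurable (restrict_space borel (sphere 0 1))"
    by (rule measurable_restrict_space1) fact
  have gD: "g \<in> borel_measurable ?D"
    using gm by simp
  have s: "(sphere_measure :: 'a measure) = density ?D (\<lambda>_. ennreal (real DIM('a)))"
    unfolding sphere_measure_def scale_measure_eq_density ennreal_of_nat_eq_real_of_nat ..
  have set: "ball (0::'a) 1 - {0} \<inter> space lborel \<in> sets lborel" by simp
  have AE0: "AE x in (lborel :: 'a measure). x \<noteq> 0"
    by (rule AE_lborel_singleton)
  have i1: "(LINT x|lborel. indicator (ball 0 1 - {0}) x *\<^sub>R g (sgn x)) = (LINT x|(lborel :: 'a measure). indicator (ball 0 1) x *\<^sub>R g (sgn x))"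
    by (intro integral_cong_AE) (use AE0 in \<open>auto simp: indicator_def elim!: eventually_mono\<close>)
  have i2: "integrable lborel (\<lambda>x. indicator (ball 0 1 - {0}) x *\<^sub>R g (sgn x)) \<longleftrightarrow> integrable (lborel :: 'a measure) (\<lambda>x. indicator (ball 0 1) x *\<^sub>R g (sgn x))"
    by (intro integrable_cong_AE) (use AE0 in \<open>auto simp: indicator_def elim!: eventually_mono\<close>)
  have gs: "(\<lambda>x. g (sgn x)) \<in> borel_measurable borel" by measurable
  have "(LINT x|sphere_measure. g x) = (LINT x|?D. real DIM('a) *\<^sub>R g x)"
    unfolding s by (rule integral_density) (use gD in auto)
  also have "\<dots> = DIM('a) * (LINT x|?D. g x)" by simp
  also have "(LINT x|?D. g x) = (LINT x|?M. g (sgn x))"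
    by (rule integral_distr[OF sgn_ball_measurable gm])
  also have "\<dots> = (LINT x|lborel. indicator (ball 0 1 - {0}) x *\<^sub>R g (sgn x))"
    by (rule integral_restrict_space) simp
  also note i1
  also have "(LINT x|lborel. indicator (ball 0 1) x *\<^sub>R g (sgn x)) = (LINT x|ballM. g (sgn x))"
    by (rule integral_ball_eq_lborel(1)[OF gs, symmetric])
  finally show "(LINT x|sphere_measure. g x) = DIM('a) * (LINT x|ballM. g (sgn x))" .
  have "integrable sphere_measure g \<longleftrightarrow> integrable ?D (\<lambda>x. real DIM('a) *\<^sub>R g x)"
    unfolding s by (rule integrable_density) (use gD in auto)
  also have "\<dots> \<longleftrightarrow> integrable ?D g" by simp
  also have "\<dots> \<longleftrightarrow> integrable ?M (\<lambda>x. g (sgn x))"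
    by (rule integrable_distr_eq[OF sgn_ball_measurable gm])
  also have "\<dots> \<longleftrightarrow> integrable lborel (\<lambda>x. indicator (ball 0 1 - {0}) x *\<^sub>R g (sgn x))"
    by (rule integrable_restrict_space) simp
  also note i2
  also have "integrable lborel (\<lambda>x. indicator (ball 0 1) x *\<^sub>R g (sgn x)) \<longleftrightarrow> integrable ballM (\<lambda>x. g (sgn x))"
    by (rule integral_ball_eq_lborel(2)[OF gs, symmetric])
  finally show "integrable sphere_measure g \<longleftrightarrow> integrable ballM (\<lambda>x. g (sgn x))" .
qed

lemma continuous_sphere_measurable:
  fixes g :: "'a::euclidean_space \<Rightarrow> real"
  shows "continuous_on UNIV g \<Longrightarrow> g \<in> borel_measurable sphere_measure"
  by (intro borel_imp_sphere_measurable borel_measurable_continuous_onI)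

lemma continuous_sphere_integrable:
  fixes g :: "'a::euclidean_space \<Rightarrow> real"
  assumes g: "continuous_on UNIV g"
  shows "integrable sphere_measure g"
proof -
  have gm [measurable]: "g \<in> borel_measurable borel"
    by (rule borel_measurable_continuous_onI[OF g])
  obtain C where C: "C > 0" "\<And>x. x \<in> cball 0 1 \<Longrightarrow> norm (g x) \<le> C"
    using continuous_bounded_ball[OF continuous_on_subset[OF g]] by blast
  have "(\<lambda>x. g (sgn x)) \<in> borel_measurable ballM"
    by (intro measurable_restrict_space1 measurable_completion) measurable
  then show ?thesis
    unfolding integral_sphere_measure(2)[OF gm]
    by (rule integrable_bounded_ball[where C = C]) (use C(2) in \<open>auto simp: norm_sgn\<close>)
qed

lemma continuous_L2_sphere:
  fixes g :: "'a::euclidean_space \<Rightarrow> real"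
  assumes g: "continuous_on UNIV g"
  shows "L2 sphere_measure g"
  unfolding L2_iff_real
  by (intro conjI continuous_sphere_measurable continuous_sphere_integrable continuous_intros g)

lemma smooth_L2_sphere: "smooth g \<Longrightarrow> L2 sphere_measure g"
  by (intro continuous_L2_sphere smooth_continuous_on)

lemma finite_measure_sphere: "finite_measure (sphere_measure :: 'a::euclidean_space measure)"
proof (rule finite_measureI)
  have "integrable (sphere_measure :: 'a measure) (\<lambda>_. 1 :: real)"
    by (intro continuous_sphere_integrable continuous_intros)
  then show "emeasure (sphere_measure :: 'a measure) (space sphere_measure) \<noteq> \<infinity>"
    by (simp add: integrable_iff_bounded)
qed

lemma measure_sphere_pos:
  "0 < measure (sphere_measure :: 'a::euclidean_space measure) (sphere 0 1)"
proof -
  have "measure (sphere_measure :: 'a measure) (sphere 0 1) = (LINT x|(sphere_measure :: 'a measure). 1)"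
    by (simp add: space_sphere_measure)
  also have "\<dots> = DIM('a) * measure (ballM :: 'a measure) (ball 0 1)"
    by (subst integral_sphere_measure(1)) (simp_all add: space_restrict_space)
  also have "measure (ballM :: 'a measure) (ball 0 1) = measure lborel (ball (0::'a) 1)"
    by (simp add: measure_restrict_space)
  finally show ?thesis
    using content_ball_pos[of 1 "0::'a"] by simp
qed

lemma L2_sphere_integrable:
  fixes g :: "'a::euclidean_space \<Rightarrow> real"
  assumes "L2 sphere_measure g"
  shows "integrable sphere_measure g"
  using L2_mult_integrable[OF assms continuous_L2_sphere[of "\<lambda>_. 1"]] by simp

text \<open>Rescale the ball of radius \<open>s\<close> to the unit ball. This serves to compute integrals over thin shells.\<close>

lemma integral_ball_minus_dilated:
  fixes p :: "'a::euclidean_space \<Rightarrow> real"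
  assumes pm [measurable]: "p \<in> borel_measurable borel"
    and p: "integrable ballM p" and s: "0 < s" "s < 1"
  shows "(LINT x|ballM. p x) - s ^ DIM('a) * (LINT x|ballM. p (s *\<^sub>R x))
      = (LINT x|lborel. indicator (ball 0 1 - ball 0 s) x * p x)"
    and "integrable lborel (\<lambda>x. indicator (ball 0 1 - ball 0 s) x * p x)"
proof -
  have i: "integrable lborel (\<lambda>x. indicator (ball 0 1) x * p x)"
    using p by (subst (asm) integral_ball_eq_lborel(2)) auto
  have j: "integrable lborel (\<lambda>x. indicator (ball 0 s) x * p x)"
    by (rule Bochner_Integration.integrable_bound[OF i])
      (use s in \<open>auto simp: indicator_def intro!: AE_I2\<close>)
  have eq: "(\<lambda>x. indicator (ball 0 1 - ball 0 s) x * p x)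
      = (\<lambda>x. indicator (ball 0 1) x * p x - indicator (ball 0 s) x * p x)"
    using s by (auto simp: fun_eq_iff indicator_def)
  show "integrable lborel (\<lambda>x. indicator (ball 0 1 - ball 0 s) x * p x)"
    unfolding eq using i j by simp
  have "(LINT x|lborel. indicator (ball 0 s) x * p x)
      = s ^ DIM('a) * (LINT z|(lborel :: 'a measure). indicator (ball 0 s) (s *\<^sub>R z) * p (s *\<^sub>R z))"
    using integral_substitute(2)[OF j, of s 0] s by simp
  also have "(\<lambda>z::'a. indicator (ball 0 s) (s *\<^sub>R z) :: real) = indicator (ball 0 1)"
    using s by (auto simp: fun_eq_iff indicator_def)
  then have "(LINT z|(lborel :: 'a measure). indicator (ball 0 s) (s *\<^sub>R z) * p (s *\<^sub>R z))
      = (LINT z|lborel. indicator (ball 0 1) z *\<^sub>R p (s *\<^sub>R z))"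
    by (simp add: fun_eq_iff)
  also have "\<dots> = (LINT x|ballM. p (s *\<^sub>R x))"
    by (rule integral_ball_eq_lborel(1)[symmetric]) measurable
  finally show "(LINT x|ballM. p x) - s ^ DIM('a) * (LINT x|ballM. p (s *\<^sub>R x))
      = (LINT x|lborel. indicator (ball 0 1 - ball 0 s) x * p x)"
    unfolding eq using i j integral_ball_eq_lborel(1)[OF pm] by simp
qed

text \<open>The divergence theorem for the field \<open>f x *\<^sub>R x\<close>. Differentiate the integral of \<open>f\<close> over the
  ball of radius \<open>s\<close> at \<open>s = 1\<close>: rescaling to the unit ball gives the right hand side, and on the thin
  shell that is left out \<open>f\<close> may be replaced by its radially constant extension \<open>f \<circ> sgn\<close>, whose
  integral over shells is the surface integral by definition.\<close>

theorem radial_divergence: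
  fixes f :: "'a::euclidean_space \<Rightarrow> real"
  assumes f: "smooth f"
  shows "(LINT x|sphere_measure. f x) = (LINT x|ballM. DIM('a) * f x + grad f x \<bullet> x)"
proof -
  let ?L = "ballM :: 'a measure" and ?d = "DIM('a)"
  define s where "s n = 1 - width n" for n
  have s: "0 < s n" "s n < 1" "1 - s n = width n" for n using width[of n] by (auto simp: s_def)
  have s1: "s \<longlonglongrightarrow> 1"
    unfolding s_def[abs_def] using tendsto_diff[OF tendsto_const width_tendsto, of 1] by simp
  define h where "h x = f (sgn x)" for x
  have fm [measurable]: "f \<in> borel_measurable borel" by (intro borel_measurable_continuous_onI smooth_continuous_on f)
  have hm [measurable]: "h \<in> borel_measurable borel" unfolding h_def[abs_def] by measurable
  have fi: "integrable ?L f" by (intro continuous_integrable_ball smooth_continuous_on f)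
  have hi: "integrable ?L h"
    unfolding h_def[abs_def] integral_sphere_measure(2)[OF fm, symmetric]
    by (intro continuous_sphere_integrable smooth_continuous_on f)
  have fsi: "integrable ?L (\<lambda>x. f (s n *\<^sub>R x))" for n
    using smooth_affine[OF f, of "s n" 0] by (intro continuous_integrable_ball smooth_continuous_on) simp
  obtain C where C: "C > 0" "\<And>x. x \<in> cball 0 1 \<Longrightarrow> norm (grad f x) \<le> C"
    using continuous_bounded_ball[OF continuous_on_grad[OF f]] by blast
  have lip: "\<bar>f x - f y\<bar> \<le> C * norm (x - y)" if "x \<in> cball 0 1" "y \<in> cball 0 1" for x y
  proof -
    have "norm (f x - f y) \<le> C * norm (x - y)"
    proof (rule differentiable_bound[of "cball 0 1" f "\<lambda>x h. grad f x \<bullet> h" C])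
      fix z :: 'a assume z: "z \<in> cball 0 1"
      show "(f has_derivative (\<lambda>h. grad f z \<bullet> h)) (at z within cball 0 1)"
        by (rule has_derivative_at_withinI[OF smooth_has_grad[OF f]])
      have "onorm (\<lambda>h. grad f z \<bullet> h) \<le> norm (grad f z)"
        by (intro onorm_le Cauchy_Schwarz_ineq2[unfolded real_norm_def[symmetric]])
      with C(2)[OF z] show "onorm (\<lambda>h. grad f z \<bullet> h) \<le> C" by simp
    qed (use that in auto)
    then show ?thesis by simp
  qed
  define A where "A n = (LINT x|?L. (f x - f (s n *\<^sub>R x)) / width n)" for n
  have A: "A \<longlonglongrightarrow> (LINT x|?L. grad f x \<bullet> x)"
    unfolding A_def[abs_def]
  proof (rule integral_dominated_convergence)
    show "(\<lambda>x. grad f x \<bullet> x) \<in> borel_measurable ?L"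
      by (intro continuous_measurable_ball continuous_intros continuous_on_grad f)
    show "(\<lambda>x. (f x - f (s n *\<^sub>R x)) / width n) \<in> borel_measurable ?L" for n
      using fi fsi[of n] by simp
    show "integrable ?L (\<lambda>_. C)" by (intro continuous_integrable_ball continuous_intros)
    show "AE x in ?L. (\<lambda>n. (f x - f (s n *\<^sub>R x)) / width n) \<longlonglongrightarrow> grad f x \<bullet> x"
    proof (rule AE_I2)
      fix x
      have "((\<lambda>t. f (x + t *\<^sub>R x)) has_real_derivative grad f x \<bullet> x) (at 0)"
      proof -
        have "((\<lambda>t. x + t *\<^sub>R x) has_derivative (\<lambda>t. t *\<^sub>R x)) (at 0)"
          by (auto intro!: derivative_eq_intros)
        from has_derivative_compose[OF this, of f "\<lambda>h. grad f x \<bullet> h"] smooth_has_grad[OF f, of x]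
        show ?thesis by (simp add: has_field_derivative_def mult.commute[of _ "grad f x \<bullet> x"])
      qed
      then have "((\<lambda>t. (f (x + t *\<^sub>R x) - f x) / t) \<longlongrightarrow> grad f x \<bullet> x) (at 0)"
        by (simp add: DERIV_def)
      moreover have "filterlim (\<lambda>n. - width n) (at 0) sequentially"
        using tendsto_minus[OF width_tendsto] width(1) by (simp add: filterlim_at less_imp_neq[THEN not_sym])
      ultimately have "(\<lambda>n. (f (x + (- width n) *\<^sub>R x) - f x) / (- width n)) \<longlonglongrightarrow> grad f x \<bullet> x"
        by (rule filterlim_compose)
      moreover have "(f (x + (- width n) *\<^sub>R x) - f x) / (- width n) = (f x - f (s n *\<^sub>R x)) / width n" for n
        by (simp add: s_def scaleR_diff_left minus_divide_left)
      ultimately show "(\<lambda>n. (f x - f (s n *\<^sub>R x)) / width n) \<longlonglongrightarrow> grad f x \<bullet> x"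
        by simp
    qed
    show "AE x in ?L. norm ((f x - f (s n *\<^sub>R x)) / width n) \<le> C" for n
    proof (rule AE_I2)
      fix x assume "x \<in> space ?L"
      then have x: "norm x \<le> 1" by simp
      have sx: "norm (s n *\<^sub>R x) \<le> 1"
        using x s[of n] by (simp add: mult_le_one)
      have "\<bar>f x - f (s n *\<^sub>R x)\<bar> \<le> C * norm (x - s n *\<^sub>R x)"
        using lip[of x "s n *\<^sub>R x"] x sx by simp
      also have "x - s n *\<^sub>R x = width n *\<^sub>R x" by (simp add: s_def scaleR_diff_left)
      also have "C * norm (width n *\<^sub>R x) \<le> C * width n"
        using x C width[of n] by simp
      finally show "norm ((f x - f (s n *\<^sub>R x)) / width n) \<le> C"
        using width[of n] by (simp add: divide_le_eq abs_of_pos)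
    qed
  qed
  define q where "q n = (1 - s n ^ ?d) / width n" for n
  have q_eq: "q n = (\<Sum>i<?d. s n ^ i)" for n
    using width(1)[of n] by (simp add: q_def one_diff_power_eq s(3))
  have q: "q \<longlonglongrightarrow> real ?d"
  proof -
    have "(\<lambda>n. \<Sum>i<?d. s n ^ i) \<longlonglongrightarrow> (\<Sum>i<?d. 1 ^ i)"
      by (intro tendsto_intros s1)
    then show ?thesis by (simp add: q_eq[abs_def])
  qed
  define V :: real where "V = (LINT x|?L. 1)"
  have shell: "\<bar>q n * (LINT x|?L. f x) + s n ^ ?d * A n - q n * (LINT x|?L. h x)\<bar> \<le> C * (width n * q n * V)" for n
  proof -
    let ?S = "ball (0::'a) 1 - ball 0 (s n)"
    note F = integral_ball_minus_dilated[OF fm fi s(1) s(2), of n]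
      and H = integral_ball_minus_dilated[OF hm hi s(1) s(2), of n]
    have oi: "integrable ?L (\<lambda>_. 1 :: real)" by (intro continuous_integrable_ball continuous_intros)
    have one_m: "(\<lambda>_::'a. 1 :: real) \<in> borel_measurable borel" by simp
    note One = integral_ball_minus_dilated[OF one_m oi s(1) s(2), of n]
    have hs: "h (s n *\<^sub>R x) = h x" for x
      using s[of n] by (simp add: h_def sgn_scaleR)
    have "\<bar>(LINT x|lborel. indicator ?S x * f x) - (LINT x|lborel. indicator ?S x * h x)\<bar>
        = \<bar>\<integral>x. indicator ?S x * f x - indicator ?S x * h x \<partial>lborel\<bar>"
      using F(2) H(2) by simp
    also have "\<dots> \<le> (LINT x|lborel. (C * width n) * (indicator ?S x * 1))"
    proof (rule integral_abs_bound_integral)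
      show "integrable lborel (\<lambda>x. indicator ?S x * f x - indicator ?S x * h x)"
        using F(2) H(2) by simp
      show "integrable lborel (\<lambda>x. (C * width n) * (indicator ?S x * 1))"
        by (rule integrable_mult_right) (rule One(2))
      fix x :: 'a
      show "\<bar>indicator ?S x * f x - indicator ?S x * h x\<bar> \<le> (C * width n) * (indicator ?S x * 1)"
      proof (cases "x \<in> ?S")
        case True
        then have x: "norm x < 1" "s n \<le> norm x" by auto
        with s[of n] have x0: "x \<noteq> 0" by auto
        have "norm (x - sgn x) = 1 - norm x"
        proof -
          have "norm (sgn x - x) = norm ((inverse (norm x) - 1) *\<^sub>R x)"
            by (simp add: sgn_div_norm scaleR_diff_left)
          also have "\<dots> = \<bar>(inverse (norm x) - 1) * norm x\<bar>"
            by (simp add: abs_mult)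
          also have "(inverse (norm x) - 1) * norm x = 1 - norm x"
            using x0 by (simp add: left_diff_distrib)
          finally show ?thesis using x by (simp add: norm_minus_commute)
        qed
        also have "\<dots> \<le> width n" using x s(3)[of n] by simp
        finally have "C * norm (x - sgn x) \<le> C * width n" using C(1) by simp
        moreover have "\<bar>f x - f (sgn x)\<bar> \<le> C * norm (x - sgn x)"
          by (rule lip) (use x x0 in \<open>auto simp: norm_sgn\<close>)
        ultimately show ?thesis using True by (simp add: h_def)
      qed simp
    qed
    also have "\<dots> = (C * width n) * ((1 - s n ^ ?d) * V)"
    proof -
      have "(LINT x|lborel. indicator ?S x * 1) = (1 - s n ^ ?d) * V"
        using One(1) unfolding V_def by (simp only: left_diff_distrib mult_1_left)
      then show ?thesis by simp
    qed
    finally have "\<bar>((LINT x|?L. f x) - s n ^ ?d * (LINT x|?L. f (s n *\<^sub>R x))) - (1 - s n ^ ?d) * (LINT x|?L. h x)\<bar>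
        \<le> (C * width n) * ((1 - s n ^ ?d) * V)"
      using F(1) H(1) unfolding hs by (simp add: left_diff_distrib)
    moreover have wq: "1 - s n ^ ?d = width n * q n"
      using width(1)[of n] by (simp add: q_def)
    moreover have "(LINT x|?L. f x) - s n ^ ?d * (LINT x|?L. f (s n *\<^sub>R x))
        = width n * (q n * (LINT x|?L. f x) + s n ^ ?d * A n)"
    proof -
      have wA: "width n * A n = (LINT x|?L. f x) - (LINT x|?L. f (s n *\<^sub>R x))"
        using width(1)[of n] fi fsi[of n] by (simp add: A_def)
      have "width n * (q n * (LINT x|?L. f x) + s n ^ ?d * A n)
        = (width n * q n) * (LINT x|?L. f x) + s n ^ ?d * (width n * A n)"
        by (simp add: algebra_simps)
      also have "\<dots> = (1 - s n ^ ?d) * (LINT x|?L. f x) + s n ^ ?d * ((LINT x|?L. f x) - (LINT x|?L. f (s n *\<^sub>R x)))"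
        by (simp only: wA wq)
      finally show ?thesis by (simp add: algebra_simps)
    qed
    ultimately have le: "\<bar>width n * (q n * (LINT x|?L. f x) + s n ^ ?d * A n) - (width n * q n) * (LINT x|?L. h x)\<bar>
        \<le> (C * width n) * ((width n * q n) * V)"
      by (simp only:)
    have "width n * \<bar>q n * (LINT x|?L. f x) + s n ^ ?d * A n - q n * (LINT x|?L. h x)\<bar>
        = \<bar>width n * (q n * (LINT x|?L. f x) + s n ^ ?d * A n - q n * (LINT x|?L. h x))\<bar>"
      using width(1)[of n] by (simp only: abs_mult abs_of_pos)
    also have "\<dots> = \<bar>width n * (q n * (LINT x|?L. f x) + s n ^ ?d * A n) - (width n * q n) * (LINT x|?L. h x)\<bar>"
      by (simp only: right_diff_distrib mult.assoc)
    also note le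
    also have "(C * width n) * ((width n * q n) * V) = width n * (C * (width n * q n * V))"
      by (simp only: mult_ac)
    finally show ?thesis
      using width(1)[of n] by (rule mult_left_le_imp_le)
  qed
  have "(\<lambda>n. C * (width n * q n * V)) \<longlonglongrightarrow> C * (0 * real ?d * V)"
    by (intro tendsto_intros width_tendsto q)
  then have b0: "(\<lambda>n. C * (width n * q n * V)) \<longlonglongrightarrow> 0"
    by simp
  have "(\<lambda>n. q n * (LINT x|?L. f x) + s n ^ ?d * A n - q n * (LINT x|?L. h x)) \<longlonglongrightarrow> 0"
    by (rule Lim_null_comparison[OF _ b0], rule always_eventually) (simp only: real_norm_def shell simp_thms)
  moreover have "(\<lambda>n. q n * (LINT x|?L. f x) + s n ^ ?d * A n - q n * (LINT x|?L. h x))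
      \<longlonglongrightarrow> real ?d * (LINT x|?L. f x) + 1 ^ ?d * (LINT x|?L. grad f x \<bullet> x) - real ?d * (LINT x|?L. h x)"
    by (intro tendsto_intros q s1 A)
  ultimately have "0 = real ?d * (LINT x|?L. f x) + 1 ^ ?d * (LINT x|?L. grad f x \<bullet> x) - real ?d * (LINT x|?L. h x)"
    by (rule LIMSEQ_unique)
  then have "real ?d * (LINT x|?L. h x) = real ?d * (LINT x|?L. f x) + (LINT x|?L. grad f x \<bullet> x)" by simp
  moreover have "integrable ?L (\<lambda>x. grad f x \<bullet> x)"
    by (intro continuous_integrable_ball continuous_intros continuous_on_grad f)
  ultimately show ?thesis
    unfolding integral_sphere_measure(1)[OF fm] h_def[abs_def] using fi by simp
qed

section \<open>Traces\<close>

text \<open>The divergence theorem for \<open>(f x)\<^sup>2 *\<^sub>R x\<close>, together with \<open>2 \<bar>f\<bar> \<bar>grad f\<bar> \<le> f\<^sup>2 + \<bar>grad f\<bar>\<^sup>2\<close>.\<close>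

lemma trace_inequality:
  fixes f :: "'a::euclidean_space \<Rightarrow> real"
  assumes f: "smooth f"
  shows "(LINT x|sphere_measure. (f x)\<^sup>2)
    \<le> (real DIM('a) + 1) * ((LINT x|ballM. (f x)\<^sup>2) + (LINT x|ballM. (norm (grad f x))\<^sup>2))"
proof -
  let ?L = "ballM :: 'a measure"
  have i: "integrable ?L (\<lambda>x. (f x)\<^sup>2)" "integrable ?L (\<lambda>x. (norm (grad f x))\<^sup>2)"
    using smooth_L2_ball[OF f] grad_L2_ball[OF f] by (auto simp: L2_def)
  have "(LINT x|sphere_measure. (f x)\<^sup>2) = (LINT x|sphere_measure. f x * f x)"
    by (simp add: power2_eq_square)
  also have "\<dots> = (LINT x|?L. DIM('a) * (f x * f x) + grad (\<lambda>x. f x * f x) x \<bullet> x)"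
    by (rule radial_divergence[OF smooth_mult[OF f f]])
  also have "\<dots> \<le> (LINT x|?L. (real DIM('a) + 1) * (f x)\<^sup>2 + (real DIM('a) + 1) * (norm (grad f x))\<^sup>2)"
  proof (rule integral_mono)
    show "integrable ?L (\<lambda>x. DIM('a) * (f x * f x) + grad (\<lambda>x. f x * f x) x \<bullet> x)"
      by (intro continuous_integrable_ball continuous_intros continuous_on_grad smooth_continuous_on smooth_mult f)
    show "integrable ?L (\<lambda>x. (real DIM('a) + 1) * (f x)\<^sup>2 + (real DIM('a) + 1) * (norm (grad f x))\<^sup>2)"
      using i by simp
    fix x assume "x \<in> space ?L"
    then have x: "norm x \<le> 1" by simp
    have "grad (\<lambda>x. f x * f x) x \<bullet> x = 2 * (f x * (grad f x \<bullet> x))"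
      by (simp add: grad_mult[OF f f] inner_add_left)
    also have "\<dots> \<le> 2 * (\<bar>f x\<bar> * norm (grad f x))"
    proof -
      have "\<bar>grad f x \<bullet> x\<bar> \<le> norm (grad f x) * 1"
        using Cauchy_Schwarz_ineq2[of "grad f x" x] mult_left_mono[OF x, of "norm (grad f x)"] by simp
      then have "\<bar>f x * (grad f x \<bullet> x)\<bar> \<le> \<bar>f x\<bar> * norm (grad f x)"
        unfolding abs_mult by (intro mult_left_mono) auto
      then show ?thesis by simp
    qed
    also have "\<dots> \<le> (f x)\<^sup>2 + (norm (grad f x))\<^sup>2"
      using sum_squares_bound[of "\<bar>f x\<bar>" "norm (grad f x)"] by (simp add: mult.assoc)
    also have "\<dots> \<le> (f x)\<^sup>2 + (real DIM('a) + 1) * (norm (grad f x))\<^sup>2"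
      by (simp add: mult_right_mono[of 1 "real DIM('a) + 1" "(norm (grad f x))\<^sup>2", simplified])
    finally show "DIM('a) * (f x * f x) + grad (\<lambda>x. f x * f x) x \<bullet> x
        \<le> (real DIM('a) + 1) * (f x)\<^sup>2 + (real DIM('a) + 1) * (norm (grad f x))\<^sup>2"
      by (simp add: power2_eq_square algebra_simps)
  qed
  also have "\<dots> = (real DIM('a) + 1) * ((LINT x|?L. (f x)\<^sup>2) + (LINT x|?L. (norm (grad f x))\<^sup>2))"
    using i by (simp add: distrib_left)
  finally show ?thesis .
qed

text \<open>Approximations of the same \<open>H1\<close> function have nearby restrictions to the sphere. With one approximating sequence
  this makes the restrictions a Cauchy sequence, with two it shows that the limits agree.\<close>

lemma trace_difference_bound:
  fixes f g :: "'a::euclidean_space \<Rightarrow> real"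
  assumes f: "smooth f" and g: "smooth g" and u: "L2 ballM u" and G: "L2 ballM G"
  shows "(LINT x|sphere_measure. (f x - g x)\<^sup>2)
    \<le> 2 * (real DIM('a) + 1) * ((LINT x|ballM. (f x - u x)\<^sup>2) + (LINT x|ballM. (g x - u x)\<^sup>2)
      + (LINT x|ballM. (norm (grad f x - G x))\<^sup>2) + (LINT x|ballM. (norm (grad g x - G x))\<^sup>2))"
proof -
  let ?L = "ballM :: 'a measure"
  have 1: "(LINT x|?L. (f x - g x)\<^sup>2) \<le> 2 * (LINT x|?L. (f x - u x)\<^sup>2) + 2 * (LINT x|?L. (g x - u x)\<^sup>2)"
    using square_integral_triangle[OF L2_diff[OF smooth_L2_ball[OF f] u] L2_cmult[OF L2_diff[OF smooth_L2_ball[OF g] u], of "-1"]]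
    by (simp add: power2_commute)
  have 2: "(LINT x|?L. (norm (grad (\<lambda>x. f x - g x) x))\<^sup>2)
      \<le> 2 * (LINT x|?L. (norm (grad f x - G x))\<^sup>2) + 2 * (LINT x|?L. (norm (grad g x - G x))\<^sup>2)"
    using square_integral_triangle[OF L2_diff[OF grad_L2_ball[OF f] G] L2_scaleR[OF L2_diff[OF grad_L2_ball[OF g] G], of "-1"]]
    by (simp add: grad_diff[OF f g] norm_minus_commute)
  have "(LINT x|sphere_measure. (f x - g x)\<^sup>2)
      \<le> (real DIM('a) + 1) * ((LINT x|?L. (f x - g x)\<^sup>2) + (LINT x|?L. (norm (grad (\<lambda>x. f x - g x) x))\<^sup>2))"
    by (rule trace_inequality[OF smooth_diff[OF f g]])
  also have "\<dots> \<le> (real DIM('a) + 1) * ((2 * (LINT x|?L. (f x - u x)\<^sup>2) + 2 * (LINT x|?L. (g x - u x)\<^sup>2))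
      + (2 * (LINT x|?L. (norm (grad f x - G x))\<^sup>2) + 2 * (LINT x|?L. (norm (grad g x - G x))\<^sup>2)))"
    by (intro mult_left_mono add_mono 1 2) simp
  finally show ?thesis by (simp add: algebra_simps)
qed

theorem trace_unique:
  fixes u :: "'a::euclidean_space \<Rightarrow> real"
  assumes u: "u \<in> H1 (ball 0 1)"
    and g: "has_trace (ball 0 1) sphere_measure u g" and h: "has_trace (ball 0 1) sphere_measure u h"
  shows "AE x in sphere_measure. g x = h x"
proof -
  let ?L = "ballM :: 'a measure" and ?G = "wgrad (ball 0 1) u"
  obtain \<phi> where \<phi>: "L2 sphere_measure g" "\<And>n. smooth (\<phi> n)"
      "(\<lambda>n. \<integral>x. (\<phi> n x - u x)\<^sup>2 \<partial>?L) \<longlonglongrightarrow> 0"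
      "(\<lambda>n. \<integral>x. (norm (grad (\<phi> n) x - ?G x))\<^sup>2 \<partial>?L) \<longlonglongrightarrow> 0"
      "(\<lambda>n. \<integral>x. (\<phi> n x - g x)\<^sup>2 \<partial>sphere_measure) \<longlonglongrightarrow> 0"
    using g unfolding has_trace_def by blast
  obtain \<psi> where \<psi>: "L2 sphere_measure h" "\<And>n. smooth (\<psi> n)"
      "(\<lambda>n. \<integral>x. (\<psi> n x - u x)\<^sup>2 \<partial>?L) \<longlonglongrightarrow> 0"
      "(\<lambda>n. \<integral>x. (norm (grad (\<psi> n) x - ?G x))\<^sup>2 \<partial>?L) \<longlonglongrightarrow> 0"
      "(\<lambda>n. \<integral>x. (\<psi> n x - h x)\<^sup>2 \<partial>sphere_measure) \<longlonglongrightarrow> 0"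
    using h unfolding has_trace_def by blast
  show ?thesis
  proof (rule L2_limit_unique[where F = \<phi> and G = \<psi>])
    show "(\<lambda>n. \<integral>x. (norm (\<phi> n x - \<psi> n x))\<^sup>2 \<partial>sphere_measure) \<longlonglongrightarrow> 0"
    proof (rule Lim_null_comparison[OF always_eventually[OF allI]])
      fix n
      show "norm (LINT x|sphere_measure. (norm (\<phi> n x - \<psi> n x))\<^sup>2)
        \<le> 2 * (real DIM('a) + 1) * ((LINT x|?L. (\<phi> n x - u x)\<^sup>2) + (LINT x|?L. (\<psi> n x - u x)\<^sup>2)
          + (LINT x|?L. (norm (grad (\<phi> n) x - ?G x))\<^sup>2) + (LINT x|?L. (norm (grad (\<psi> n) x - ?G x))\<^sup>2))"
        using trace_difference_bound[OF \<phi>(2) \<psi>(2) H1_wgrad(1)[OF u] H1_wgrad(3)[OF u], of n n] by simp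
    next
      have "(\<lambda>n. 2 * (real DIM('a) + 1) * ((LINT x|?L. (\<phi> n x - u x)\<^sup>2) + (LINT x|?L. (\<psi> n x - u x)\<^sup>2)
          + (LINT x|?L. (norm (grad (\<phi> n) x - ?G x))\<^sup>2) + (LINT x|?L. (norm (grad (\<psi> n) x - ?G x))\<^sup>2)))
        \<longlonglongrightarrow> 2 * (real DIM('a) + 1) * (0 + 0 + 0 + 0)"
        by (intro tendsto_intros \<phi> \<psi>)
      then show "(\<lambda>n. 2 * (real DIM('a) + 1) * ((LINT x|?L. (\<phi> n x - u x)\<^sup>2) + (LINT x|?L. (\<psi> n x - u x)\<^sup>2)
          + (LINT x|?L. (norm (grad (\<phi> n) x - ?G x))\<^sup>2) + (LINT x|?L. (norm (grad (\<psi> n) x - ?G x))\<^sup>2))) \<longlonglongrightarrow> 0"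
        by simp
    qed
  qed (use \<phi> \<psi> in \<open>auto intro: smooth_L2_sphere\<close>)
qed

lemma boundary_trace_eq_AE:
  fixes u :: "'a::euclidean_space \<Rightarrow> real"
  assumes u: "u \<in> H1 (ball 0 1)" and g: "has_trace (ball 0 1) sphere_measure u g"
  shows "has_trace (ball 0 1) sphere_measure u (boundary_trace (ball 0 1) sphere_measure u)"
    and "AE x in sphere_measure. boundary_trace (ball 0 1) sphere_measure u x = g x"
proof -
  show *: "has_trace (ball 0 1) sphere_measure u (boundary_trace (ball 0 1) sphere_measure u)"
    unfolding boundary_trace_def by (rule someI[of "has_trace (ball 0 1) sphere_measure u", OF g])
  show "AE x in sphere_measure. boundary_trace (ball 0 1) sphere_measure u x = g x"
    by (rule trace_unique[OF u * g])
qed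

lemma L2_sphere_const: "L2 (sphere_measure :: 'a::euclidean_space measure) (\<lambda>_. a :: real)"
  by (intro continuous_L2_sphere continuous_intros)

lemma integral_sphere_const:
  "(LINT x|(sphere_measure :: 'a::euclidean_space measure). c) = measure (sphere_measure :: 'a measure) (sphere 0 1) * (c::real)"
  by (simp add: space_sphere_measure)

text \<open>The mollifications of a radial function are constant on the sphere, and these constants
  converge by the trace inequality.\<close>

theorem radial_has_trace_const:
  fixes u :: "'a::euclidean_space \<Rightarrow> real"
  assumes u: "u \<in> H1 (ball 0 1)" and rad: "radially_symmetric (ball 0 1) u"
  obtains a where "has_trace (ball 0 1) sphere_measure u (\<lambda>_. a)"
proof -
  let ?L = "ballM :: 'a measure" and ?G = "wgrad (ball 0 1) u"
  let ?A = "measure (sphere_measure :: 'a measure) (sphere 0 1)"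
  note m = mollify_H1_tendsto[OF u]
  obtain e :: 'a where "e \<in> Basis" using nonempty_Basis by blast
  then have e: "norm e = 1" by (rule norm_Basis)
  define a where "a n = mollify n u e" for n
  have a: "mollify n u x = a n" if "x \<in> sphere 0 1" for n x
    unfolding a_def by (rule mollify_radial[OF H1_wgrad(1)[OF u] rad]) (use that e in simp)
  have sq: "(LINT x|sphere_measure. (mollify n u x - c)\<^sup>2) = ?A * (a n - c)\<^sup>2" for n c
  proof -
    have "(LINT x|sphere_measure. (mollify n u x - c)\<^sup>2) = (LINT x|(sphere_measure :: 'a measure). (a n - c)\<^sup>2)"
      by (intro Bochner_Integration.integral_cong) (auto simp: space_sphere_measure a)
    also have "\<dots> = ?A * (a n - c)\<^sup>2" by (rule integral_sphere_const)
    finally show ?thesis .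
  qed
  define r where "r n = (LINT x|?L. (mollify n u x - u x)\<^sup>2) + (LINT x|?L. (norm (grad (mollify n u) x - ?G x))\<^sup>2)" for n
  have r: "r \<longlonglongrightarrow> 0" unfolding r_def[abs_def] using tendsto_add[OF m(2,3)] by simp
  have bound: "?A * (a n - a k)\<^sup>2 \<le> 2 * (real DIM('a) + 1) * (r n + r k)" for n k
  proof -
    have "?A * (a n - a k)\<^sup>2 = (LINT x|sphere_measure. (mollify n u x - a k)\<^sup>2)"
      by (rule sq[symmetric])
    also have "\<dots> = (LINT x|sphere_measure. (mollify n u x - mollify k u x)\<^sup>2)"
      by (intro Bochner_Integration.integral_cong) (auto simp: space_sphere_measure a)
    finally show ?thesis
      using trace_difference_bound[OF m(1) m(1) H1_wgrad(1)[OF u] H1_wgrad(3)[OF u], of n k]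
      by (simp add: r_def algebra_simps)
  qed
  have "Cauchy a"
  proof (rule CauchyI)
    fix \<epsilon> :: real assume \<epsilon>: "\<epsilon> > 0"
    define \<delta> where "\<delta> = ?A * \<epsilon>\<^sup>2 / (4 * (real DIM('a) + 1))"
    have "\<delta> > 0" unfolding \<delta>_def using measure_sphere_pos[where 'a='a] \<epsilon> by simp
    then have "\<forall>\<^sub>F n in sequentially. r n < \<delta>" using order_tendstoD(2)[OF r] by blast
    then obtain M where M: "\<And>n. n \<ge> M \<Longrightarrow> r n < \<delta>" unfolding eventually_sequentially by blast
    show "\<exists>M. \<forall>m\<ge>M. \<forall>n\<ge>M. norm (a m - a n) < \<epsilon>"
    proof (intro exI[of _ M] allI impI)
      fix k n assume kn: "k \<ge> M" "n \<ge> M"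
      have "?A * (a k - a n)\<^sup>2 \<le> 2 * (real DIM('a) + 1) * (r k + r n)" by (rule bound)
      also have "\<dots> < 2 * (real DIM('a) + 1) * (\<delta> + \<delta>)"
        using M[OF kn(1)] M[OF kn(2)] by (intro mult_strict_left_mono add_strict_mono) auto
      also have "\<dots> = ?A * \<epsilon>\<^sup>2"
      proof -
        have "2 * K * (X / (4 * K) + X / (4 * K)) = X" if "K > 0" for K X :: real
          using that by (simp add: field_simps)
        from this[of "real DIM('a) + 1" "?A * \<epsilon>\<^sup>2"] show ?thesis
          unfolding \<delta>_def by linarith
      qed
      finally have "(a k - a n)\<^sup>2 < \<epsilon>\<^sup>2"
        using measure_sphere_pos[where 'a='a] by simp
      then have "(norm (a k - a n))\<^sup>2 < \<epsilon>\<^sup>2"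
        by simp
      then show "norm (a k - a n) < \<epsilon>"
        using \<epsilon> by (intro power2_less_imp_less[of _ \<epsilon>]) simp_all
    qed
  qed
  then obtain c where c: "a \<longlonglongrightarrow> c" using Cauchy_convergent convergent_def by blast
  have "(\<lambda>n. ?A * (a n - c)\<^sup>2) \<longlonglongrightarrow> ?A * (c - c)\<^sup>2"
    by (intro tendsto_intros c)
  then have "(\<lambda>n. \<integral>x. (mollify n u x - c)\<^sup>2 \<partial>sphere_measure) \<longlonglongrightarrow> 0"
    by (simp add: sq)
  then have "has_trace (ball 0 1) sphere_measure u (\<lambda>_. c)"
    unfolding has_trace_def using m L2_sphere_const by (intro conjI exI[of _ "\<lambda>n. mollify n u"]) auto
  then show ?thesis by (rule that)
qed

lemma has_trace_add_scaled:
  fixes u w :: "'a::euclidean_space \<Rightarrow> real"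
  assumes u: "u \<in> H1 (ball 0 1)" and g: "has_trace (ball 0 1) sphere_measure u g" and w: "smooth w"
  shows "(\<lambda>x. c * u x + w x) \<in> H1 (ball 0 1)"
    and "AE x in ballM. wgrad (ball 0 1) (\<lambda>x. c * u x + w x) x = c *\<^sub>R wgrad (ball 0 1) u x + grad w x"
    and "has_trace (ball 0 1) sphere_measure (\<lambda>x. c * u x + w x) (\<lambda>x. c * g x + w x)"
proof -
  let ?L = "ballM :: 'a measure" and ?G = "wgrad (ball 0 1) u"
  let ?w = "\<lambda>x. c * u x + w x"
  note uL = H1_wgrad(1)[OF u] and GL = H1_wgrad(3)[OF u]
  have wL: "L2 ?L ?w" by (intro L2_add L2_cmult uL smooth_L2_ball w)
  note wg = wgrad_eq_AE[OF wL has_weak_gradient_add_scaled[OF uL H1_wgrad(2)[OF u] w]]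
  show *: "?w \<in> H1 (ball 0 1)" by (rule wg(1))
  show ae: "AE x in ?L. wgrad (ball 0 1) ?w x = c *\<^sub>R ?G x + grad w x" by (rule wg(2))
  obtain \<phi> where \<phi>: "L2 sphere_measure g" "\<And>n. smooth (\<phi> n)"
      "(\<lambda>n. \<integral>x. (\<phi> n x - u x)\<^sup>2 \<partial>?L) \<longlonglongrightarrow> 0"
      "(\<lambda>n. \<integral>x. (norm (grad (\<phi> n) x - ?G x))\<^sup>2 \<partial>?L) \<longlonglongrightarrow> 0"
      "(\<lambda>n. \<integral>x. (\<phi> n x - g x)\<^sup>2 \<partial>sphere_measure) \<longlonglongrightarrow> 0"
    using g unfolding has_trace_def by blast
  let ?\<phi> = "\<lambda>n x. c * \<phi> n x + w x"
  have sm: "smooth (?\<phi> n)" for n by (intro smooth_add smooth_mult smooth_const \<phi> w)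
  have gr: "grad (?\<phi> n) x = c *\<^sub>R grad (\<phi> n) x + grad w x" for n x
    by (simp add: grad_add[OF smooth_mult[OF smooth_const \<phi>(2)] w] grad_mult[OF smooth_const \<phi>(2)])
  have e1: "(LINT x|?L. (?\<phi> n x - ?w x)\<^sup>2) = c\<^sup>2 * (LINT x|?L. (\<phi> n x - u x)\<^sup>2)" for n
  proof -
    have "(LINT x|?L. (?\<phi> n x - ?w x)\<^sup>2) = (LINT x|?L. c\<^sup>2 * (\<phi> n x - u x)\<^sup>2)"
      by (simp add: power_mult_distrib[symmetric] right_diff_distrib)
    then show ?thesis by simp
  qed
  have e2: "(LINT x|?L. (norm (grad (?\<phi> n) x - wgrad (ball 0 1) ?w x))\<^sup>2) = c\<^sup>2 * (LINT x|?L. (norm (grad (\<phi> n) x - ?G x))\<^sup>2)" for n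
  proof -
    have m: "grad (?\<phi> n) \<in> borel_measurable ?L" "wgrad (ball 0 1) ?w \<in> borel_measurable ?L"
      "grad (\<phi> n) \<in> borel_measurable ?L" "?G \<in> borel_measurable ?L"
      using grad_L2_ball[OF sm] H1_wgrad(3)[OF *] grad_L2_ball[OF \<phi>(2)] GL by (auto simp: L2_def)
    have "(LINT x|?L. (norm (grad (?\<phi> n) x - wgrad (ball 0 1) ?w x))\<^sup>2) = (LINT x|?L. c\<^sup>2 * (norm (grad (\<phi> n) x - ?G x))\<^sup>2)"
    proof (rule integral_cong_AE)
      show "AE x in ?L. (norm (grad (?\<phi> n) x - wgrad (ball 0 1) ?w x))\<^sup>2 = c\<^sup>2 * (norm (grad (\<phi> n) x - ?G x))\<^sup>2"
        using ae
      proof eventually_elim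
        case (elim x)
        have "norm (c *\<^sub>R grad (\<phi> n) x + grad w x - (c *\<^sub>R ?G x + grad w x)) = norm (c *\<^sub>R (grad (\<phi> n) x - ?G x))"
          by (simp add: scaleR_diff_right)
        then show ?case unfolding elim gr by (simp add: power_mult_distrib del: scaleR_diff_right)
      qed
    qed (use m in auto)
    then show ?thesis by simp
  qed
  have e3: "(LINT x|sphere_measure. (?\<phi> n x - (c * g x + w x))\<^sup>2) = c\<^sup>2 * (LINT x|sphere_measure. (\<phi> n x - g x)\<^sup>2)" for n
  proof -
    have "(LINT x|sphere_measure. (?\<phi> n x - (c * g x + w x))\<^sup>2) = (LINT x|sphere_measure. c\<^sup>2 * (\<phi> n x - g x)\<^sup>2)"
      by (simp add: power_mult_distrib[symmetric] right_diff_distrib)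
    then show ?thesis by simp
  qed
  show "has_trace (ball 0 1) sphere_measure ?w (\<lambda>x. c * g x + w x)"
    unfolding has_trace_def
  proof (intro conjI exI[of _ ?\<phi>] allI)
    show "L2 sphere_measure (\<lambda>x. c * g x + w x)"
      by (intro L2_add L2_cmult \<phi> smooth_L2_sphere w)
  qed (auto simp only: e1 e2 e3 sm intro!: tendsto_mult_right_zero \<phi>)
qed

section \<open>The boundary term for nearly constant traces\<close>

text \<open>Subtracting \<open>c\<close> times the measure of the set where \<open>\<bar>g\<bar> \<ge> c\<close>, the equation of the threshold
  says that the integral of the positive part of \<open>\<bar>g\<bar> - c\<close> is \<open>c k\<close>, where \<open>k\<close> is \<open>m / lmin\<close> in the definition. The
  integral does not increase with \<open>c\<close>, and \<open>c k\<close> increases strictly.\<close>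

lemma threshold_unique:
  fixes g :: "'a \<Rightarrow> real"
  assumes "finite_measure M" and g: "integrable M g" and k: "k > 0"
    and c: "c > 0" "c = inverse (measure M {x \<in> space M. \<bar>g x\<bar> \<ge> c} + k) * (\<integral>x\<in>{x \<in> space M. \<bar>g x\<bar> \<ge> c}. \<bar>g x\<bar> \<partial>M)"
    and c': "c' > 0" "c' = inverse (measure M {x \<in> space M. \<bar>g x\<bar> \<ge> c'} + k) * (\<integral>x\<in>{x \<in> space M. \<bar>g x\<bar> \<ge> c'}. \<bar>g x\<bar> \<partial>M)"
  shows "c = c'"
proof -
  interpret finite_measure M by fact
  have gm [measurable]: "g \<in> borel_measurable M" using g by auto
  define \<Psi> where "\<Psi> t = (LINT x|M. max 0 (\<bar>g x\<bar> - t))" for t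
  have int: "integrable M (\<lambda>x. max 0 (\<bar>g x\<bar> - t))" for t
    using g by (intro integrable_max) auto
  have eq: "\<Psi> t = t * k"
    if t: "t > 0" "t = inverse (measure M {x \<in> space M. \<bar>g x\<bar> \<ge> t} + k) * (\<integral>x\<in>{x \<in> space M. \<bar>g x\<bar> \<ge> t}. \<bar>g x\<bar> \<partial>M)" for t
  proof -
    let ?S = "{x \<in> space M. \<bar>g x\<bar> \<ge> t}"
    have S [measurable]: "?S \<in> sets M" by measurable
    have i: "integrable M (\<lambda>x. indicator ?S x * \<bar>g x\<bar>)"
      using integrable_mult_indicator[OF S integrable_abs[OF g]] by simp
    have j: "integrable M (\<lambda>x. t * indicator ?S x :: real)"
      by (intro integrable_mult_right integrable_real_indicator S) (simp add: less_top[symmetric])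
    have "\<Psi> t = (LINT x|M. indicator ?S x * \<bar>g x\<bar> - t * indicator ?S x)"
      unfolding \<Psi>_def by (intro Bochner_Integration.integral_cong) (auto simp: indicator_def)
    also have "\<dots> = (LINT x|M. indicator ?S x * \<bar>g x\<bar>) - t * measure M ?S"
      using i j S by (simp add: Int_absorb1 sets.sets_into_space)
    also have "(LINT x|M. indicator ?S x * \<bar>g x\<bar>) = t * (measure M ?S + k)"
    proof -
      have "measure M ?S + k > 0" using k by (simp add: add_nonneg_pos)
      then show ?thesis
        using t(2) by (simp add: set_lebesgue_integral_def field_simps)
    qed
    finally show ?thesis by (simp add: algebra_simps)
  qed
  have mono: "\<Psi> s \<ge> \<Psi> t" if "s \<le> t" for s t
    unfolding \<Psi>_def using that by (intro integral_mono int) auto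
  show ?thesis
  proof (rule linorder_cases[of c c'])
    assume "c < c'"
    then show ?thesis using mono[of c c'] eq[OF c] eq[OF c'] k by simp
  next
    assume "c' < c"
    then show ?thesis using mono[of c' c] eq[OF c] eq[OF c'] k by simp
  qed
qed

text \<open>If the whole boundary lies above the threshold, the optimal distribution is affine in \<open>\<bar>g\<bar>\<close>
  everywhere, and the boundary term depends only on the mean of \<open>\<bar>g\<bar>\<close>.\<close>

lemma boundary_term_above_threshold:
  fixes g :: "'a::euclidean_space \<Rightarrow> real"
  defines "A \<equiv> measure (sphere_measure :: 'a measure) (sphere 0 1)"
  defines "J \<equiv> (LINT x|sphere_measure. \<bar>g x\<bar>)"
  assumes g: "L2 sphere_measure g" and J: "J > 0" and m: "m > 0" and l: "lmin \<ge> 0"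
    and flat: "AE x in sphere_measure. lmin * J \<le> (lmin * A + m) * \<bar>g x\<bar>"
  shows "boundary_term sphere_measure lmin m g = J\<^sup>2 / (lmin * A + m)"
proof -
  let ?\<sigma> = "sphere_measure :: 'a measure"
  have gi: "integrable ?\<sigma> g" by (rule L2_sphere_integrable[OF g])
  have gm [measurable]: "g \<in> borel_measurable ?\<sigma>" using gi by auto
  show ?thesis
  proof (cases "lmin = 0")
    case True
    have "boundary_term ?\<sigma> lmin m g = (LINT x|?\<sigma>. (J / m) * \<bar>g x\<bar>)"
      unfolding boundary_term_def optimal_distribution_def True J_def[symmetric]
      using J m by (intro Bochner_Integration.integral_cong) (auto simp: field_simps power2_eq_square abs_if)
    also have "\<dots> = (J / m) * J" by (simp add: J_def)
    finally show ?thesis using True by (simp add: power2_eq_square)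
  next
    case False
    with l have l0: "lmin > 0" by simp
    define M where "M = lmin * A + m"
    have A0: "A \<ge> 0" by (simp add: A_def)
    have M: "M > 0" unfolding M_def using l0 A0 m by (simp add: add_nonneg_pos)
    define c where "c = lmin * J / M"
    have c0: "c > 0" using l0 J M by (simp add: c_def)
    have ae: "AE x in ?\<sigma>. c \<le> \<bar>g x\<bar>"
      using flat unfolding c_def M_def[symmetric] using M by (auto simp: field_simps)
    let ?S = "{x \<in> space ?\<sigma>. \<bar>g x\<bar> \<ge> c}"
    have S [measurable]: "?S \<in> sets ?\<sigma>" by measurable
    have "measure ?\<sigma> ?S = A"
      unfolding A_def space_sphere_measure[symmetric]
      by (rule measure_eq_AE) (use ae in \<open>auto\<close>)
    moreover have "(\<integral>x\<in>?S. \<bar>g x\<bar> \<partial>?\<sigma>) = J"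
      unfolding set_lebesgue_integral_def J_def
      by (rule integral_cong_AE) (use ae AE_space[of ?\<sigma>] in \<open>auto simp: indicator_def elim: eventually_elim2\<close>)
    moreover have "c = inverse (A + m / lmin) * J"
      using l0 M by (simp add: c_def M_def field_simps)
    ultimately have c: "c = inverse (measure ?\<sigma> ?S + m / lmin) * (\<integral>x\<in>?S. \<bar>g x\<bar> \<partial>?\<sigma>)"
      by simp
    have thr: "threshold ?\<sigma> lmin m g = c"
      unfolding threshold_def
    proof (rule the_equality)
      show "c > 0 \<and> c = inverse (measure ?\<sigma> ?S + m / lmin) * (\<integral>x\<in>?S. \<bar>g x\<bar> \<partial>?\<sigma>)"
        using c0 c by (rule conjI)
      fix t assume "t > 0 \<and> t = inverse (measure ?\<sigma> {x \<in> space ?\<sigma>. \<bar>g x\<bar> \<ge> t} + m / lmin) * (\<integral>x\<in>{x \<in> space ?\<sigma>. \<bar>g x\<bar> \<ge> t}. \<bar>g x\<bar> \<partial>?\<sigma>)"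
      then show "t = c"
        using threshold_unique[OF finite_measure_sphere gi _ _ _ c0 c, of t] m l0 by simp
    qed
    have "boundary_term ?\<sigma> lmin m g = (LINT x|?\<sigma>. (c / lmin) * \<bar>g x\<bar>)"
      unfolding boundary_term_def
    proof (rule integral_cong_AE)
      show "AE x in ?\<sigma>. (g x)\<^sup>2 / (lmin + optimal_distribution ?\<sigma> lmin m g x) = (c / lmin) * \<bar>g x\<bar>"
        using ae
      proof eventually_elim
        case (elim x)
        then have den: "lmin + optimal_distribution ?\<sigma> lmin m g x = lmin / c * \<bar>g x\<bar>"
          using False by (simp add: optimal_distribution_def thr)
        have sq: "(g x)\<^sup>2 = \<bar>g x\<bar> * \<bar>g x\<bar>" by (simp add: power2_eq_square)
        have "y * y / (lmin / c * y) = c / lmin * y" if "y > 0" for y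
          using that l0 c0 by (simp add: field_simps)
        from this[of "\<bar>g x\<bar>"] elim c0 show ?case
          unfolding den sq by linarith
      qed
      show "(\<lambda>x. (g x)\<^sup>2 / (lmin + optimal_distribution ?\<sigma> lmin m g x)) \<in> borel_measurable ?\<sigma>"
        unfolding optimal_distribution_def using False by (simp add: Let_def)
    qed simp
    also have "\<dots> = (c / lmin) * J" by (simp add: J_def)
    also have "\<dots> = J\<^sup>2 / M" using l0 by (simp add: c_def power2_eq_square)
    finally show ?thesis by (simp add: M_def)
  qed
qed

text \<open>Let \<open>M = lmin A + m\<close> and \<open>\<delta> = m / (2 M)\<close>. Then \<open>\<bar>g\<bar> \<ge> (1 - \<delta>) \<bar>a\<bar>\<close>, while the threshold is
  at most \<open>lmin A (1 + \<delta>) \<bar>a\<bar> / M\<close>, and \<open>\<delta>\<close> is so small that the first bound is not below the second. As the sign of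
  the trace is constant, the mean of \<open>\<bar>g\<bar>\<close> is up to sign the mean of \<open>g\<close>; this makes the boundary term a
  quadratic form.\<close>

lemma boundary_term_nearly_constant:
  fixes g \<phi> :: "'a::euclidean_space \<Rightarrow> real"
  defines "A \<equiv> measure (sphere_measure :: 'a measure) (sphere 0 1)"
  assumes g: "L2 sphere_measure g" and ae: "AE x in sphere_measure. g x = \<phi> x" and \<phi>: "continuous_on UNIV \<phi>"
    and m: "m > 0" and l: "lmin \<ge> 0" and a: "a \<noteq> 0"
    and near: "\<And>x. x \<in> sphere 0 1 \<Longrightarrow> \<bar>\<phi> x - a\<bar> \<le> m / (2 * (lmin * A + m)) * \<bar>a\<bar>"
  shows "boundary_term sphere_measure lmin m g = (LINT x|sphere_measure. \<phi> x)\<^sup>2 / (lmin * A + m)"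
proof -
  let ?\<sigma> = "sphere_measure :: 'a measure"
  define M where "M = lmin * A + m"
  define \<delta> where "\<delta> = m / (2 * M)"
  have A: "A > 0" unfolding A_def by (rule measure_sphere_pos)
  have M: "M > 0" "m \<le> M" unfolding M_def using l A m by (auto simp: add_nonneg_pos)
  have \<delta>: "0 \<le> \<delta>" "\<delta> \<le> 1 / 2" "2 * M * \<delta> = m"
    using m M by (auto simp: \<delta>_def field_simps)
  have near': "\<bar>\<phi> x - a\<bar> \<le> \<delta> * \<bar>a\<bar>" if "x \<in> sphere 0 1" for x
    using near[OF that] by (simp add: \<delta>_def M_def)
  have half: "\<delta> * \<bar>a\<bar> \<le> \<bar>a\<bar> / 2" using mult_right_mono[OF \<delta>(2), of "\<bar>a\<bar>"] by simp
  have sgn: "\<bar>\<phi> x\<bar> = sgn a * \<phi> x" if "x \<in> sphere 0 1" for x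
  proof -
    have "\<bar>\<phi> x - a\<bar> \<le> \<bar>a\<bar> / 2" using near'[OF that] half by (rule order_trans)
    then have "(a > 0 \<longrightarrow> \<phi> x \<ge> 0) \<and> (a < 0 \<longrightarrow> \<phi> x \<le> 0)" by linarith
    then show ?thesis using a by (cases "a > 0") (auto simp: sgn_if)
  qed
  have lower: "(1 - \<delta>) * \<bar>a\<bar> \<le> \<bar>\<phi> x\<bar>" and upper: "\<bar>\<phi> x\<bar> \<le> (1 + \<delta>) * \<bar>a\<bar>" if "x \<in> sphere 0 1" for x
    using near'[OF that] unfolding left_diff_distrib distrib_right by linarith+
  have \<phi>i: "integrable ?\<sigma> \<phi>" "integrable ?\<sigma> (\<lambda>x. \<bar>\<phi> x\<bar>)"
    using \<phi> by (auto intro: continuous_sphere_integrable)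
  have ci: "integrable ?\<sigma> (\<lambda>_. c)" for c :: real
    by (intro continuous_sphere_integrable continuous_intros)
  have gm: "g \<in> borel_measurable ?\<sigma>" "\<phi> \<in> borel_measurable ?\<sigma>"
    using g \<phi>i by (auto simp: L2_def)
  define J where "J = (LINT x|?\<sigma>. \<bar>g x\<bar>)"
  have J: "J = (LINT x|?\<sigma>. \<bar>\<phi> x\<bar>)"
    unfolding J_def by (rule integral_cong_AE) (use gm ae in \<open>auto elim!: eventually_mono\<close>)
  have "J = (LINT x|?\<sigma>. sgn a * \<phi> x)"
    unfolding J by (intro Bochner_Integration.integral_cong) (auto simp: space_sphere_measure sgn)
  then have Jsq: "J\<^sup>2 = (LINT x|?\<sigma>. \<phi> x)\<^sup>2"
    using a by (simp add: power_mult_distrib sgn_if)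
  have "(LINT x|?\<sigma>. (1 - \<delta>) * \<bar>a\<bar>) \<le> J"
    unfolding J by (intro integral_mono ci \<phi>i) (auto simp: space_sphere_measure lower)
  then have Jlow: "A * ((1 - \<delta>) * \<bar>a\<bar>) \<le> J"
    unfolding integral_sphere_const A_def .
  have "J \<le> (LINT x|?\<sigma>. (1 + \<delta>) * \<bar>a\<bar>)"
    unfolding J by (intro integral_mono ci \<phi>i) (auto simp: space_sphere_measure upper)
  then have Jup: "J \<le> A * ((1 + \<delta>) * \<bar>a\<bar>)"
    unfolding integral_sphere_const A_def .
  have "0 < A * ((1 - \<delta>) * \<bar>a\<bar>)" using A \<delta> a by (intro mult_pos_pos) auto
  then have Jpos: "J > 0" using Jlow by linarith
  have "lmin * J \<le> M * \<bar>\<phi> x\<bar>" if x: "x \<in> sphere 0 1" for x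
  proof -
    have "lmin * J \<le> lmin * (A * ((1 + \<delta>) * \<bar>a\<bar>))"
      using Jup l by (rule mult_left_mono)
    also have "\<dots> = ((lmin * A) * (1 + \<delta>)) * \<bar>a\<bar>" by simp
    also have "\<dots> \<le> (M * (1 - \<delta>)) * \<bar>a\<bar>"
    proof (rule mult_right_mono)
      have "(lmin * A) * (1 + \<delta>) = M - m + M * \<delta> - m * \<delta>" by (simp add: M_def algebra_simps)
      also have "\<dots> \<le> M - 2 * M * \<delta> + M * \<delta>" using \<delta> m by simp
      finally show "(lmin * A) * (1 + \<delta>) \<le> M * (1 - \<delta>)" by (simp add: algebra_simps)
    qed simp
    also have "\<dots> \<le> M * \<bar>\<phi> x\<bar>"
      using mult_left_mono[OF lower[OF x], of M] M by (simp add: mult.assoc)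
    finally show ?thesis .
  qed
  then have "AE x in ?\<sigma>. lmin * J \<le> M * \<bar>\<phi> x\<bar>"
    by (intro AE_I2) (simp add: space_sphere_measure)
  with ae have "AE x in ?\<sigma>. lmin * J \<le> M * \<bar>g x\<bar>"
    by eventually_elim simp
  then show ?thesis
    using boundary_term_above_threshold[OF g _ m l] Jpos Jsq by (simp add: J_def M_def A_def)
qed

section \<open>Radial minimizers\<close>

lemma grad_inner_power:
  "grad (\<lambda>x::'a::euclidean_space. (x \<bullet> x) ^ k) x = (2 * real k * (x \<bullet> x) ^ (k - 1)) *\<^sub>R x"
proof (rule grad_eqI)
  have "((\<lambda>x::'a. (x \<bullet> x) ^ k) has_derivative (\<lambda>h. (real k * (x \<bullet> x) ^ (k - 1)) * (2 * (x \<bullet> h)))) (at x)"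
    by (auto intro!: derivative_eq_intros simp: inner_commute)
  then show "((\<lambda>x::'a. (x \<bullet> x) ^ k) has_derivative (\<lambda>h. ((2 * real k * (x \<bullet> x) ^ (k - 1)) *\<^sub>R x) \<bullet> h)) (at x)"
    by (simp add: mult_ac)
qed

text \<open>The divergence theorem for the field \<open>(u x * (x \<bullet> x) ^ k) *\<^sub>R x\<close>, applied to smooth approximations of \<open>u\<close>: the surface
  integrals tend to zero with the traces.\<close>

lemma H1_zero_trace_moments:
  fixes u :: "'a::euclidean_space \<Rightarrow> real"
  assumes u: "u \<in> H1 (ball 0 1)" and tr: "has_trace (ball 0 1) sphere_measure u (\<lambda>_. 0)"
  shows "(real DIM('a) + 2 * real k) * (LINT x|ballM. u x * (x \<bullet> x) ^ k)
      + (LINT x|ballM. wgrad (ball 0 1) u x \<bullet> ((x \<bullet> x) ^ k *\<^sub>R x)) = 0"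
proof -
  let ?L = "ballM :: 'a measure" and ?G = "wgrad (ball 0 1) u" and ?q = "\<lambda>x::'a. (x \<bullet> x) ^ k"
  let ?\<sigma> = "sphere_measure :: 'a measure"
  obtain \<phi> where \<phi>: "\<And>n. smooth (\<phi> n)"
      "(\<lambda>n. \<integral>x. (\<phi> n x - u x)\<^sup>2 \<partial>?L) \<longlonglongrightarrow> 0"
      "(\<lambda>n. \<integral>x. (norm (grad (\<phi> n) x - ?G x))\<^sup>2 \<partial>?L) \<longlonglongrightarrow> 0"
      "(\<lambda>n. \<integral>x. (\<phi> n x - 0)\<^sup>2 \<partial>?\<sigma>) \<longlonglongrightarrow> 0"
    using tr unfolding has_trace_def by blast
  note uL = H1_wgrad(1)[OF u] and GL = H1_wgrad(3)[OF u]
  have q: "smooth ?q" by (intro smooth_power smooth_norm_square)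
  have qL: "L2 ?L ?q" by (rule smooth_L2_ball[OF q])
  have qxL: "L2 ?L (\<lambda>x. ?q x *\<^sub>R x)"
    by (intro continuous_L2_ball continuous_intros)
  have gq: "grad ?q x \<bullet> x = 2 * real k * ?q x" for x
    unfolding grad_inner_power by (cases k) simp_all
  have eq: "(LINT x|?\<sigma>. \<phi> n x * 1) = (real DIM('a) + 2 * real k) * (LINT x|?L. \<phi> n x * ?q x) + (LINT x|?L. grad (\<phi> n) x \<bullet> (?q x *\<^sub>R x))" for n
  proof -
    have i: "integrable ?L (\<lambda>x. \<phi> n x * ?q x)" "integrable ?L (\<lambda>x. grad (\<phi> n) x \<bullet> (?q x *\<^sub>R x))"
      by (intro L2_mult_integrable L2_inner_integrable smooth_L2_ball grad_L2_ball \<phi> qL qxL)+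
    have "(LINT x|?\<sigma>. \<phi> n x * 1) = (LINT x|?\<sigma>. \<phi> n x * ?q x)"
      by (intro Bochner_Integration.integral_cong) (auto simp: space_sphere_measure dot_square_norm)
    also have "\<dots> = (LINT x|?L. DIM('a) * (\<phi> n x * ?q x) + grad (\<lambda>x. \<phi> n x * ?q x) x \<bullet> x)"
      by (rule radial_divergence[OF smooth_mult[OF \<phi>(1) q]])
    also have "\<dots> = (LINT x|?L. (real DIM('a) + 2 * real k) * (\<phi> n x * ?q x) + grad (\<phi> n) x \<bullet> (?q x *\<^sub>R x))"
      by (intro Bochner_Integration.integral_cong)
        (simp_all add: grad_mult[OF \<phi>(1) q] inner_add_left gq algebra_simps)
    finally show ?thesis using i by simp
  qed
  have one: "L2 ?\<sigma> (\<lambda>_. 1 :: real)" and zero: "L2 ?\<sigma> (\<lambda>_. 0 :: real)" by (rule L2_sphere_const)+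
  have 1: "(\<lambda>n. \<integral>x. \<phi> n x * 1 \<partial>?\<sigma>) \<longlonglongrightarrow> (LINT x|?\<sigma>. 0 * 1)"
    by (rule L2_tendsto_mult[OF smooth_L2_sphere[OF \<phi>(1)] zero one one \<phi>(4)]) simp
  have 2: "(\<lambda>n. \<integral>x. \<phi> n x * ?q x \<partial>?L) \<longlonglongrightarrow> (LINT x|?L. u x * ?q x)"
    by (rule L2_tendsto_mult[OF smooth_L2_ball[OF \<phi>(1)] uL qL qL \<phi>(2)]) simp
  have 3: "(\<lambda>n. \<integral>x. grad (\<phi> n) x \<bullet> (?q x *\<^sub>R x) \<partial>?L) \<longlonglongrightarrow> (LINT x|?L. ?G x \<bullet> (?q x *\<^sub>R x))"
    by (rule L2_tendsto_inner[OF grad_L2_ball[OF \<phi>(1)] GL qxL qxL \<phi>(3)]) simp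
  have "(\<lambda>n. \<integral>x. \<phi> n x * 1 \<partial>?\<sigma>) \<longlonglongrightarrow> (real DIM('a) + 2 * real k) * (LINT x|?L. u x * ?q x) + (LINT x|?L. ?G x \<bullet> (?q x *\<^sub>R x))"
    unfolding eq by (intro tendsto_intros 2 3)
  then show ?thesis
    using LIMSEQ_unique[OF 1] by simp
qed

text \<open>A radial function with vanishing moments is orthogonal to its own mollifications, which are
  radial and continuous, hence uniform limits of polynomials in \<open>x \<bullet> x\<close>.\<close>

lemma radial_zero_moments_imp_zero:
  fixes u :: "'a::euclidean_space \<Rightarrow> real"
  assumes u: "L2 ballM u" and rad: "radially_symmetric (ball 0 1) u"
    and mom: "\<And>k. (LINT x|ballM. u x * (x \<bullet> x) ^ k) = 0"
  shows "(LINT x|ballM. (u x)\<^sup>2) = 0"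
proof -
  let ?L = "ballM :: 'a measure"
  have ui: "integrable ?L u" by (rule L2_ball_integrable[OF u])
  obtain b :: 'a where "b \<in> Basis" using nonempty_Basis by blast
  then have b: "norm b = 1" by (rule norm_Basis)
  have zero: "(LINT x|?L. mollify n u x * u x) = 0" for n
  proof -
    define K where "K = (LINT x|?L. \<bar>u x\<bar>)"
    have sm: "smooth (mollify n u)" by (rule smooth_mollify[OF ui])
    have iM: "integrable ?L (\<lambda>x. mollify n u x * u x)"
      by (intro L2_mult_integrable smooth_L2_ball sm u)
    define f where "f s = mollify n u (sqrt s *\<^sub>R b)" for s
    have "continuous_on {0..1} f"
      unfolding f_def[abs_def]
      by (rule continuous_on_compose2[OF smooth_continuous_on[OF sm, of UNIV]]) (auto intro!: continuous_intros)
    then have approx: "\<exists>p. real_polynomial_function p \<and> (\<forall>s\<in>{0..1}. \<bar>f s - p s\<bar> < e)" if "e > 0" for e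
      using Stone_Weierstrass_real_polynomial_function[OF compact_Icc _ that, of 0 1 f] by metis
    have "\<bar>\<integral>x. mollify n u x * u x \<partial>?L\<bar> \<le> e * K" if e: "e > 0" for e
    proof -
      obtain p where p: "real_polynomial_function p" "\<forall>s\<in>{0..1}. \<bar>f s - p s\<bar> < e"
        using approx[OF e] by blast
      obtain c N where c: "p = (\<lambda>s. \<Sum>i\<le>N. c i * s ^ i)"
        using p(1) unfolding real_polynomial_function_iff_sum by blast
      have ik: "integrable ?L (\<lambda>x. u x * (x \<bullet> x) ^ i)" for i
        by (intro L2_mult_integrable u smooth_L2_ball smooth_power smooth_norm_square)
      have pe: "p (x \<bullet> x) * u x = (\<Sum>i\<le>N. c i * (u x * (x \<bullet> x) ^ i))" for x
        unfolding c sum_distrib_right by (simp only: mult_ac)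
      have ip: "integrable ?L (\<lambda>x. p (x \<bullet> x) * u x)"
        unfolding pe by (intro Bochner_Integration.integrable_sum integrable_mult_right ik)
      have "(LINT x|?L. p (x \<bullet> x) * u x) = (\<Sum>i\<le>N. c i * (LINT x|?L. u x * (x \<bullet> x) ^ i))"
        unfolding pe using ik by (simp add: Bochner_Integration.integral_sum)
      then have p0: "(LINT x|?L. p (x \<bullet> x) * u x) = 0" by (simp add: mom)
      have "(LINT x|?L. mollify n u x * u x) = (LINT x|?L. mollify n u x * u x - p (x \<bullet> x) * u x)"
        using iM ip p0 by simp
      also have "\<bar>\<dots>\<bar> \<le> (LINT x|?L. e * \<bar>u x\<bar>)"
      proof (rule integral_abs_bound_integral)
        show "integrable ?L (\<lambda>x. mollify n u x * u x - p (x \<bullet> x) * u x)" using iM ip by simp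
        show "integrable ?L (\<lambda>x. e * \<bar>u x\<bar>)" using ui by simp
        fix x assume "x \<in> space ?L"
        then have x: "x \<bullet> x \<in> {0..1}"
          using inner_self_ge_1_iff[of x] by auto
        have "mollify n u x = f (x \<bullet> x)"
          unfolding f_def by (rule mollify_radial[OF u rad]) (simp add: b norm_eq_sqrt_inner[symmetric])
        with bspec[OF p(2) x] have "\<bar>mollify n u x - p (x \<bullet> x)\<bar> \<le> e" by linarith
        then show "\<bar>mollify n u x * u x - p (x \<bullet> x) * u x\<bar> \<le> e * \<bar>u x\<bar>"
          unfolding left_diff_distrib[symmetric] abs_mult by (rule mult_right_mono) simp
      qed
      finally show ?thesis by (simp add: K_def)
    qed
    note bound = this
    have K0: "K \<ge> 0" by (simp add: K_def)
    show ?thesis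
    proof (rule ccontr)
      assume "(LINT x|?L. mollify n u x * u x) \<noteq> 0"
      then have pos: "0 < \<bar>\<integral>x. mollify n u x * u x \<partial>?L\<bar>" by simp
      define t where "t = \<bar>\<integral>x. mollify n u x * u x \<partial>?L\<bar>"
      have "t \<le> t / (2 * (K + 1)) * K"
        unfolding t_def by (rule bound) (use pos K0 in simp)
      also have "\<dots> \<le> t / (2 * (K + 1)) * (K + 1)"
        using pos K0 unfolding t_def by (intro mult_left_mono) auto
      also have "\<dots> = t / 2" using K0 by (simp add: field_simps)
      finally show False using pos unfolding t_def by simp
    qed
  qed
  have "(\<lambda>n. \<integral>x. mollify n u x * u x \<partial>?L) \<longlonglongrightarrow> (LINT x|?L. u x * u x)"
    by (rule L2_tendsto_mult[OF smooth_L2_ball[OF smooth_mollify[OF ui]] u u u mollify_L2_tendsto[OF u]]) simp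
  then show ?thesis
    by (simp add: zero LIMSEQ_const_iff power2_eq_square)
qed

lemma square_integral_pos:
  assumes "L2 (lebesgue_on \<Omega>) u" "nonzero \<Omega> u"
  shows "0 < (LINT x|(lebesgue_on \<Omega>). (u x)\<^sup>2)"
proof -
  have "(LINT x|(lebesgue_on \<Omega>). (u x)\<^sup>2) \<noteq> 0"
    using assms integral_nonneg_eq_0_iff_AE[of "lebesgue_on \<Omega>" "\<lambda>x. (u x)\<^sup>2"]
    by (auto simp: L2_iff_real nonzero_def)
  moreover have "0 \<le> (LINT x|(lebesgue_on \<Omega>). (u x)\<^sup>2)" by simp
  ultimately show ?thesis by linarith
qed

lemma dirichlet_energy_add_scaled:
  fixes u w :: "'a::euclidean_space \<Rightarrow> real"
  assumes u: "u \<in> H1 (ball 0 1)" and g: "has_trace (ball 0 1) sphere_measure u g" and w: "smooth w"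
  shows "(LINT x|ballM. (norm (wgrad (ball 0 1) (\<lambda>x. c * u x + w x) x))\<^sup>2)
    = c\<^sup>2 * (LINT x|ballM. (norm (wgrad (ball 0 1) u x))\<^sup>2)
      + 2 * c * (LINT x|ballM. wgrad (ball 0 1) u x \<bullet> grad w x)
      + (LINT x|ballM. (norm (grad w x))\<^sup>2)"
proof -
  let ?L = "ballM :: 'a measure" and ?G = "wgrad (ball 0 1) u"
  let ?w = "\<lambda>x. c * u x + w x"
  note h = has_trace_add_scaled[OF u g w, of c]
  note GL = H1_wgrad(3)[OF u] and gL = grad_L2_ball[OF w]
  have i: "integrable ?L (\<lambda>x. (norm (?G x))\<^sup>2)" "integrable ?L (\<lambda>x. ?G x \<bullet> grad w x)" "integrable ?L (\<lambda>x. (norm (grad w x))\<^sup>2)"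
    using GL gL L2_inner_integrable[OF GL gL] by (auto simp: L2_def)
  have m: "wgrad (ball 0 1) ?w \<in> borel_measurable ?L" "?G \<in> borel_measurable ?L" "grad w \<in> borel_measurable ?L"
    using H1_wgrad(3)[OF h(1)] GL gL by (auto simp: L2_def)
  have "(LINT x|?L. (norm (wgrad (ball 0 1) ?w x))\<^sup>2)
      = (LINT x|?L. c\<^sup>2 * (norm (?G x))\<^sup>2 + 2 * c * (?G x \<bullet> grad w x) + (norm (grad w x))\<^sup>2)"
  proof (rule integral_cong_AE)
    show "AE x in ?L. (norm (wgrad (ball 0 1) ?w x))\<^sup>2
        = c\<^sup>2 * (norm (?G x))\<^sup>2 + 2 * c * (?G x \<bullet> grad w x) + (norm (grad w x))\<^sup>2"
      using h(2) by eventually_elim (simp add: norm_add_square power_mult_distrib)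
  qed (use m in auto)
  then show ?thesis using i by simp
qed

lemma square_integral_add_scaled:
  fixes u w :: "'a::euclidean_space \<Rightarrow> real"
  assumes u: "L2 M u" and w: "L2 M w"
  shows "(LINT x|M. (c * u x + w x)\<^sup>2) = c\<^sup>2 * (LINT x|M. (u x)\<^sup>2) + 2 * c * (LINT x|M. u x * w x) + (LINT x|M. (w x)\<^sup>2)"
proof -
  have i: "integrable M (\<lambda>x. (u x)\<^sup>2)" "integrable M (\<lambda>x. u x * w x)" "integrable M (\<lambda>x. (w x)\<^sup>2)"
    using u w L2_mult_integrable[OF u w] by (auto simp: L2_iff_real)
  have "(LINT x|M. (c * u x + w x)\<^sup>2) = (LINT x|M. c\<^sup>2 * (u x)\<^sup>2 + 2 * c * (u x * w x) + (w x)\<^sup>2)"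
    by (intro Bochner_Integration.integral_cong) (auto simp: power2_eq_square algebra_simps)
  then show ?thesis using i by simp
qed

text \<open>The multiple of \<open>u\<close> with norm one is admissible in the infimum.\<close>

lemma lambda_m_le:
  fixes u :: "'a::euclidean_space \<Rightarrow> real"
  assumes u: "u \<in> H1 (ball 0 1)" "nonzero (ball 0 1) u" and m: "m > 0"
    and tr: "has_trace (ball 0 1) sphere_measure u (\<lambda>_. a)"
  shows "lambda_m (ball 0 1) (sphere_measure :: 'a measure) m * (LINT x|ballM. (u x)\<^sup>2)
      \<le> (LINT x|ballM. (norm (wgrad (ball 0 1) u x))\<^sup>2)
        + (measure (sphere_measure :: 'a measure) (sphere 0 1) * a)\<^sup>2 / m"
    and "0 \<le> lambda_m (ball 0 1) (sphere_measure :: 'a measure) m"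
proof -
  let ?L = "ballM :: 'a measure" and ?\<sigma> = "sphere_measure :: 'a measure"
  let ?A = "measure ?\<sigma> (sphere 0 1)"
  define X where "X = {(LINT x|?L. (norm (wgrad (ball 0 1) u x))\<^sup>2)
       + 1 / m * (LINT x|?\<sigma>. \<bar>boundary_trace (ball 0 1) ?\<sigma> u x\<bar>)\<^sup>2 | u.
     u \<in> H1 (ball 0 1) \<and> sqrt (LINT x|?L. (u x)\<^sup>2) = 1}"
  have lam: "lambda_m (ball 0 1) ?\<sigma> m = Inf X" by (simp add: lambda_m_def X_def)
  have nonneg: "0 \<le> y" if "y \<in> X" for y using that m by (auto simp: X_def)
  have bdd: "bdd_below X" using nonneg by (rule bdd_belowI)
  define N where "N = (LINT x|?L. (u x)\<^sup>2)"
  have N: "N > 0" unfolding N_def by (rule square_integral_pos[OF H1_wgrad(1)[OF u(1)] u(2)])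
  define c where "c = 1 / sqrt N"
  have c: "c > 0" "c\<^sup>2 = 1 / N" using N by (auto simp: c_def power_divide)
  let ?v = "\<lambda>x. c * u x + 0"
  note h = has_trace_add_scaled[OF u(1) tr smooth_const[of 0], of c]
  have "(LINT x|?L. (?v x)\<^sup>2) = c\<^sup>2 * N" by (simp add: power_mult_distrib N_def)
  then have norm1: "sqrt (LINT x|?L. (?v x)\<^sup>2) = 1" using c N by simp
  have D: "(LINT x|?L. (norm (wgrad (ball 0 1) ?v x))\<^sup>2) = c\<^sup>2 * (LINT x|?L. (norm (wgrad (ball 0 1) u x))\<^sup>2)"
    using dirichlet_energy_add_scaled[OF u(1) tr smooth_const[of 0], of c] by simp
  note bt = boundary_trace_eq_AE[OF h(1) h(3)]
  have "(LINT x|?\<sigma>. \<bar>boundary_trace (ball 0 1) ?\<sigma> ?v x\<bar>) = (LINT x|?\<sigma>. \<bar>c * a + 0\<bar>)"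
    by (rule integral_cong_AE)
      (use bt in \<open>auto simp: has_trace_def L2_def elim!: eventually_mono\<close>)
  also have "\<dots> = ?A * \<bar>c * a\<bar>" by (simp only: integral_sphere_const add_0_right)
  finally have T: "(LINT x|?\<sigma>. \<bar>boundary_trace (ball 0 1) ?\<sigma> ?v x\<bar>)\<^sup>2 = c\<^sup>2 * (?A * a)\<^sup>2"
    by (simp add: power_mult_distrib mult_ac)
  have mem: "c\<^sup>2 * (LINT x|?L. (norm (wgrad (ball 0 1) u x))\<^sup>2) + 1 / m * (c\<^sup>2 * (?A * a)\<^sup>2) \<in> X"
    unfolding X_def D[symmetric] T[symmetric] using h(1) norm1 by blast
  then have "Inf X \<le> c\<^sup>2 * (LINT x|?L. (norm (wgrad (ball 0 1) u x))\<^sup>2) + 1 / m * (c\<^sup>2 * (?A * a)\<^sup>2)"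
    using bdd by (rule cInf_lower)
  also have "\<dots> = ((LINT x|?L. (norm (wgrad (ball 0 1) u x))\<^sup>2) + (?A * a)\<^sup>2 / m) / N"
    by (simp add: c add_divide_distrib)
  finally show "lambda_m (ball 0 1) ?\<sigma> m * (LINT x|?L. (u x)\<^sup>2)
      \<le> (LINT x|?L. (norm (wgrad (ball 0 1) u x))\<^sup>2) + (?A * a)\<^sup>2 / m"
    using N by (simp add: lam N_def[symmetric] pos_le_divide_eq)
  show "0 \<le> lambda_m (ball 0 1) ?\<sigma> m"
    unfolding lam using mem nonneg by (intro cInf_greatest) auto
qed

text \<open>A vanishing trace makes the integrand of the boundary term vanish, for whatever value of the threshold; any other
  constant is a nearly constant trace.\<close>

lemma minimizer_energy:
  fixes u :: "'a::euclidean_space \<Rightarrow> real"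
  defines "A \<equiv> measure (sphere_measure :: 'a measure) (sphere 0 1)"
  assumes mini: "minimizer (ball 0 1) sphere_measure lmin m u" and tr: "has_trace (ball 0 1) sphere_measure u (\<lambda>_. a)"
    and m: "m > 0" and l: "lmin \<ge> 0"
  shows "rayleigh_quotient (ball 0 1) sphere_measure lmin m u * (LINT x|ballM. (u x)\<^sup>2)
      = (LINT x|ballM. (norm (wgrad (ball 0 1) u x))\<^sup>2) + (A * a)\<^sup>2 / (lmin * A + m)"
proof -
  let ?\<sigma> = "sphere_measure :: 'a measure"
  have u: "u \<in> H1 (ball 0 1)" "nonzero (ball 0 1) u" using mini by (auto simp: minimizer_def)
  note bt = boundary_trace_eq_AE[OF u(1) tr]
  have bL: "L2 ?\<sigma> (boundary_trace (ball 0 1) ?\<sigma> u)" using bt(1) by (simp add: has_trace_def)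
  have A: "A > 0" unfolding A_def by (rule measure_sphere_pos)
  have "boundary_term ?\<sigma> lmin m (boundary_trace (ball 0 1) ?\<sigma> u) = (A * a)\<^sup>2 / (lmin * A + m)"
  proof (cases "a = 0")
    case True
    have "boundary_term ?\<sigma> lmin m (boundary_trace (ball 0 1) ?\<sigma> u) = 0"
      unfolding boundary_term_def
      by (rule integral_eq_zero_AE) (use bt(2) True in \<open>auto elim!: eventually_mono\<close>)
    then show ?thesis using True by simp
  next
    case False
    have "0 \<le> m / (2 * (lmin * A + m)) * \<bar>a\<bar>"
      using m l A by (intro mult_nonneg_nonneg divide_nonneg_nonneg) auto
    then have "boundary_term ?\<sigma> lmin m (boundary_trace (ball 0 1) ?\<sigma> u)
        = (LINT x|?\<sigma>. a)\<^sup>2 / (lmin * measure ?\<sigma> (sphere 0 1) + m)"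
      using boundary_term_nearly_constant[OF bL bt(2) continuous_on_const m l False] by (simp add: A_def)
    then show ?thesis by (simp only: integral_sphere_const A_def)
  qed
  moreover have "0 < (LINT x|ballM. (u x)\<^sup>2)"
    by (rule square_integral_pos[OF H1_wgrad(1)[OF u(1)] u(2)])
  ultimately show ?thesis
    by (simp add: rayleigh_quotient_def)
qed

text \<open>As long as the perturbed trace stays close to a constant \<open>a' \<noteq> 0\<close>, the boundary term
  is that of the total mass \<open>lmin A + m\<close>, a quadratic form, and minimality becomes an inequality between
  polynomials in \<open>s\<close>.\<close>

lemma minimizer_perturbation:
  fixes u \<phi> :: "'a::euclidean_space \<Rightarrow> real"
  defines "A \<equiv> measure (sphere_measure :: 'a measure) (sphere 0 1)"
  assumes mini: "minimizer (ball 0 1) sphere_measure lmin m u" and tr: "has_trace (ball 0 1) sphere_measure u (\<lambda>_. a)"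
    and m: "m > 0" and l: "lmin \<ge> 0" and \<phi>: "smooth \<phi>" and a': "a' \<noteq> 0"
    and near: "\<And>x. x \<in> sphere 0 1 \<Longrightarrow> \<bar>a + s * \<phi> x - a'\<bar> \<le> m / (2 * (lmin * A + m)) * \<bar>a'\<bar>"
  shows "rayleigh_quotient (ball 0 1) sphere_measure lmin m u
        * ((LINT x|ballM. (u x)\<^sup>2) + 2 * s * (LINT x|ballM. u x * \<phi> x)
          + s\<^sup>2 * (LINT x|ballM. (\<phi> x)\<^sup>2))
      \<le> (LINT x|ballM. (norm (wgrad (ball 0 1) u x))\<^sup>2)
        + 2 * s * (LINT x|ballM. wgrad (ball 0 1) u x \<bullet> grad \<phi> x)
        + s\<^sup>2 * (LINT x|ballM. (norm (grad \<phi> x))\<^sup>2)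
        + (A * a + s * (LINT x|sphere_measure. \<phi> x))\<^sup>2 / (lmin * A + m)"
proof -
  let ?L = "ballM :: 'a measure" and ?\<sigma> = "sphere_measure :: 'a measure" and ?B = "ball (0::'a) 1"
  let ?R = "rayleigh_quotient ?B ?\<sigma> lmin m"
  let ?w = "\<lambda>x. 1 * u x + s * \<phi> x"
  have u: "u \<in> H1 ?B" using mini by (auto simp: minimizer_def)
  have s\<phi>: "smooth (\<lambda>x. s * \<phi> x)" by (intro smooth_mult smooth_const \<phi>)
  have gs\<phi>: "grad (\<lambda>x. s * \<phi> x) x = s *\<^sub>R grad \<phi> x" for x
    by (simp add: grad_mult[OF smooth_const \<phi>])
  note h = has_trace_add_scaled[OF u tr s\<phi>, of 1]
  note bt = boundary_trace_eq_AE[OF h(1) h(3)]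
  have bL: "L2 ?\<sigma> (boundary_trace ?B ?\<sigma> ?w)" using bt(1) by (simp add: has_trace_def)
  have A: "A > 0" unfolding A_def by (rule measure_sphere_pos)
  have "boundary_term ?\<sigma> lmin m (boundary_trace ?B ?\<sigma> ?w)
      = (LINT x|?\<sigma>. 1 * a + s * \<phi> x)\<^sup>2 / (lmin * measure ?\<sigma> (sphere 0 1) + m)"
  proof (rule boundary_term_nearly_constant[OF bL bt(2) _ m l a'])
    show "continuous_on UNIV (\<lambda>x. 1 * a + s * \<phi> x)"
      by (intro continuous_intros smooth_continuous_on \<phi>)
  qed (use near in \<open>simp add: A_def\<close>)
  also have "(LINT x|?\<sigma>. 1 * a + s * \<phi> x) = A * a + s * (LINT x|?\<sigma>. \<phi> x)"
  proof -
    have "integrable ?\<sigma> (\<lambda>_. a)" "integrable ?\<sigma> \<phi>"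
      by (intro continuous_sphere_integrable continuous_intros smooth_continuous_on \<phi>)+
    then have "(LINT x|?\<sigma>. 1 * a + s * \<phi> x) = (LINT x|?\<sigma>. a) + s * (LINT x|?\<sigma>. \<phi> x)"
      by simp
    then show ?thesis by (simp only: integral_sphere_const A_def)
  qed
  finally have BT: "boundary_term ?\<sigma> lmin m (boundary_trace ?B ?\<sigma> ?w)
      = (A * a + s * (LINT x|?\<sigma>. \<phi> x))\<^sup>2 / (lmin * A + m)"
    by (simp add: A_def)
  have D: "(LINT x|?L. (norm (wgrad ?B ?w x))\<^sup>2)
      = (LINT x|?L. (norm (wgrad ?B u x))\<^sup>2) + 2 * s * (LINT x|?L. wgrad ?B u x \<bullet> grad \<phi> x) + s\<^sup>2 * (LINT x|?L. (norm (grad \<phi> x))\<^sup>2)"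
    using dirichlet_energy_add_scaled[OF u tr s\<phi>, of 1] by (simp add: gs\<phi> power_mult_distrib)
  have N: "(LINT x|?L. (?w x)\<^sup>2) = (LINT x|?L. (u x)\<^sup>2) + 2 * s * (LINT x|?L. u x * \<phi> x) + s\<^sup>2 * (LINT x|?L. (\<phi> x)\<^sup>2)"
  proof -
    have "(LINT x|?L. u x * (s * \<phi> x)) = s * (LINT x|?L. u x * \<phi> x)"
      by (simp add: mult.left_commute)
    then show ?thesis
      using square_integral_add_scaled[OF H1_wgrad(1)[OF u] smooth_L2_ball[OF s\<phi>], of 1]
      by (simp add: power_mult_distrib)
  qed
  have "?R u * (LINT x|?L. (?w x)\<^sup>2) \<le> (LINT x|?L. (norm (wgrad ?B ?w x))\<^sup>2) + boundary_term ?\<sigma> lmin m (boundary_trace ?B ?\<sigma> ?w)"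
  proof (cases "nonzero ?B ?w")
    case True
    then have "?R u \<le> ?R ?w" using mini h(1) by (auto simp: minimizer_def)
    moreover have "0 < (LINT x|?L. (?w x)\<^sup>2)"
      by (rule square_integral_pos[OF H1_wgrad(1)[OF h(1)] True])
    ultimately show ?thesis
      unfolding rayleigh_quotient_def[of _ _ _ _ ?w] by (simp add: pos_le_divide_eq)
  next
    case False
    then have "(LINT x|?L. (?w x)\<^sup>2) = 0"
      by (intro integral_eq_zero_AE) (auto simp: nonzero_def)
    moreover have "0 \<le> (A * a + s * (LINT x|?\<sigma>. \<phi> x))\<^sup>2 / (lmin * A + m)"
      using l m A by simp
    ultimately show ?thesis unfolding BT by simp
  qed
  then show ?thesis unfolding D N BT by simp
qed

text \<open>Add the inequalities for the perturbations by \<open>\<epsilon> \<phi>\<close> and by \<open>- \<epsilon> \<phi>\<close>: the terms of first order cancel.\<close>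

lemma minimizer_second_variation:
  fixes u \<phi> :: "'a::euclidean_space \<Rightarrow> real"
  defines "A \<equiv> measure (sphere_measure :: 'a measure) (sphere 0 1)"
  assumes mini: "minimizer (ball 0 1) sphere_measure lmin m u" and tr: "has_trace (ball 0 1) sphere_measure u (\<lambda>_. a)"
    and m: "m > 0" and l: "lmin \<ge> 0" and \<phi>: "smooth \<phi>" and a: "a \<noteq> 0"
  shows "rayleigh_quotient (ball 0 1) sphere_measure lmin m u * (LINT x|ballM. (\<phi> x)\<^sup>2)
      \<le> (LINT x|ballM. (norm (grad \<phi> x))\<^sup>2) + (LINT x|sphere_measure. \<phi> x)\<^sup>2 / (lmin * A + m)"
proof -
  let ?L = "ballM :: 'a measure" and ?\<sigma> = "sphere_measure :: 'a measure" and ?B = "ball (0::'a) 1"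
  define \<delta> where "\<delta> = m / (2 * (lmin * A + m))"
  have A: "A > 0" unfolding A_def by (rule measure_sphere_pos)
  have M: "lmin * A + m > 0" using A l m by (simp add: add_nonneg_pos)
  have \<delta>: "\<delta> > 0" unfolding \<delta>_def using M m by simp
  obtain C where C: "C > 0" "\<And>x. x \<in> cball 0 1 \<Longrightarrow> norm (\<phi> x) \<le> C"
    using continuous_bounded_ball[OF smooth_continuous_on[OF \<phi>]] by blast
  define \<epsilon> where "\<epsilon> = \<delta> * \<bar>a\<bar> / C"
  have \<epsilon>: "\<epsilon> > 0" unfolding \<epsilon>_def using \<delta> a C by simp
  have near: "\<bar>a + s * \<phi> x - a\<bar> \<le> m / (2 * (lmin * A + m)) * \<bar>a\<bar>" if "\<bar>s\<bar> = \<epsilon>" "x \<in> sphere 0 1" for s x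
  proof -
    have "\<bar>a + s * \<phi> x - a\<bar> = \<epsilon> * \<bar>\<phi> x\<bar>" using that by (simp add: abs_mult)
    also have "\<dots> \<le> \<epsilon> * C" using C(2)[of x] that \<epsilon> by (intro mult_left_mono) auto
    also have "\<dots> = \<delta> * \<bar>a\<bar>" using C by (simp add: \<epsilon>_def)
    finally show ?thesis by (simp add: \<delta>_def)
  qed
  define q D N X P Y E T M where "q = rayleigh_quotient ?B ?\<sigma> lmin m u" and "D = (LINT x|?L. (norm (wgrad ?B u x))\<^sup>2)"
    and "N = (LINT x|?L. (u x)\<^sup>2)" and "X = (LINT x|?L. u x * \<phi> x)" and "P = (LINT x|?L. (\<phi> x)\<^sup>2)"
    and "Y = (LINT x|?L. wgrad ?B u x \<bullet> grad \<phi> x)" and "E = (LINT x|?L. (norm (grad \<phi> x))\<^sup>2)"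
    and "T = (LINT x|?\<sigma>. \<phi> x)" and "M = lmin * A + m"
  have ineq: "q * (N + 2 * s * X + s\<^sup>2 * P) \<le> D + 2 * s * Y + s\<^sup>2 * E + (A * a + s * T)\<^sup>2 / M" if "\<bar>s\<bar> = \<epsilon>" for s
    using minimizer_perturbation[OF mini tr m l \<phi> a, of s] near[OF that]
    unfolding A_def q_def D_def N_def X_def P_def Y_def E_def T_def M_def by blast
  have eq: "q * N = D + (A * a)\<^sup>2 / M"
    using minimizer_energy[OF mini tr m l] unfolding A_def q_def D_def N_def M_def .
  have expand: "(A * a + s * T)\<^sup>2 / M = (A * a)\<^sup>2 / M + 2 * s * (A * a * T / M) + s\<^sup>2 * (T\<^sup>2 / M)" for s
    by (simp add: power2_sum power_mult_distrib add_divide_distrib algebra_simps)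
  have abs_eps: "\<bar>\<epsilon>\<bar> = \<epsilon>" "\<bar>- \<epsilon>\<bar> = \<epsilon>" using \<epsilon> by simp_all
  have left: "q * (N + 2 * \<epsilon> * X + \<epsilon>\<^sup>2 * P) + q * (N + 2 * (- \<epsilon>) * X + (- \<epsilon>)\<^sup>2 * P) = 2 * (q * N) + 2 * (\<epsilon>\<^sup>2 * (q * P))"
    by (simp add: algebra_simps)
  have right: "(D + 2 * \<epsilon> * Y + \<epsilon>\<^sup>2 * E + (A * a + \<epsilon> * T)\<^sup>2 / M) + (D + 2 * (- \<epsilon>) * Y + (- \<epsilon>)\<^sup>2 * E + (A * a + (- \<epsilon>) * T)\<^sup>2 / M)
      = 2 * (D + (A * a)\<^sup>2 / M) + 2 * (\<epsilon>\<^sup>2 * (E + T\<^sup>2 / M))"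
    unfolding expand by (simp add: algebra_simps)
  have "2 * (\<epsilon>\<^sup>2 * (q * P)) \<le> 2 * (\<epsilon>\<^sup>2 * (E + T\<^sup>2 / M))"
    using add_mono[OF ineq[OF abs_eps(1)] ineq[OF abs_eps(2)]] unfolding left right eq by (rule add_le_imp_le_left)
  then have "q * P \<le> E + T\<^sup>2 / M" using \<epsilon> by simp
  then show ?thesis by (simp add: q_def P_def E_def T_def M_def)
qed

text \<open>For zero trace the boundary term is of second order in the perturbation, so the remaining terms
  of first order, from the Dirichlet energy and the norm, cancel. The test function may be nonzero on the sphere, which makes this the
  Neumann equation.\<close>

lemma minimizer_zero_trace_neumann:
  fixes u \<psi> :: "'a::euclidean_space \<Rightarrow> real"
  assumes mini: "minimizer (ball 0 1) sphere_measure lmin m u" and tr: "has_trace (ball 0 1) sphere_measure u (\<lambda>_. 0)"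
    and m: "m > 0" and l: "lmin \<ge> 0" and \<psi>: "smooth \<psi>"
  shows "(LINT x|ballM. wgrad (ball 0 1) u x \<bullet> grad \<psi> x)
      = rayleigh_quotient (ball 0 1) sphere_measure lmin m u * (LINT x|ballM. u x * \<psi> x)"
proof -
  let ?L = "ballM :: 'a measure" and ?\<sigma> = "sphere_measure :: 'a measure" and ?B = "ball (0::'a) 1"
  define A where "A = measure ?\<sigma> (sphere 0 1)"
  define q where "q = rayleigh_quotient ?B ?\<sigma> lmin m u"
  define M where "M = lmin * A + m"
  define \<delta> where "\<delta> = m / (2 * M)"
  have A: "A > 0" unfolding A_def by (rule measure_sphere_pos)
  have M: "M > 0" unfolding M_def using A l m by (simp add: add_nonneg_pos)
  have \<delta>: "\<delta> > 0" unfolding \<delta>_def using M m by simp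
  have u: "u \<in> H1 ?B" using mini by (auto simp: minimizer_def)
  have ui: "integrable ?L u" by (rule L2_ball_integrable[OF H1_wgrad(1)[OF u]])
  have linear_term_zero: "p = 0" if "\<And>s. s \<noteq> 0 \<Longrightarrow> 2 * s * p \<le> s\<^sup>2 * r" for p r :: real
  proof (rule ccontr)
    assume p: "p \<noteq> 0"
    define s where "s = p / (\<bar>r\<bar> + 1)"
    have s: "s \<noteq> 0" "p = s * (\<bar>r\<bar> + 1)" using p by (auto simp: s_def)
    have "2 * s * p = s\<^sup>2 * (2 * \<bar>r\<bar> + 2)" unfolding s(2) by (simp add: power2_eq_square algebra_simps)
    with that[OF s(1)] have "s\<^sup>2 * (2 * \<bar>r\<bar> + 2) \<le> s\<^sup>2 * r" by simp
    then have "2 * \<bar>r\<bar> + 2 \<le> r" using s(1) by simp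
    then show False by linarith
  qed
  \<comment> \<open>Adding a large constant makes the perturbation nearly constant on the sphere, relative to its size.\<close>
  have main: "(LINT x|?L. wgrad ?B u x \<bullet> grad \<phi> x) = q * ((LINT x|?L. u x * \<phi> x) + K * (LINT x|?L. u x))"
    if \<phi>: "smooth \<phi>" and K: "K > 0" and small: "\<And>x. x \<in> sphere 0 1 \<Longrightarrow> \<bar>\<phi> x\<bar> \<le> \<delta> * K" for \<phi> K
  proof -
    let ?\<chi> = "\<lambda>x. \<phi> x + K"
    have \<chi>: "smooth ?\<chi>" by (intro smooth_add smooth_const \<phi>)
    have g\<chi>: "grad ?\<chi> x = grad \<phi> x" for x by (simp add: grad_add[OF \<phi> smooth_const])
    define D N X P Y E T where "D = (LINT x|?L. (norm (wgrad ?B u x))\<^sup>2)"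
      and "N = (LINT x|?L. (u x)\<^sup>2)" and "X = (LINT x|?L. u x * ?\<chi> x)" and "P = (LINT x|?L. (?\<chi> x)\<^sup>2)"
      and "Y = (LINT x|?L. wgrad ?B u x \<bullet> grad ?\<chi> x)" and "E = (LINT x|?L. (norm (grad ?\<chi> x))\<^sup>2)"
      and "T = (LINT x|?\<sigma>. ?\<chi> x)"
    have eq: "q * N = D"
      using minimizer_energy[OF mini tr m l] unfolding q_def D_def N_def by simp
    have "2 * s * (q * X - Y) \<le> s\<^sup>2 * (E + T\<^sup>2 / M - q * P)" if s: "s \<noteq> 0" for s
    proof -
      have near: "\<bar>0 + s * ?\<chi> x - s * K\<bar> \<le> m / (2 * (lmin * A + m)) * \<bar>s * K\<bar>" if "x \<in> sphere 0 1" for x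
      proof -
        have "\<bar>0 + s * ?\<chi> x - s * K\<bar> = \<bar>s\<bar> * \<bar>\<phi> x\<bar>" by (simp add: distrib_left abs_mult)
        also have "\<dots> \<le> \<bar>s\<bar> * (\<delta> * K)" using small[OF that] by (rule mult_left_mono) simp
        also have "\<dots> = \<delta> * \<bar>s * K\<bar>" using K by (simp add: abs_mult)
        finally show ?thesis by (simp add: \<delta>_def M_def)
      qed
      have "q * (N + 2 * s * X + s\<^sup>2 * P) \<le> D + 2 * s * Y + s\<^sup>2 * E + (A * 0 + s * T)\<^sup>2 / M"
        using minimizer_perturbation[OF mini tr m l \<chi>, of "s * K" s] near s K
        unfolding A_def q_def D_def N_def X_def P_def Y_def E_def T_def M_def by simp
      also have "(A * 0 + s * T)\<^sup>2 / M = s\<^sup>2 * (T\<^sup>2 / M)" by (simp add: power_mult_distrib)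
      finally show ?thesis using eq by (simp add: algebra_simps)
    qed
    then have "q * X - Y = 0" by (rule linear_term_zero)
    moreover have "X = (LINT x|?L. u x * \<phi> x) + K * (LINT x|?L. u x)"
    proof -
      have "integrable ?L (\<lambda>x. u x * \<phi> x)"
        by (intro L2_mult_integrable H1_wgrad(1)[OF u] smooth_L2_ball \<phi>)
      then show ?thesis unfolding X_def distrib_left using ui by (simp add: mult.commute)
    qed
    ultimately show ?thesis by (simp add: Y_def g\<chi>)
  qed
  have mean: "q * (LINT x|?L. u x) = 0"
    using main[of "\<lambda>_. 0" 1] \<delta> by simp
  obtain C where C: "C > 0" "\<And>x. x \<in> cball 0 1 \<Longrightarrow> norm (\<psi> x) \<le> C"
    using continuous_bounded_ball[OF smooth_continuous_on[OF \<psi>]] by blast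
  have "(LINT x|?L. wgrad ?B u x \<bullet> grad \<psi> x) = q * ((LINT x|?L. u x * \<psi> x) + C / \<delta> * (LINT x|?L. u x))"
    by (rule main[OF \<psi>]) (use C \<delta> in auto)
  then show ?thesis using mean by (simp add: q_def distrib_left mult.left_commute)
qed

text \<open>The minimizer satisfies the Dirichlet and the Neumann condition. Testing the equation with
  \<open>(x \<bullet> x) ^ Suc k\<close> expresses the moment of order \<open>Suc k\<close> by that of order \<open>k\<close>, and testing with \<open>1\<close> shows
  that the moment of order zero vanishes.\<close>

lemma no_radial_minimizer_zero_trace:
  fixes u :: "'a::euclidean_space \<Rightarrow> real"
  assumes mini: "minimizer (ball 0 1) sphere_measure lmin m u" and tr: "has_trace (ball 0 1) sphere_measure u (\<lambda>_. 0)"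
    and m: "m > 0" and l: "lmin \<ge> 0" and rad: "radially_symmetric (ball 0 1) u"
    and q: "rayleigh_quotient (ball 0 1) sphere_measure lmin m u > 0"
  shows False
proof -
  let ?L = "ballM :: 'a measure" and ?B = "ball (0::'a) 1" and ?q = "rayleigh_quotient (ball (0::'a) 1) sphere_measure lmin m u"
  have u: "u \<in> H1 ?B" "nonzero ?B u" using mini by (auto simp: minimizer_def)
  note neumann = minimizer_zero_trace_neumann[OF mini tr m l]
  have mom: "(LINT x|?L. u x * (x \<bullet> x) ^ k) = 0" for k
  proof (induction k)
    case 0
    then show ?case using neumann[OF smooth_const[of 1]] q by simp
  next
    case (Suc k)
    have "(LINT x|?L. wgrad ?B u x \<bullet> grad (\<lambda>x. (x \<bullet> x) ^ Suc k) x)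
        = (LINT x|?L. 2 * real (Suc k) * (wgrad ?B u x \<bullet> ((x \<bullet> x) ^ k *\<^sub>R x)))"
      unfolding grad_inner_power by (intro Bochner_Integration.integral_cong) simp_all
    also have "\<dots> = 2 * real (Suc k) * (LINT x|?L. wgrad ?B u x \<bullet> ((x \<bullet> x) ^ k *\<^sub>R x))"
      by (rule integral_mult_right_zero)
    also have "(LINT x|?L. wgrad ?B u x \<bullet> ((x \<bullet> x) ^ k *\<^sub>R x)) = 0"
      using H1_zero_trace_moments[OF u(1) tr, of k] unfolding Suc.IH by simp
    finally have "?q * (LINT x|?L. u x * (x \<bullet> x) ^ Suc k) = 0"
      using neumann[OF smooth_power[OF smooth_norm_square], of "Suc k"] by simp
    then show ?case using q by simp
  qed
  show False
    using radial_zero_moments_imp_zero[OF H1_wgrad(1)[OF u(1)] rad mom]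
      square_integral_pos[OF H1_wgrad(1)[OF u(1)] u(2)] by simp
qed

text \<open>Let \<open>v\<close> be an eigenfunction; its mean over the ball vanishes, as \<open>\<mu> \<noteq> 0\<close>. Apply the inequality to smooth
  approximations of \<open>v\<close>, shifted by constants to have mean zero on the sphere. The shifts need not
  converge: replacing them by the shifts to mean zero over the ball only decreases the norm.\<close>

lemma neumann_eigenvalue_ge:
  fixes q M \<mu> :: real
  assumes \<mu>: "neumann_eigenvalue (ball (0::'a::euclidean_space) 1) \<mu>" "\<mu> \<noteq> 0" and q: "q \<ge> 0"
    and var: "\<And>\<phi>. smooth \<phi> \<Longrightarrow> (LINT x|sphere_measure. \<phi> x) = 0 \<Longrightarrow>
      q * (LINT x|(ballM :: 'a measure). (\<phi> x)\<^sup>2) \<le> (LINT x|ballM. (norm (grad \<phi> x))\<^sup>2)"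
  shows "q \<le> \<mu>"
proof -
  let ?L = "ballM :: 'a measure" and ?\<sigma> = "sphere_measure :: 'a measure" and ?B = "ball (0::'a) 1"
  obtain v where v: "v \<in> H1 ?B" "nonzero ?B v"
    and weak: "\<And>w. w \<in> H1 ?B \<Longrightarrow> (LINT x|?L. wgrad ?B v x \<bullet> wgrad ?B w x) = \<mu> * (LINT x|?L. v x * w x)"
    using \<mu>(1) unfolding neumann_eigenvalue_def by blast
  note vL = H1_wgrad(1)[OF v(1)] and GL = H1_wgrad(3)[OF v(1)]
  define V where "V = measure ?L ?B"
  have V: "V > 0"
  proof -
    have "V = measure lborel ?B" unfolding V_def by (simp add: measure_restrict_space)
    then show ?thesis using content_ball_pos[of 1 "0::'a"] by simp
  qed
  have constL: "L2 ?L (\<lambda>_. c)" for c :: real by (intro continuous_L2_ball continuous_intros)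
  have iconst: "(LINT x|?L. c) = V * c" for c :: real by (simp add: V_def)
  have energy: "(LINT x|?L. wgrad ?B v x \<bullet> wgrad ?B v x) = \<mu> * (LINT x|?L. v x * v x)"
    by (rule weak[OF v(1)])
  have mean: "(LINT x|?L. v x * 1) = 0"
  proof -
    note c = wgrad_eq_AE[OF constL smooth_has_weak_gradient[OF smooth_const[of "1::real"]]]
    have "(LINT x|?L. wgrad ?B v x \<bullet> wgrad ?B (\<lambda>_. 1) x) = 0"
      by (rule integral_eq_zero_AE) (use c(2) in \<open>auto elim!: eventually_mono\<close>)
    with weak[OF c(1)] \<mu>(2) show ?thesis by simp
  qed
  note conv = mollify_H1_tendsto[OF v(1)]
  define \<phi> where "\<phi> n = mollify n v" for n
  have \<phi>: "smooth (\<phi> n)" for n unfolding \<phi>_def by (rule conv(1))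
  have i: "integrable ?L (\<lambda>x. (\<phi> n x)\<^sup>2)" "integrable ?L (\<phi> n)" for n
    using smooth_L2_ball[OF \<phi>] L2_ball_integrable[OF smooth_L2_ball[OF \<phi>]] by (auto simp: L2_iff_real)
  have bound: "q * ((LINT x|?L. \<phi> n x * \<phi> n x) - (LINT x|?L. \<phi> n x * 1)\<^sup>2 / V) \<le> (LINT x|?L. grad (\<phi> n) x \<bullet> grad (\<phi> n) x)" for n
  proof -
    let ?A = "measure ?\<sigma> (sphere 0 1)"
    define c where "c = (LINT x|?\<sigma>. \<phi> n x) / ?A"
    let ?\<psi> = "\<lambda>x. \<phi> n x - c"
    have \<psi>: "smooth ?\<psi>" by (intro smooth_diff smooth_const \<phi>)
    have "integrable ?\<sigma> (\<phi> n)" "integrable ?\<sigma> (\<lambda>_. c)"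
      by (intro continuous_sphere_integrable continuous_intros smooth_continuous_on \<phi>)+
    then have "(LINT x|?\<sigma>. ?\<psi> x) = (LINT x|?\<sigma>. \<phi> n x) - (LINT x|?\<sigma>. c)" by simp
    also have "\<dots> = 0"
      unfolding integral_sphere_const using measure_sphere_pos[where 'a='a] by (simp add: c_def)
    finally have "q * (LINT x|?L. (?\<psi> x)\<^sup>2) \<le> (LINT x|?L. (norm (grad ?\<psi> x))\<^sup>2)"
      by (rule var[OF \<psi>])
    also have "\<dots> = (LINT x|?L. grad (\<phi> n) x \<bullet> grad (\<phi> n) x)"
      by (simp add: grad_diff[OF \<phi> smooth_const] power2_norm_eq_inner)
    finally have 1: "q * (LINT x|?L. (?\<psi> x)\<^sup>2) \<le> (LINT x|?L. grad (\<phi> n) x \<bullet> grad (\<phi> n) x)" .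
    \<comment> \<open>The mean over the ball minimizes the distance to the constants.\<close>
    define S where "S = (LINT x|?L. \<phi> n x)"
    have "(LINT x|?L. (?\<psi> x)\<^sup>2) = (LINT x|?L. (\<phi> n x)\<^sup>2 - 2 * c * \<phi> n x + c\<^sup>2)"
      by (intro Bochner_Integration.integral_cong) (auto simp: power2_eq_square algebra_simps)
    also have "\<dots> = (LINT x|?L. (\<phi> n x)\<^sup>2) - 2 * c * S + V * c\<^sup>2"
      using i[of n] L2_ball_integrable[OF constL[of "c\<^sup>2"]] unfolding S_def iconst[symmetric] by simp
    also have "\<dots> \<ge> (LINT x|?L. (\<phi> n x)\<^sup>2) - S\<^sup>2 / V"
    proof -
      have "0 \<le> (S - V * c)\<^sup>2 / V" using V by simp
      also have "\<dots> = S\<^sup>2 / V - 2 * c * S + V * c\<^sup>2"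
        using V by (simp add: power2_eq_square field_simps)
      finally show ?thesis by linarith
    qed
    finally have "(LINT x|?L. \<phi> n x * \<phi> n x) - (LINT x|?L. \<phi> n x * 1)\<^sup>2 / V \<le> (LINT x|?L. (?\<psi> x)\<^sup>2)"
      by (simp add: S_def power2_eq_square)
    from mult_left_mono[OF this q] 1 show ?thesis by linarith
  qed
  have l1: "(\<lambda>n. \<integral>x. \<phi> n x * \<phi> n x \<partial>?L) \<longlonglongrightarrow> (LINT x|?L. v x * v x)"
    unfolding \<phi>_def by (rule L2_tendsto_mult[OF smooth_L2_ball[OF conv(1)] vL smooth_L2_ball[OF conv(1)] vL conv(2) conv(2)])
  have l2: "(\<lambda>n. \<integral>x. \<phi> n x * 1 \<partial>?L) \<longlonglongrightarrow> (LINT x|?L. v x * 1)"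
    unfolding \<phi>_def by (rule L2_tendsto_mult[OF smooth_L2_ball[OF conv(1)] vL constL constL conv(2)]) simp
  have l3: "(\<lambda>n. \<integral>x. grad (\<phi> n) x \<bullet> grad (\<phi> n) x \<partial>?L) \<longlonglongrightarrow> (LINT x|?L. wgrad ?B v x \<bullet> wgrad ?B v x)"
    unfolding \<phi>_def by (rule L2_tendsto_inner[OF grad_L2_ball[OF conv(1)] GL grad_L2_ball[OF conv(1)] GL conv(3) conv(3)])
  have "(\<lambda>n. q * ((LINT x|?L. \<phi> n x * \<phi> n x) - (LINT x|?L. \<phi> n x * 1)\<^sup>2 / V))
      \<longlonglongrightarrow> q * ((LINT x|?L. v x * v x) - (LINT x|?L. v x * 1)\<^sup>2 / V)"
    by (intro tendsto_intros l1 l2) (use V in simp)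
  then have "q * ((LINT x|?L. v x * v x) - (LINT x|?L. v x * 1)\<^sup>2 / V) \<le> (LINT x|?L. wgrad ?B v x \<bullet> wgrad ?B v x)"
    using l3 bound by (intro LIMSEQ_le) auto
  then have "q * (LINT x|?L. v x * v x) \<le> \<mu> * (LINT x|?L. v x * v x)"
    unfolding energy mean by simp
  moreover have "0 < (LINT x|?L. v x * v x)"
    using square_integral_pos[OF vL v(2)] by (simp add: power2_eq_square)
  ultimately show ?thesis by simp
qed

theorem proposition4p1:
  fixes \<Omega> :: "'a::euclidean_space set" and \<sigma> :: "'a measure"
    and m0 mhat lmin m :: real
  assumes "DIM('a) \<ge> 2"
    and "\<Omega> = ball 0 1"
    and "\<sigma> = sphere_measure"
    and "critical_mass \<Omega> \<sigma> m0"
    and "0 < mhat" and "mhat < m0"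
    and "0 \<le> lmin" and "lmin < mhat / measure \<sigma> (frontier \<Omega>)"
    and "m = mhat - lmin * measure \<sigma> (frontier \<Omega>)"
  shows "\<not> (\<exists>u. minimizer \<Omega> \<sigma> lmin m u \<and> radially_symmetric \<Omega> u)"
proof
  let ?B = "ball (0::'a) 1" and ?S = "sphere_measure :: 'a measure" and ?L = "ballM :: 'a measure"
  assume "\<exists>u. minimizer \<Omega> \<sigma> lmin m u \<and> radially_symmetric \<Omega> u"
  then obtain u where mini: "minimizer ?B ?S lmin m u" and rad: "radially_symmetric ?B u"
    using assms(2,3) by blast
  define A where "A = measure ?S (sphere 0 1)"
  have A: "A > 0" unfolding A_def by (rule measure_sphere_pos)
  have frontier: "measure \<sigma> (frontier \<Omega>) = A" using assms(2,3) by (simp add: A_def)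
  have mass: "lmin * A + m = mhat" using assms(9) frontier by simp
  have m: "m > 0" using assms(8,9) A unfolding frontier by (simp add: field_simps)
  define \<mu> where "\<mu> = lambda_m ?B ?S m0"
  define q where "q = rayleigh_quotient ?B ?S lmin m u"
  have m0: "m0 > 0" and \<mu>: "neumann_eigenvalue ?B \<mu>" "\<mu> \<noteq> 0"
    using assms(2-4) by (auto simp: critical_mass_def first_nonzero_neumann_eigenvalue_def \<mu>_def)
  have u: "u \<in> H1 ?B" "nonzero ?B u" using mini by (auto simp: minimizer_def)
  obtain a where tr: "has_trace ?B ?S u (\<lambda>_. a)" using radial_has_trace_const[OF u(1) rad] .
  define D N where "D = (LINT x|?L. (norm (wgrad ?B u x))\<^sup>2)" and "N = (LINT x|?L. (u x)\<^sup>2)"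
  have N: "N > 0" unfolding N_def by (rule square_integral_pos[OF H1_wgrad(1)[OF u(1)] u(2)])
  have energy: "q * N = D + (A * a)\<^sup>2 / mhat"
    using minimizer_energy[OF mini tr m assms(7)] unfolding q_def N_def D_def A_def[symmetric] mass .
  have lam: "\<mu> * N \<le> D + (A * a)\<^sup>2 / m0" and \<mu>_nonneg: "\<mu> \<ge> 0"
    using lambda_m_le[OF u m0 tr] unfolding \<mu>_def N_def D_def A_def by auto
  have mono: "(A * a)\<^sup>2 / m0 \<le> (A * a)\<^sup>2 / mhat"
    using assms(5,6) by (intro divide_left_mono) auto
  have "\<mu> * N \<le> q * N" using lam mono energy by linarith
  then have \<mu>q: "\<mu> \<le> q" using N by simp
  have q: "q > 0" using \<mu>q \<mu>(2) \<mu>_nonneg by linarith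
  show False
  proof (cases "a = 0")
    case True
    with tr have tr0: "has_trace ?B ?S u (\<lambda>_. 0)" by simp
    show False
      by (rule no_radial_minimizer_zero_trace[OF mini tr0 m assms(7) rad q[unfolded q_def]])
  next
    case False
    have "(A * a)\<^sup>2 / m0 < (A * a)\<^sup>2 / mhat"
      using assms(5,6) A False m0 by (intro divide_strict_left_mono) auto
    then have "\<mu> * N < q * N" using lam energy by linarith
    then have "\<mu> < q" using N by simp
    moreover have "q \<le> \<mu>"
    proof (rule neumann_eigenvalue_ge[OF \<mu>])
      show "q \<ge> 0" using q by simp
      fix \<phi> :: "'a \<Rightarrow> real" assume "smooth \<phi>" "(LINT x|?S. \<phi> x) = 0"
      then show "q * (LINT x|?L. (\<phi> x)\<^sup>2) \<le> (LINT x|?L. (norm (grad \<phi> x))\<^sup>2)"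
        using minimizer_second_variation[OF mini tr m assms(7) _ False, of \<phi>] by (simp add: q_def)
    qed
    ultimately show False by simp
  qed
qed

end
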